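(* The Mellin--Bergman transform $$M_\Delta: A^2(\Delta)\to\mathcal{H}$$ is a surjective isometry. The space $\mathcal{H}$ consists of holomorphic functions on $\mathcal{R}$ that are of exponential type at most $\pi/2$, and the polynomials are dense in $\mathcal{H}$. Moreover, $\mathcal{H}$ is a Hilbert space with reproducing kernel $$H(z,w)=\frac1{2\pi}\,\frac{\Gamma(z+\overline w)}{\Gamma(1+z)\Gamma(1+\overline w)}.$$
   Context: $\Delta=\{\zeta\in\mathbf{C}:|\zeta-1|<1\}$; $A^2(\Delta)$ is the (unweighted) Bergman space of holomorphic functions $f$ on $\Delta$ with $\|f\|_{A^2(\Delta)}^2=\frac1\pi\iint_\Delta|f(\zeta)|^2\,dA(\zeta)<\infty$ ($dA$ Lebesgue measure). $\mathcal{R}=\{z\in\mathbf{C}:\Re z>0\}$ and $\overline{\mathcal{R}}$ is its closure. For $f\in A^2(\Delta)$ and $z\in\mathcal{R}$, the Mellin--Bergman transform is $M_\Delta f(z)=\frac1\pi\iint_\Delta f(\zeta)\,\overline{\zeta}^{\,z-1}\,dA(\zeta)$ (principal branch of powers). For $0<b<\infty$, $S_b=\{x+iy:0<x<b\}$ and $H^2(S_b)$ is the space of holomorphic $f$ on $S_b$ with $\sup_{0<x<b}\int_{-\infty}^{+\infty}|f(x+iy)|^2\,dy<\infty$; for such $f$ the functions $f(x+i\cdot)$ have a limit in $L^2(\mathbf{R})$ as $x\to0^+$ (boundary values on the imaginary axis). Let $\omega=\sum_{n=0}^{+\infty}\frac{2^n}{n!}\,\delta_{n/2}(x)\otimes dy$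 on $\overline{\mathcal{R}}$. The space $\mathcal{M}^2_\omega(\mathcal{R})$ consists of the holomorphic functions $f$ on $\mathcal{R}$ such that $f\in H^2(S_b)$ for every $0<b<\infty$ and $f\in L^2(\overline{\mathcal{R}},d\omega)$ (with $f$ on the imaginary axis understood as its boundary values), with norm $$\|f\|_{\mathcal{M}^2_\omega(\mathcal{R})}^2=\sum_{n=0}^{+\infty}\frac{2^n}{n!}\int_{-\infty}^{+\infty}|f(\tfrac n2+iy)|^2\,dy.$$ $\mathcal{H}$ is the space of holomorphic functions $g$ on $\mathcal{R}$ such that $\frac{\Gamma(1+z)}{2^z}g(z)\in\mathcal{M}^2_\omega(\mathcal{R})$, with norm $$\|g\|_{\mathcal{H}}^2=\Big\|\frac{\Gamma(1+z)}{2^z}g\Big\|^2_{\mathcal{M}^2_\omega(\mathcal{R})}=\sum_{n=0}^{+\infty}\int_{-\infty}^{+\infty}|g(\tfrac n2+iy)|^2\frac{|\Gamma(\frac n2+1+iy)|^2}{\Gamma(n+1)}\,dy .$$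
   Formalization: With the given norms the surjective isometry is M_Δ/√(2π), not M_Δ (for f=1 the squared norms are 1 and 2π); exponential type at most π/2 means |g(z)| ≤ C e^{(π/2+ε)|z|} on each half-plane Re z ≥ δ > 0, since a bound uniform up to the imaginary axis fails. *)

theory Defs
  imports "HOL-Complex_Analysis.Complex_Analysis"
begin

text \<open>
  A function on a domain is represented by the total function that vanishes off the domain, so that
  equality of elements of a function space is equality of HOL functions.
\<close>

definition zero_ext :: "complex set \<Rightarrow> (complex \<Rightarrow> complex) \<Rightarrow> complex \<Rightarrow> complex" where
  "zero_ext D f = (\<lambda>z. if z \<in> D then f z else 0)"

definition holo_space :: "complex set \<Rightarrow> (complex \<Rightarrow> complex) set" where
  "holo_space D = {f. f holomorphic_on D \<and> (\<forall>z. z \<notin> D \<longrightarrow> f z = 0)}"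

definition right_half_plane :: "complex set" where
  "right_half_plane = {z. Re z > 0}"

definition unit_disc_at_1 :: "complex set" where
  "unit_disc_at_1 = {\<zeta>. cmod (\<zeta> - 1) < 1}"

definition bergman :: "(complex \<Rightarrow> complex) set" where
  "bergman = {f \<in> holo_space unit_disc_at_1.
     set_integrable lborel unit_disc_at_1 (\<lambda>\<zeta>. (cmod (f \<zeta>))\<^sup>2)}"

definition bergman_norm :: "(complex \<Rightarrow> complex) \<Rightarrow> real" where
  "bergman_norm f = sqrt (1 / pi * (LINT \<zeta>:unit_disc_at_1|lborel. (cmod (f \<zeta>))\<^sup>2))"

definition mellin_bergman :: "(complex \<Rightarrow> complex) \<Rightarrow> complex \<Rightarrow> complex" where
  "mellin_bergman f = zero_ext right_half_plane
     (\<lambda>z. 1 / of_real pi * (LINT \<zeta>:unit_disc_at_1|lborel. f \<zeta> * cnj \<zeta> powr (z - 1)))"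

definition strip :: "real \<Rightarrow> complex set" where
  "strip b = {z. 0 < Re z \<and> Re z < b}"

definition hardy_strip :: "real \<Rightarrow> (complex \<Rightarrow> complex) set" where
  "hardy_strip b = {f. f holomorphic_on strip b \<and>
     (SUP x\<in>{0<..<b}. \<integral>\<^sup>+y. ennreal ((cmod (f (Complex x y)))\<^sup>2) \<partial>lborel) < \<infinity>}"

text \<open>
  The boundary function is determined only up to a null set; everything below depends on it only
  through integrals.
\<close>

definition boundary_value :: "(complex \<Rightarrow> complex) \<Rightarrow> real \<Rightarrow> complex" where
  "boundary_value f = (SOME \<phi>. \<phi> \<in> borel_measurable lborel \<and>
     ((\<lambda>x. \<integral>\<^sup>+y. ennreal ((cmod (f (Complex x y) - \<phi> y))\<^sup>2) \<partial>lborel) \<longlongrightarrow> 0) (at_right 0))"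

definition with_boundary :: "(complex \<Rightarrow> complex) \<Rightarrow> complex \<Rightarrow> complex" where
  "with_boundary f z = (if Re z = 0 then boundary_value f (Im z) else f z)"

definition omega :: "complex measure" where
  "omega = distr (density (count_space (UNIV :: nat set)) (\<lambda>n. ennreal (2 ^ n / fact n)) \<Otimes>\<^sub>M lborel)
     borel (\<lambda>(n, y). Complex (real n / 2) y)"

definition M2_omega :: "(complex \<Rightarrow> complex) set" where
  "M2_omega = {f \<in> holo_space right_half_plane. (\<forall>b>0. f \<in> hardy_strip b) \<and>
     with_boundary f \<in> borel_measurable omega \<and>
     integrable omega (\<lambda>z. (cmod (with_boundary f z))\<^sup>2)}"

definition M2_omega_norm :: "(complex \<Rightarrow> complex) \<Rightarrow> real" where
  "M2_omega_norm f = sqrt (\<Sum>n. 2 ^ n / fact n *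
     (LINT y|lborel. (cmod (with_boundary f (Complex (real n / 2) y)))\<^sup>2))"

definition M2_omega_inner :: "(complex \<Rightarrow> complex) \<Rightarrow> (complex \<Rightarrow> complex) \<Rightarrow> complex" where
  "M2_omega_inner f g = (\<Sum>n. 2 ^ n / fact n *
     (LINT y|lborel. with_boundary f (Complex (real n / 2) y) *
        cnj (with_boundary g (Complex (real n / 2) y))))"

definition gamma_mult :: "(complex \<Rightarrow> complex) \<Rightarrow> complex \<Rightarrow> complex" where
  "gamma_mult g = (\<lambda>z. Gamma (1 + z) / 2 powr z * g z)"

definition H_space :: "(complex \<Rightarrow> complex) set" where
  "H_space = {g \<in> holo_space right_half_plane. gamma_mult g \<in> M2_omega}"

text \<open>
  With these normalizations, the transform fixes the constant function 1 on the domain, whose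
  Bergman norm is 1, whereas
  \<open>H_norm 1 ^ 2 = (\<Sum>n. (\<integral>y. |Gamma (n / 2 + 1 + i y)|^2) / n!) = (\<Sum>n. 2 * pi * (n + 1) / 2 ^ (n + 2)) = 2 * pi\<close>.
  It is therefore the transform divided by \<open>sqrt (2 * pi)\<close> that preserves norms. The factor
  \<open>1 / (2 * pi)\<close> in the reproducing kernel is the correct one for \<open>H_norm\<close>.
\<close>

definition H_norm :: "(complex \<Rightarrow> complex) \<Rightarrow> real" where
  "H_norm g = M2_omega_norm (gamma_mult g)"

definition H_inner :: "(complex \<Rightarrow> complex) \<Rightarrow> (complex \<Rightarrow> complex) \<Rightarrow> complex" where
  "H_inner g h = M2_omega_inner (gamma_mult g) (gamma_mult h)"

definition surjective_isometry ::
  "('a \<Rightarrow> complex) set \<Rightarrow> (('a \<Rightarrow> complex) \<Rightarrow> real) \<Rightarrow> ('b \<Rightarrow> complex) set \<Rightarrow>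
   (('b \<Rightarrow> complex) \<Rightarrow> real) \<Rightarrow> (('a \<Rightarrow> complex) \<Rightarrow> ('b \<Rightarrow> complex)) \<Rightarrow> bool" where
  "surjective_isometry V nV W nW T \<longleftrightarrow>
     (\<forall>f\<in>V. \<forall>g\<in>V. \<forall>a b. T (\<lambda>z. a * f z + b * g z) = (\<lambda>z. a * T f z + b * T g z)) \<and>
     T ` V = W \<and>
     (\<forall>f\<in>V. nW (T f) = nV f)"

text \<open>
  A function on the right half-plane that is merely square integrable at the boundary may be
  unbounded near points of the imaginary axis (the reproducing kernel blows up there on the
  diagonal), so the exponential bound is required uniformly on each closed half-plane
  \<open>Re z \<ge> \<delta>\<close> with \<open>\<delta> > 0\<close>.
\<close>

definition exponential_type_at_most :: "real \<Rightarrow> (complex \<Rightarrow> complex) \<Rightarrow> bool" where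
  "exponential_type_at_most \<tau> g \<longleftrightarrow>
     (\<forall>\<delta>>0. \<forall>\<epsilon>>0. \<exists>C. \<forall>z. Re z \<ge> \<delta> \<longrightarrow> cmod (g z) \<le> C * exp ((\<tau> + \<epsilon>) * cmod z))"

definition complex_hilbert_space ::
  "('a \<Rightarrow> complex) set \<Rightarrow> (('a \<Rightarrow> complex) \<Rightarrow> ('a \<Rightarrow> complex) \<Rightarrow> complex) \<Rightarrow>
   (('a \<Rightarrow> complex) \<Rightarrow> real) \<Rightarrow> bool" where
  "complex_hilbert_space V ip nrm \<longleftrightarrow>
     (\<lambda>x. 0) \<in> V \<and>
     (\<forall>f\<in>V. \<forall>g\<in>V. \<forall>a b. (\<lambda>x. a * f x + b * g x) \<in> V) \<and>
     (\<forall>f\<in>V. \<forall>g\<in>V. \<forall>h\<in>V. \<forall>a b. ip (\<lambda>x. a * f x + b * g x) h = a * ip f h + b * ip g h) \<and>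
     (\<forall>f\<in>V. \<forall>g\<in>V. ip g f = cnj (ip f g)) \<and>
     (\<forall>f\<in>V. 0 \<le> nrm f \<and> ip f f = of_real ((nrm f)\<^sup>2) \<and> (nrm f = 0 \<longrightarrow> f = (\<lambda>x. 0))) \<and>
     (\<forall>s. (\<forall>n. s n \<in> V) \<and>
          (\<forall>\<epsilon>>0. \<exists>N::nat. \<forall>m\<ge>N. \<forall>n\<ge>N. nrm (\<lambda>x. s m x - s n x) < \<epsilon>) \<longrightarrow>
          (\<exists>l\<in>V. (\<lambda>n. nrm (\<lambda>x. s n x - l x)) \<longlonglongrightarrow> 0))"

definition reproducing_kernel ::
  "complex set \<Rightarrow> (complex \<Rightarrow> complex) set \<Rightarrow>
   ((complex \<Rightarrow> complex) \<Rightarrow> (complex \<Rightarrow> complex) \<Rightarrow> complex) \<Rightarrow>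
   (complex \<Rightarrow> complex \<Rightarrow> complex) \<Rightarrow> bool" where
  "reproducing_kernel D V ip K \<longleftrightarrow>
     (\<forall>w\<in>D. zero_ext D (\<lambda>z. K z w) \<in> V \<and> (\<forall>f\<in>V. f w = ip f (zero_ext D (\<lambda>z. K z w))))"

end

theory Submission
  imports Defs
begin

text \<open>
  Expanding about the centre, \<open>f = \<Sum>n. a n * (\<zeta> - 1) ^ n\<close>, the Bergman norm becomes
  \<open>\<Sum>n. |a n|^2 / (n + 1)\<close>. The transform pairs \<open>f\<close> with the power \<open>\<zeta> powr (cnj z - 1)\<close>, whose Taylor
  coefficients are generalized binomial coefficients, so it sends \<open>f\<close> to the Newton series
  \<open>\<Sum>n. a n / (n + 1) * ((z - 1) gchoose n)\<close>. Hence the theorem amounts to two facts: the polynomials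
  \<open>newton n z = ((z - 1) gchoose n) / sqrt (2 * pi * (n + 1))\<close> are orthonormal in \<open>H_space\<close>, and
  they are complete there. Both are read off from the reproducing formula, which therefore comes first.

  \<^emph>\<open>Reproducing formula.\<close> On the line \<open>Re z = n / 2\<close> one has \<open>cnj z = n - z\<close>, so the integrand of the
  \<open>n\<close>-th term of the inner product of \<open>g\<close> with the kernel at \<open>w\<close> is, up to a constant, the
  holomorphic function \<open>Gamma (1 + z) * g z * Gamma (w + n - z) / n!\<close>. All these lines can be moved
  to a single line \<open>Re z = c\<close> with \<open>0 < c < Re w\<close>, where the sum over \<open>n \<le> N\<close> telescopes to
  \<open>Gamma (w + N + 1 - z) / (N! * (w - z))\<close> (\<open>sum_Gamma_over_fact\<close>). Now the line is moved to
  \<open>Re z = (N + 1) / 2\<close>: it crosses the only pole \<open>z = w\<close>, whose residue yields the value \<open>g w\<close>, and the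
  integral left over tends to \<open>0\<close> (\<open>partial_sum_residue\<close>, \<open>remainder_tendsto_0\<close>).

  \<^emph>\<open>Analysis on strips.\<close> Shifting the line in the inner product of two vertical sections of a Hardy
  function shows that this product depends only on the sum of the two abscissas
  (\<open>hardy_strip_inner\<close>). So the squared norm of the sections is midpoint convex in the abscissa. This
  gives the boundary values, and it bounds every section by those on the half-integer
  lines. The same shift for the Gamma function yields the recursion \<open>Gamma_line_sq_shift\<close>, by which
  the kernel functions lie in \<open>H_space\<close>.

  \<^emph>\<open>Orthonormality.\<close> The kernel at the integer \<open>n + 1\<close> is a polynomial of degree \<open>n\<close>, so the inner
  product with a polynomial of degree at most \<open>n\<close> only involves values at \<open>1, \<dots>, n + 1\<close>. As
  \<open>newton n\<close> vanishes at \<open>1, \<dots>, n\<close>, orthonormality is immediate (\<open>newton_orthonormal\<close>).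

  \<^emph>\<open>Completeness.\<close> For real \<open>0 < x < 1\<close>, Gauss's evaluation of a hypergeometric series at \<open>1\<close> says
  that the Parseval identity holds for the kernel at \<open>x\<close>; so that kernel is a limit of polynomials,
  and a function orthogonal to all polynomials vanishes on \<open>(0, 1)\<close>, hence everywhere
  (\<open>newton_complete\<close>).

  \<^emph>\<open>Exponential type.\<close> By Cauchy-Schwarz a transform at \<open>z\<close> is bounded by the Bergman norm of
  \<open>\<zeta> powr (cnj z - 1)\<close>, and \<open>|\<zeta> powr s| \<le> exp (pi / 2 * |s|)\<close> on the disc for \<open>Re s \<ge> 0\<close>.
\<close>

section \<open>Square-integrable functions\<close>

text \<open>
  Elements are functions, not classes modulo null sets: the boundary functions below are chosen
  individually, and identities between them hold almost everywhere.
\<close>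

definition L2 :: "'a measure \<Rightarrow> ('a \<Rightarrow> complex) set" where
  "L2 M = {u \<in> borel_measurable M. integrable M (\<lambda>x. (cmod (u x))\<^sup>2)}"

definition norm_sq :: "'a measure \<Rightarrow> ('a \<Rightarrow> complex) \<Rightarrow> real" where
  "norm_sq M u = (LINT x|M. (cmod (u x))\<^sup>2)"

definition L2_inner :: "'a measure \<Rightarrow> ('a \<Rightarrow> complex) \<Rightarrow> ('a \<Rightarrow> complex) \<Rightarrow> complex" where
  "L2_inner M u v = (LINT x|M. u x * cnj (v x))"

lemma L2_measurable [measurable_dest]: "u \<in> L2 M \<Longrightarrow> u \<in> borel_measurable M"
  by (simp add: L2_def)

lemma L2_integrable: "u \<in> L2 M \<Longrightarrow> integrable M (\<lambda>x. (cmod (u x))\<^sup>2)"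
  by (simp add: L2_def)

lemma norm_sq_nonneg [simp]: "norm_sq M u \<ge> 0"
  by (simp add: norm_sq_def)

lemma nn_integral_norm_sq:
  "u \<in> L2 M \<Longrightarrow> (\<integral>\<^sup>+x. ennreal ((cmod (u x))\<^sup>2) \<partial>M) = ennreal (norm_sq M u)"
  by (simp add: norm_sq_def nn_integral_eq_integral L2_integrable)

lemma L2I_nn_integral:
  assumes "u \<in> borel_measurable M" "(\<integral>\<^sup>+x. ennreal ((cmod (u x))\<^sup>2) \<partial>M) < \<infinity>"
  shows "u \<in> L2 M"
  using assms by (auto simp: L2_def integrable_iff_bounded)

lemma norm_sq_le_nn_integral:
  assumes "u \<in> L2 M" "(\<integral>\<^sup>+x. ennreal ((cmod (u x))\<^sup>2) \<partial>M) \<le> ennreal c" "c \<ge> 0"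
  shows "norm_sq M u \<le> c"
  using assms by (simp add: nn_integral_norm_sq)

lemma L2_mult_integrable:
  assumes "u \<in> L2 M" "v \<in> L2 M"
  shows "integrable M (\<lambda>x. u x * v x)"
proof (rule Bochner_Integration.integrable_bound)
  show "integrable M (\<lambda>x. (cmod (u x))\<^sup>2 + (cmod (v x))\<^sup>2)"
    using assms by (simp add: L2_integrable)
  show "(\<lambda>x. u x * v x) \<in> borel_measurable M"
    using assms[THEN L2_measurable] by measurable
  have "a * b \<le> a\<^sup>2 + b\<^sup>2" for a b :: real
    using sum_squares_bound[of a b] sum_power2_ge_zero[of a b] by linarith
  then show "AE x in M. norm (u x * v x) \<le> norm ((cmod (u x))\<^sup>2 + (cmod (v x))\<^sup>2)"
    by (intro AE_I2) (simp add: norm_mult)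
qed

lemma L2_cnj: "v \<in> L2 M \<Longrightarrow> (\<lambda>x. cnj (v x)) \<in> L2 M"
proof -
  assume v: "v \<in> L2 M"
  have "cnj \<in> borel_measurable borel"
    by (intro borel_measurable_continuous_onI continuous_on_cnj continuous_on_id)
  from measurable_compose[OF L2_measurable[OF v] this] L2_integrable[OF v]
  show ?thesis by (simp add: L2_def)
qed

lemma L2_inner_integrable:
  assumes "u \<in> L2 M" "v \<in> L2 M"
  shows "integrable M (\<lambda>x. u x * cnj (v x))"
  using L2_mult_integrable[OF assms(1) L2_cnj[OF assms(2)]] .

lemma cmod_add_sq_le: "(cmod (a + b))\<^sup>2 \<le> 2 * (cmod a)\<^sup>2 + 2 * (cmod b)\<^sup>2"
proof -
  have "(cmod (a + b))\<^sup>2 \<le> (cmod a + cmod b)\<^sup>2"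
    by (simp add: norm_triangle_ineq power_mono)
  also have "\<dots> \<le> 2 * (cmod a)\<^sup>2 + 2 * (cmod b)\<^sup>2"
    using sum_squares_bound[of "cmod a" "cmod b"] by (simp add: power2_sum)
  finally show ?thesis .
qed

lemma L2_add: "u \<in> L2 M \<Longrightarrow> v \<in> L2 M \<Longrightarrow> (\<lambda>x. u x + v x) \<in> L2 M"
  unfolding L2_def
proof (clarsimp)
  assume *[measurable]: "u \<in> borel_measurable M" "v \<in> borel_measurable M"
    and "integrable M (\<lambda>x. (cmod (u x))\<^sup>2)" "integrable M (\<lambda>x. (cmod (v x))\<^sup>2)"
  then have "integrable M (\<lambda>x. 2 * (cmod (u x))\<^sup>2 + 2 * (cmod (v x))\<^sup>2)" by simp
  then show "integrable M (\<lambda>x. (cmod (u x + v x))\<^sup>2)"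
    by (rule Bochner_Integration.integrable_bound) (auto intro!: AE_I2 cmod_add_sq_le)
qed

lemma L2_mult_left: "u \<in> L2 M \<Longrightarrow> (\<lambda>x. c * u x) \<in> L2 M"
  by (auto simp: L2_def norm_mult power_mult_distrib)

lemma L2_lincomb: "u \<in> L2 M \<Longrightarrow> v \<in> L2 M \<Longrightarrow> (\<lambda>x. a * u x + b * v x) \<in> L2 M"
  by (intro L2_add L2_mult_left)

lemma L2_diff: "u \<in> L2 M \<Longrightarrow> v \<in> L2 M \<Longrightarrow> (\<lambda>x. u x - v x) \<in> L2 M"
  using L2_lincomb[of u M v 1 "-1"] by simp

lemma L2_inner_lincomb_left:
  assumes "u \<in> L2 M" "v \<in> L2 M" "w \<in> L2 M"
  shows "L2_inner M (\<lambda>x. a * u x + b * v x) w = a * L2_inner M u w + b * L2_inner M v w"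
proof -
  have "L2_inner M (\<lambda>x. a * u x + b * v x) w
      = (LINT x|M. a * (u x * cnj (w x)) + b * (v x * cnj (w x)))"
    unfolding L2_inner_def by (simp add: algebra_simps)
  also have "\<dots> = a * L2_inner M u w + b * L2_inner M v w"
    unfolding L2_inner_def using assms by (subst Bochner_Integration.integral_add) (auto simp: L2_inner_integrable)
  finally show ?thesis .
qed

lemma L2_inner_commute: "L2_inner M v u = cnj (L2_inner M u v)"
  unfolding L2_inner_def by (subst Bochner_Integration.integral_cnj[symmetric]) (simp add: mult.commute)

lemma L2_inner_self: "L2_inner M u u = of_real (norm_sq M u)"
  unfolding L2_inner_def norm_sq_def
  by (subst integral_complex_of_real[symmetric]) (simp only: complex_norm_square)

lemma norm_sq_diff:
  assumes "u \<in> L2 M" "v \<in> L2 M"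
  shows "norm_sq M (\<lambda>x. u x - v x) = norm_sq M u + norm_sq M v - 2 * Re (L2_inner M u v)"
proof -
  have pt: "(cmod (a - b))\<^sup>2 = (cmod a)\<^sup>2 + (cmod b)\<^sup>2 - 2 * Re (a * cnj b)" for a b :: complex
    by (simp only: cmod_power2) (simp add: power2_eq_square algebra_simps)
  have "norm_sq M (\<lambda>x. u x - v x)
      = (LINT x|M. ((cmod (u x))\<^sup>2 + (cmod (v x))\<^sup>2) - 2 * Re (u x * cnj (v x)))"
    unfolding norm_sq_def pt ..
  also have "\<dots> = (LINT x|M. (cmod (u x))\<^sup>2 + (cmod (v x))\<^sup>2) - (LINT x|M. 2 * Re (u x * cnj (v x)))"
    using assms by (intro Bochner_Integration.integral_diff Bochner_Integration.integrable_add L2_integrable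
        integrable_mult_right integrable_Re L2_inner_integrable) auto
  also have "(LINT x|M. (cmod (u x))\<^sup>2 + (cmod (v x))\<^sup>2) = norm_sq M u + norm_sq M v"
    unfolding norm_sq_def using assms by (intro Bochner_Integration.integral_add L2_integrable)
  also have "(LINT x|M. 2 * Re (u x * cnj (v x))) = 2 * (LINT x|M. Re (u x * cnj (v x)))"
    by (rule integral_mult_right_zero)
  also have "(LINT x|M. Re (u x * cnj (v x))) = Re (L2_inner M u v)"
    unfolding L2_inner_def by (rule integral_Re[OF L2_inner_integrable[OF assms]])
  finally show ?thesis .
qed

lemma L2_nn_Cauchy_Schwarz:
  assumes "u \<in> L2 M" "v \<in> L2 M"
  shows "(\<integral>\<^sup>+x. ennreal (cmod (u x) * cmod (v x)) \<partial>M) \<le> ennreal (sqrt (norm_sq M u) * sqrt (norm_sq M v))"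
proof -
  have int: "integrable M (\<lambda>x. cmod (u x) * cmod (v x))"
    using integrable_norm[OF L2_mult_integrable[OF assms]] by (simp add: norm_mult)
  define I where "I = (LINT x|M. cmod (u x) * cmod (v x))"
  have I0: "I \<ge> 0" by (simp add: I_def)
  have nI: "(\<integral>\<^sup>+x. ennreal (cmod (u x) * cmod (v x)) \<partial>M) = ennreal I"
    unfolding I_def by (rule nn_integral_eq_integral[OF int]) simp
  have "(\<integral>\<^sup>+x. ennreal (cmod (u x)) * ennreal (cmod (v x)) \<partial>M)\<^sup>2
     \<le> (\<integral>\<^sup>+x. (ennreal (cmod (u x)))\<^sup>2 \<partial>M) * (\<integral>\<^sup>+x. (ennreal (cmod (v x)))\<^sup>2 \<partial>M)"
    using assms[THEN L2_measurable] by (intro Cauchy_Schwarz_nn_integral) auto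
  then have "(ennreal I)\<^sup>2 \<le> ennreal (norm_sq M u) * ennreal (norm_sq M v)"
    using assms nI by (simp add: ennreal_mult ennreal_power nn_integral_norm_sq)
  then have "I\<^sup>2 \<le> norm_sq M u * norm_sq M v"
    using I0 by (simp add: ennreal_power ennreal_mult[symmetric])
  then have "I \<le> sqrt (norm_sq M u) * sqrt (norm_sq M v)"
    by (simp add: real_le_rsqrt real_sqrt_mult[symmetric])
  then show ?thesis unfolding nI by (rule ennreal_leI)
qed

lemma L2_mult_integral_le:
  assumes "u \<in> L2 M" "v \<in> L2 M"
  shows "(LINT x|M. cmod (u x * v x)) \<le> sqrt (norm_sq M u) * sqrt (norm_sq M v)"
proof -
  have "ennreal (LINT x|M. cmod (u x * v x)) = (\<integral>\<^sup>+x. ennreal (cmod (u x * v x)) \<partial>M)"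
    by (rule nn_integral_eq_integral[symmetric]) (use L2_mult_integrable[OF assms] in auto)
  also have "\<dots> \<le> ennreal (sqrt (norm_sq M u) * sqrt (norm_sq M v))"
    using L2_nn_Cauchy_Schwarz[OF assms] by (simp add: norm_mult)
  finally show ?thesis by simp
qed

lemma L2_Cauchy_Schwarz:
  assumes "u \<in> L2 M" "v \<in> L2 M"
  shows "cmod (L2_inner M u v) \<le> sqrt (norm_sq M u) * sqrt (norm_sq M v)"
proof -
  have "cmod (L2_inner M u v) \<le> (LINT x|M. cmod (u x * cnj (v x)))"
    unfolding L2_inner_def by (rule integral_norm_bound)
  also have "\<dots> \<le> sqrt (norm_sq M u) * sqrt (norm_sq M v)"
    using L2_mult_integral_le[OF assms(1) L2_cnj[OF assms(2)]] by (simp add: norm_sq_def)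
  finally show ?thesis .
qed

lemma norm_sq_diff_le:
  assumes "u \<in> L2 M" "v \<in> L2 M" "w \<in> L2 M"
  shows "norm_sq M (\<lambda>x. u x - w x) \<le> 2 * norm_sq M (\<lambda>x. u x - v x) + 2 * norm_sq M (\<lambda>x. v x - w x)"
proof -
  have "norm_sq M (\<lambda>x. u x - w x) \<le> (LINT x|M. 2 * (cmod (u x - v x))\<^sup>2 + 2 * (cmod (v x - w x))\<^sup>2)"
    unfolding norm_sq_def
  proof (rule integral_mono)
    show "(cmod (u x - w x))\<^sup>2 \<le> 2 * (cmod (u x - v x))\<^sup>2 + 2 * (cmod (v x - w x))\<^sup>2" for x
      using cmod_add_sq_le[of "u x - v x" "v x - w x"] by simp
  qed (use assms in \<open>auto intro!: L2_integrable L2_diff Bochner_Integration.integrable_add integrable_mult_right\<close>)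
  also have "\<dots> = 2 * norm_sq M (\<lambda>x. u x - v x) + 2 * norm_sq M (\<lambda>x. v x - w x)"
    unfolding norm_sq_def using assms
    by (subst Bochner_Integration.integral_add) (auto intro!: L2_integrable L2_diff)
  finally show ?thesis .
qed

text \<open>
  Cauchy--Schwarz applied to the three mixed terms in the expansion of the difference.
\<close>

lemma L2_inner_tendsto:
  assumes u: "eventually (\<lambda>i. u i \<in> L2 M) F" "\<phi> \<in> L2 M" "((\<lambda>i. norm_sq M (\<lambda>x. u i x - \<phi> x)) \<longlongrightarrow> 0) F"
    and v: "eventually (\<lambda>i. v i \<in> L2 M) F" "\<psi> \<in> L2 M" "((\<lambda>i. norm_sq M (\<lambda>x. v i x - \<psi> x)) \<longlongrightarrow> 0) F"
  shows "((\<lambda>i. L2_inner M (u i) (v i)) \<longlongrightarrow> L2_inner M \<phi> \<psi>) F"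
proof -
  define e where "e i = sqrt (norm_sq M (\<lambda>x. u i x - \<phi> x))" for i
  define d where "d i = sqrt (norm_sq M (\<lambda>x. v i x - \<psi> x))" for i
  have e0: "(e \<longlongrightarrow> 0) F" unfolding e_def using tendsto_real_sqrt[OF u(3)] by simp
  have d0: "(d \<longlongrightarrow> 0) F" unfolding d_def using tendsto_real_sqrt[OF v(3)] by simp
  have lim: "((\<lambda>i. e i * d i + e i * sqrt (norm_sq M \<psi>) + sqrt (norm_sq M \<phi>) * d i) \<longlongrightarrow> 0) F"
    by (rule tendsto_eq_rhs[OF tendsto_add[OF tendsto_add[OF tendsto_mult[OF e0 d0] tendsto_mult[OF e0 tendsto_const]]
          tendsto_mult[OF tendsto_const d0]]]) simp
  have "((\<lambda>i. L2_inner M (u i) (v i) - L2_inner M \<phi> \<psi>) \<longlongrightarrow> 0) F"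
  proof (rule Lim_null_comparison[OF _ lim])
    show "\<forall>\<^sub>F i in F. norm (L2_inner M (u i) (v i) - L2_inner M \<phi> \<psi>)
        \<le> e i * d i + e i * sqrt (norm_sq M \<psi>) + sqrt (norm_sq M \<phi>) * d i"
      using u(1) v(1)
    proof eventually_elim
      case (elim i)
      define a where "a = (\<lambda>x. u i x - \<phi> x)"
      define b where "b = (\<lambda>x. v i x - \<psi> x)"
      have ab: "a \<in> L2 M" "b \<in> L2 M" unfolding a_def b_def using elim u v by (auto intro: L2_diff)
      have "L2_inner M (u i) (v i) = (LINT x|M. a x * cnj (b x) + a x * cnj (\<psi> x) + \<phi> x * cnj (b x) + \<phi> x * cnj (\<psi> x))"
        unfolding L2_inner_def a_def b_def by (intro Bochner_Integration.integral_cong) (auto simp: algebra_simps)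
      also have "\<dots> = L2_inner M a b + L2_inner M a \<psi> + L2_inner M \<phi> b + L2_inner M \<phi> \<psi>"
        unfolding L2_inner_def using ab u v
        by (simp add: L2_inner_integrable Bochner_Integration.integral_add)
      finally have "norm (L2_inner M (u i) (v i) - L2_inner M \<phi> \<psi>) = norm (L2_inner M a b + L2_inner M a \<psi> + L2_inner M \<phi> b)"
        by simp
      also have "\<dots> \<le> norm (L2_inner M a b) + norm (L2_inner M a \<psi>) + norm (L2_inner M \<phi> b)"
        by (intro norm_triangle_le add_right_mono norm_triangle_ineq)
      also have "\<dots> \<le> e i * d i + e i * sqrt (norm_sq M \<psi>) + sqrt (norm_sq M \<phi>) * d i"
        unfolding e_def d_def a_def[symmetric] b_def[symmetric]
        using ab u v by (intro add_mono L2_Cauchy_Schwarz) auto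
      finally show ?case .
    qed
  qed
  then show ?thesis by (simp add: LIM_zero_iff)
qed

lemma norm_sq_tendsto:
  assumes u: "eventually (\<lambda>i. u i \<in> L2 M) F" "\<phi> \<in> L2 M" "((\<lambda>i. norm_sq M (\<lambda>x. u i x - \<phi> x)) \<longlongrightarrow> 0) F"
  shows "((\<lambda>i. norm_sq M (u i)) \<longlongrightarrow> norm_sq M \<phi>) F"
  using tendsto_Re[OF L2_inner_tendsto[OF u u]] by (simp only: L2_inner_self Re_complex_of_real)

text \<open>
  Norm bounds pass to almost everywhere limits by Fatou's lemma. This identifies limits that are
  known only pointwise.
\<close>

lemma L2_Fatou:
  assumes u: "\<And>k. u k \<in> L2 M" and lim: "AE x in M. (\<lambda>k. u k x) \<longlonglongrightarrow> \<phi> x"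
    and meas: "\<phi> \<in> borel_measurable M" and bound: "eventually (\<lambda>k. norm_sq M (u k) \<le> c) sequentially"
  shows "\<phi> \<in> L2 M" "norm_sq M \<phi> \<le> c"
proof -
  obtain k where "norm_sq M (u k) \<le> c" using eventually_happens[OF bound] by auto
  then have c0: "c \<ge> 0" using norm_sq_nonneg[of M "u k"] by linarith
  have "(\<integral>\<^sup>+x. ennreal ((cmod (\<phi> x))\<^sup>2) \<partial>M) = (\<integral>\<^sup>+x. liminf (\<lambda>k. ennreal ((cmod (u k x))\<^sup>2)) \<partial>M)"
  proof (rule nn_integral_cong_AE, rule AE_mp[OF lim], rule AE_I2, rule impI)
    fix x assume "(\<lambda>k. u k x) \<longlonglongrightarrow> \<phi> x"
    then have "(\<lambda>k. ennreal ((cmod (u k x))\<^sup>2)) \<longlonglongrightarrow> ennreal ((cmod (\<phi> x))\<^sup>2)"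
      by (rule tendsto_ennrealI[OF tendsto_power[OF tendsto_norm]])
    then show "ennreal ((cmod (\<phi> x))\<^sup>2) = liminf (\<lambda>k. ennreal ((cmod (u k x))\<^sup>2))"
      by (rule lim_imp_Liminf[OF sequentially_bot, symmetric])
  qed
  also have "\<dots> \<le> liminf (\<lambda>k. \<integral>\<^sup>+x. ennreal ((cmod (u k x))\<^sup>2) \<partial>M)"
    using u[THEN L2_measurable] by (intro nn_integral_liminf) auto
  also have "\<dots> = liminf (\<lambda>k. ennreal (norm_sq M (u k)))"
    by (simp add: nn_integral_norm_sq u)
  also have "\<dots> \<le> liminf (\<lambda>k. ennreal c)"
  proof (rule Liminf_mono)
    show "\<forall>\<^sub>F k in sequentially. ennreal (norm_sq M (u k)) \<le> ennreal c"
      using bound by eventually_elim (rule ennreal_leI)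
  qed
  finally have *: "(\<integral>\<^sup>+x. ennreal ((cmod (\<phi> x))\<^sup>2) \<partial>M) \<le> ennreal c" by (simp add: Liminf_const)
  show "\<phi> \<in> L2 M" by (rule L2I_nn_integral[OF meas]) (use * in \<open>simp add: le_less_trans\<close>)
  then show "norm_sq M \<phi> \<le> c" using * c0 by (rule norm_sq_le_nn_integral)
qed

text \<open>
  Riesz--Fischer. Along a subsequence whose consecutive differences have squared norm below
  \<open>4 ^ (- k)\<close>, the series of the squared differences weighted by \<open>2 ^ k\<close> has a finite integral. So
  almost everywhere the differences decay geometrically and the subsequence converges.
\<close>

lemma L2_complete:
  assumes u: "\<And>n. u n \<in> L2 M"
    and Cauchy: "\<And>e. e > 0 \<Longrightarrow> \<exists>N::nat. \<forall>m\<ge>N. \<forall>n\<ge>N. norm_sq M (\<lambda>x. u m x - u n x) < e"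
  shows "\<exists>\<phi>\<in>L2 M. (\<lambda>n. norm_sq M (\<lambda>x. u n x - \<phi> x)) \<longlonglongrightarrow> 0"
proof -
  have "\<exists>r::nat\<Rightarrow>nat. strict_mono r \<and> (\<forall>k. \<forall>m\<ge>r k. \<forall>n\<ge>r k. norm_sq M (\<lambda>x. u m x - u n x) < 1 / 4 ^ k)"
  proof -
    have "\<exists>r. \<forall>k. (\<forall>m\<ge>r k. \<forall>n\<ge>r k. norm_sq M (\<lambda>x. u m x - u n x) < 1 / 4 ^ k) \<and> r k < r (Suc k)"
    proof (rule dependent_nat_choice)
      show "\<exists>N. \<forall>m\<ge>N. \<forall>n\<ge>N. norm_sq M (\<lambda>x. u m x - u n x) < 1 / 4 ^ 0" using Cauchy[of 1] by simp
      fix N k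
      obtain N' where "\<forall>m\<ge>N'. \<forall>n\<ge>N'. norm_sq M (\<lambda>x. u m x - u n x) < 1 / 4 ^ Suc k"
        using Cauchy[of "1 / 4 ^ Suc k"] by auto
      then show "\<exists>N'. (\<forall>m\<ge>N'. \<forall>n\<ge>N'. norm_sq M (\<lambda>x. u m x - u n x) < 1 / 4 ^ Suc k) \<and> N < N'"
        by (intro exI[of _ "max N' (Suc N)"]) auto
    qed
    then obtain r :: "nat \<Rightarrow> nat" where r: "\<forall>k. (\<forall>m\<ge>r k. \<forall>n\<ge>r k. norm_sq M (\<lambda>x. u m x - u n x) < 1 / 4 ^ k) \<and> r k < r (Suc k)"
      by blast
    then have "strict_mono r" by (simp add: strict_mono_Suc_iff)
    with r show ?thesis by blast
  qed
  then obtain r :: "nat \<Rightarrow> nat" where r: "strict_mono r"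
    "\<And>k m n. m \<ge> r k \<Longrightarrow> n \<ge> r k \<Longrightarrow> norm_sq M (\<lambda>x. u m x - u n x) < 1 / 4 ^ k" by blast
  define d where "d k x = u (r (Suc k)) x - u (r k) x" for k x
  have d: "d k \<in> L2 M" "norm_sq M (d k) < 1 / 4 ^ k" for k
    unfolding d_def using u r by (auto intro!: L2_diff r(2) strict_mono_leD[OF r(1)])
  have dm[measurable]: "d k \<in> borel_measurable M" for k using d(1) L2_measurable by blast
  have um[measurable]: "u k \<in> borel_measurable M" for k using u L2_measurable by blast
  have "(\<integral>\<^sup>+x. (\<Sum>k. ennreal (2 ^ k * (cmod (d k x))\<^sup>2)) \<partial>M) = (\<Sum>k. \<integral>\<^sup>+x. ennreal (2 ^ k * (cmod (d k x))\<^sup>2) \<partial>M)"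
    by (rule nn_integral_suminf) simp
  also have "\<dots> = (\<Sum>k. ennreal (2 ^ k * norm_sq M (d k)))"
    by (simp add: ennreal_mult nn_integral_cmult nn_integral_norm_sq d(1))
  also have "\<dots> \<le> (\<Sum>k. ennreal ((1/2) ^ k))"
  proof (rule suminf_le)
    fix k
    have "2 ^ k * norm_sq M (d k) \<le> 2 ^ k * (1 / 4 ^ k)" using d(2)[of k] by (intro mult_left_mono) auto
    also have "\<dots> = (1/2) ^ k" using power_divide[of 2 "4::real" k] by simp
    finally show "ennreal (2 ^ k * norm_sq M (d k)) \<le> ennreal ((1/2) ^ k)" by (rule ennreal_leI)
  qed auto
  also have "\<dots> = ennreal (\<Sum>k. (1/2) ^ k)" by (rule suminf_ennreal2) (auto intro: summable_geometric)
  finally have "(\<integral>\<^sup>+x. (\<Sum>k. ennreal (2 ^ k * (cmod (d k x))\<^sup>2)) \<partial>M) \<noteq> \<infinity>"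
    by (auto simp: top_unique)
  then have "AE x in M. (\<Sum>k. ennreal (2 ^ k * (cmod (d k x))\<^sup>2)) \<noteq> \<infinity>"
    by (intro nn_integral_noteq_infinite) auto
  then have ae: "AE x in M. convergent (\<lambda>k. u (r k) x)"
  proof eventually_elim
    case (elim x)
    have s: "summable (\<lambda>k. 2 ^ k * (cmod (d k x))\<^sup>2)"
      by (rule summable_suminf_not_top) (use elim in auto)
    then have "(\<lambda>k. 2 ^ k * (cmod (d k x))\<^sup>2) \<longlonglongrightarrow> 0" by (rule summable_LIMSEQ_zero)
    then obtain C where C: "\<And>k. 2 ^ k * (cmod (d k x))\<^sup>2 \<le> C"
      using convergent_imp_Bseq[of "\<lambda>k. 2 ^ k * (cmod (d k x))\<^sup>2"] by (auto simp: Bseq_def convergent_def)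
    have C0: "C \<ge> 0" by (rule order_trans[OF _ C[of 0]]) simp
    have "cmod (d k x) \<le> sqrt C * (1 / sqrt 2) ^ k" for k
    proof -
      have "(cmod (d k x))\<^sup>2 \<le> C / 2 ^ k" using C[of k] by (simp add: field_simps)
      then have "cmod (d k x) \<le> sqrt (C / 2 ^ k)" by (simp add: real_le_rsqrt)
      then show ?thesis by (simp add: real_sqrt_divide real_sqrt_power power_divide)
    qed
    moreover have "summable (\<lambda>k. sqrt C * (1 / sqrt 2) ^ k)"
      by (rule summable_mult[OF summable_geometric]) simp
    ultimately have "summable (\<lambda>k. d k x)"
      using summable_comparison_test'[of "\<lambda>k. sqrt C * (1 / sqrt 2) ^ k" 0 "\<lambda>k. d k x"] by blast
    then have "convergent (\<lambda>n. \<Sum>k<n. d k x)" by (simp add: summable_iff_convergent)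
    then have "convergent (\<lambda>n. (\<Sum>k<n. d k x) + u (r 0) x)"
      by (intro convergent_add convergent_const)
    moreover have "(\<Sum>k<n. d k x) + u (r 0) x = u (r n) x" for n
      unfolding d_def by (simp add: sum_lessThan_telescope[of "\<lambda>k. u (r k) x"])
    ultimately show ?case by simp
  qed
  define \<phi> where "\<phi> x = lim (\<lambda>k. u (r k) x)" for x
  have \<phi>m[measurable]: "\<phi> \<in> borel_measurable M" unfolding \<phi>_def
    by (rule borel_measurable_lim_metric) simp
  have lim: "AE x in M. (\<lambda>k. u (r k) x) \<longlonglongrightarrow> \<phi> x"
    using ae by eventually_elim (simp add: \<phi>_def convergent_LIMSEQ_iff)
  have bound: "(\<lambda>x. u n x - \<phi> x) \<in> L2 M \<and> norm_sq M (\<lambda>x. u n x - \<phi> x) \<le> 1 / 4 ^ k" if "n \<ge> r k" for n k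
  proof -
    have e: "\<forall>\<^sub>F j in sequentially. norm_sq M (\<lambda>x. u n x - u (r j) x) \<le> 1 / 4 ^ k"
      using eventually_ge_at_top[of k]
    proof eventually_elim
      case (elim j)
      then show ?case using r(2)[OF that, of "r j"] strict_mono_leD[OF r(1), of k j] by simp
    qed
    have l: "AE x in M. (\<lambda>j. u n x - u (r j) x) \<longlonglongrightarrow> u n x - \<phi> x"
      using lim by eventually_elim (intro tendsto_intros)
    show ?thesis using L2_Fatou[OF _ l _ e] u by (auto intro: L2_diff)
  qed
  have "\<phi> \<in> L2 M"
    using L2_diff[OF u[of "r 0"] conjunct1[OF bound[OF order_refl, of 0]]] by simp
  moreover have "(\<lambda>n. norm_sq M (\<lambda>x. u n x - \<phi> x)) \<longlonglongrightarrow> 0"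
  proof (rule LIMSEQ_I)
    fix e :: real assume "e > 0"
    then obtain k :: nat where "(1/4) ^ k < e" using real_arch_pow_inv[of e "1/4"] by auto
    then show "\<exists>no. \<forall>n\<ge>no. norm (norm_sq M (\<lambda>x. u n x - \<phi> x) - 0) < e"
      using bound[where k=k] by (intro exI[of _ "r k"]) (fastforce simp: power_divide)
  qed
  ultimately show ?thesis by blast
qed

section \<open>Line integrals of holomorphic functions on strips\<close>

definition line_fun :: "(complex \<Rightarrow> complex) \<Rightarrow> real \<Rightarrow> real \<Rightarrow> complex" where
  "line_fun f x = (\<lambda>y. f (Complex x y))"

lemma continuous_Complex [continuous_intros]:
  "continuous_on A f \<Longrightarrow> continuous_on A g \<Longrightarrow> continuous_on A (\<lambda>x. Complex (f x) (g x))"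
  unfolding Complex_eq by (intro continuous_intros)

lemma measurable_Complex [measurable (raw)]:
  assumes "f \<in> borel_measurable M" "g \<in> borel_measurable M"
  shows "(\<lambda>x. Complex (f x) (g x)) \<in> borel_measurable M"
  unfolding Complex_eq using assms by measurable

lemma open_vertical_strip: "open {z. A < Re z \<and> Re z < B}"
  by (intro open_Collect_conj open_halfspace_Re_gt open_halfspace_Re_lt)

lemma convex_vertical_strip: "convex {z. A < Re z \<and> Re z < B}"
proof -
  have "{z. A < Re z \<and> Re z < B} = {z. A < Re z} \<inter> {z. Re z < B}" by auto
  then show ?thesis by (simp add: convex_Int convex_halfspace_Re_gt convex_halfspace_Re_lt)
qed

text \<open>
  Cauchy's integral formula on the rectangle with vertical sides on \<open>Re z = x1\<close> and \<open>Re z = x2\<close>;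
  the right-hand side comes from the horizontal sides, parametrized over \<open>[0, 1]\<close>.
\<close>

lemma rectangle_residue_bound:
  fixes k :: "complex \<Rightarrow> complex" and w :: complex
  assumes k: "k holomorphic_on {z. A < Re z \<and> Re z < B}"
    and x: "A < x1" "x1 < Re w" "Re w < x2" "x2 < B" and T: "\<bar>Im w\<bar> < T"
  defines "h \<equiv> \<lambda>z. k z / (z - w)"
  shows "cmod (integral {-T..T} (line_fun h x2) - integral {-T..T} (line_fun h x1) - 2 * pi * k w)
     \<le> (x2 - x1) * (integral {0..1} (\<lambda>t. cmod (h (Complex (x1 + t * (x2 - x1)) T)))
                  + integral {0..1} (\<lambda>t. cmod (h (Complex (x1 + t * (x2 - x1)) (-T)))))"
proof -
  define S where "S = {z. A < Re z \<and> Re z < B}"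
  have S: "open S" "convex S" unfolding S_def by (rule open_vertical_strip convex_vertical_strip)+
  have T0: "T > 0" using T by linarith
  define a1 where "a1 = Complex x1 (-T)"
  define a2 where "a2 = Complex x2 (-T)"
  define a3 where "a3 = Complex x2 T"
  define a4 where "a4 = Complex x1 T"
  have sub: "path_image (rectpath a1 a3) \<subseteq> S - {w}"
    using x T0 T by (subst path_image_rectpath) (auto simp: a1_def a3_def S_def)
  have hc: "continuous_on (S - {w}) h"
    unfolding h_def using holomorphic_on_imp_continuous_on[OF k]
    by (intro continuous_intros) (auto simp: S_def intro: continuous_on_subset)
  have "(h has_contour_integral (2*pi * \<i> * winding_number (rectpath a1 a3) w * k w)) (rectpath a1 a3)"
    unfolding h_def
  proof (rule Cauchy_integral_formula_convex_simple[of S])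
    show "w \<in> interior S" using S x by (simp add: interior_open) (simp add: S_def)
  qed (use S k sub in \<open>auto simp: S_def\<close>)
  moreover have "winding_number (rectpath a1 a3) w = 1"
    using x T by (intro winding_number_rectpath) (auto simp: a1_def a3_def in_box_complex_iff)
  ultimately have 1: "contour_integral (rectpath a1 a3) h = 2 * pi * \<i> * k w"
    by (simp add: contour_integral_unique)
  have rp: "rectpath a1 a3 = linepath a1 a2 +++ linepath a2 a3 +++ linepath a3 a4 +++ linepath a4 a1"
    by (simp add: rectpath_def Let_def a1_def a2_def a3_def a4_def)
  have pi: "path_image (linepath a1 a2) \<subseteq> S - {w}" "path_image (linepath a2 a3) \<subseteq> S - {w}"
      "path_image (linepath a3 a4) \<subseteq> S - {w}" "path_image (linepath a4 a1) \<subseteq> S - {w}"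
    using sub unfolding rp by (auto simp: path_image_join)
  have ci: "h contour_integrable_on (linepath a1 a2)" "h contour_integrable_on (linepath a2 a3)"
      "h contour_integrable_on (linepath a3 a4)" "h contour_integrable_on (linepath a4 a1)"
    using pi by (auto intro!: contour_integrable_continuous_linepath continuous_on_subset[OF hc])
  have 2: "contour_integral (rectpath a1 a3) h = contour_integral (linepath a1 a2) h
      + contour_integral (linepath a2 a3) h + contour_integral (linepath a3 a4) h + contour_integral (linepath a4 a1) h"
    unfolding rp using ci by (simp add: contour_integrable_join valid_path_join)
  have 3: "contour_integral (linepath a2 a3) h = \<i> * integral {-T..T} (line_fun h x2)"
    unfolding line_fun_def by (rule contour_integral_linepath_same_Re) (use T0 in \<open>auto simp: a2_def a3_def\<close>)
  have "contour_integral (linepath a4 a1) h = - contour_integral (linepath a1 a4) h"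
    by (rule contour_integral_reverse_linepath) (use pi in \<open>auto simp: closed_segment_commute intro: continuous_on_subset[OF hc]\<close>)
  also have "contour_integral (linepath a1 a4) h = \<i> * integral {-T..T} (line_fun h x1)"
    unfolding line_fun_def by (rule contour_integral_linepath_same_Re) (use T0 in \<open>auto simp: a1_def a4_def\<close>)
  finally have 4: "contour_integral (linepath a4 a1) h = - (\<i> * integral {-T..T} (line_fun h x1))" .
  have hor: "cmod (contour_integral (linepath (Complex x1 s) (Complex x2 s)) h)
      \<le> (x2 - x1) * integral {0..1} (\<lambda>t. cmod (h (Complex (x1 + t * (x2 - x1)) s)))"
    if s: "\<bar>s\<bar> = T" for s
  proof -
    have mem: "Complex (x1 + t * (x2 - x1)) s \<in> S - {w}" if "t \<in> {0..1}" for t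
    proof -
      define p where "p = t * (x2 - x1)"
      have "0 \<le> p" "p \<le> x2 - x1" unfolding p_def using that x
        by (auto intro!: mult_nonneg_nonneg mult_left_le_one_le)
      then have "x1 + t * (x2 - x1) < B" "A < x1 + t * (x2 - x1)"
        using x unfolding p_def[symmetric] by auto
      then show ?thesis using x s T by (auto simp: S_def)
    qed
    have c: "continuous_on {0..1} (\<lambda>t. h (Complex (x1 + t * (x2 - x1)) s))"
      proof (rule continuous_on_compose2[OF hc])
      show "(\<lambda>t. Complex (x1 + t * (x2 - x1)) s) ` {0..1} \<subseteq> S - {w}" using mem by blast
    qed (intro continuous_intros)
    have lp: "linepath (Complex x1 s) (Complex x2 s) t = Complex (x1 + t * (x2 - x1)) s" for t
      by (simp add: linepath_def complex_eq_iff algebra_simps)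
    have "contour_integral (linepath (Complex x1 s) (Complex x2 s)) h
        = (Complex x2 s - Complex x1 s) * integral {0..1} (\<lambda>t. h (linepath (Complex x1 s) (Complex x2 s) t))"
      by (simp add: contour_integral_integral)
    also have "integral {0..1} (\<lambda>t. h (linepath (Complex x1 s) (Complex x2 s) t)) = integral {0..1} (\<lambda>t. h (Complex (x1 + t * (x2 - x1)) s))"
      unfolding lp ..
    also have "Complex x2 s - Complex x1 s = of_real (x2 - x1)" by (simp add: complex_eq_iff)
    finally have "cmod (contour_integral (linepath (Complex x1 s) (Complex x2 s)) h)
        = (x2 - x1) * cmod (integral {0..1} (\<lambda>t. h (Complex (x1 + t * (x2 - x1)) s)))"
      using x by (simp add: norm_mult del: of_real_diff)
    also have "\<dots> \<le> (x2 - x1) * integral {0..1} (\<lambda>t. cmod (h (Complex (x1 + t * (x2 - x1)) s)))"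
      using x c by (intro mult_left_mono continuous_on_imp_absolutely_integrable_on integral_norm_bound_integral
            integrable_continuous_real continuous_on_norm) auto
    finally show ?thesis .
  qed
  have "contour_integral (linepath a3 a4) h = - contour_integral (linepath a4 a3) h"
    by (rule contour_integral_reverse_linepath) (use pi in \<open>auto simp: closed_segment_commute intro: continuous_on_subset[OF hc]\<close>)
  then have n34: "cmod (contour_integral (linepath a3 a4) h)
      \<le> (x2 - x1) * integral {0..1} (\<lambda>t. cmod (h (Complex (x1 + t * (x2 - x1)) T)))"
    using hor[of T] T0 by (simp add: a3_def a4_def)
  have n12: "cmod (contour_integral (linepath a1 a2) h)
      \<le> (x2 - x1) * integral {0..1} (\<lambda>t. cmod (h (Complex (x1 + t * (x2 - x1)) (-T))))"
    using hor[of "-T"] T0 by (simp add: a1_def a2_def)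
  have "\<i> * (integral {-T..T} (line_fun h x2) - integral {-T..T} (line_fun h x1) - 2 * pi * k w)
      = - (contour_integral (linepath a1 a2) h + contour_integral (linepath a3 a4) h)"
    using 1 2 unfolding 3 4 by (simp add: algebra_simps)
  then have "cmod (\<i> * (integral {-T..T} (line_fun h x2) - integral {-T..T} (line_fun h x1) - 2 * pi * k w))
      = cmod (contour_integral (linepath a1 a2) h + contour_integral (linepath a3 a4) h)"
    by (simp only: norm_minus_cancel)
  also have "\<dots> \<le> cmod (contour_integral (linepath a1 a2) h) + cmod (contour_integral (linepath a3 a4) h)"
    by (rule norm_triangle_ineq)
  finally show ?thesis using n12 n34 by (simp add: norm_mult distrib_left)
qed

text \<open>
  Otherwise the integral would be infinite. Applied to the horizontal sides of the rectangles, this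
  provides heights at which their contribution is negligible.
\<close>

lemma exists_small_tail:
  fixes J :: "real \<Rightarrow> ennreal"
  assumes [measurable]: "J \<in> borel_measurable borel"
    and fin: "(\<integral>\<^sup>+t. J t * indicator {t. R \<le> \<bar>t\<bar>} t \<partial>lborel) < \<infinity>" and e: "e > 0"
  shows "\<exists>T\<ge>N. T \<ge> R \<and> J T + J (-T) < ennreal e"
proof (rule ccontr)
  assume "\<not> ?thesis"
  then have *: "ennreal e \<le> J T + J (-T)" if "T \<ge> N" "T \<ge> R" for T using that by (meson not_less)
  define M where "M = max 0 (max N R)"
  have "(\<integral>\<^sup>+t. ennreal e * indicator {M..} t \<partial>lborel) = ennreal e * emeasure lborel {M..}"
    by (rule nn_integral_cmult_indicator) simp
  also have "emeasure lborel {M..} = \<infinity>"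
  proof (rule ccontr)
    assume "emeasure lborel {M..} \<noteq> \<infinity>"
    then have f: "emeasure lborel {M..} < top" by (simp add: less_top)
    define m where "m = enn2real (emeasure lborel {M..})"
    have "emeasure lborel {M..M + m + 1} \<le> emeasure lborel {M..}" by (rule emeasure_mono) auto
    then have "ennreal (m + 1) \<le> ennreal m" using f by (simp add: m_def enn2real_nonneg)
    then show False using enn2real_nonneg by (simp add: m_def)
  qed
  finally have inf: "(\<integral>\<^sup>+t. ennreal e * indicator {M..} t \<partial>lborel) = \<infinity>"
    using e by (simp add: ennreal_mult_eq_top_iff)
  let ?K = "\<lambda>t. J t * indicator {t. R \<le> \<bar>t\<bar>} t"
  have Km[measurable]: "?K \<in> borel_measurable borel" by measurable
  have "(\<integral>\<^sup>+t. ennreal e * indicator {M..} t \<partial>lborel) \<le> (\<integral>\<^sup>+t. ?K t + ?K (-t) \<partial>lborel)"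
    by (rule nn_integral_mono) (auto simp: indicator_def M_def intro: *)
  also have "\<dots> = (\<integral>\<^sup>+t. ?K t \<partial>lborel) + (\<integral>\<^sup>+t. ?K (-t) \<partial>lborel)"
    by (rule nn_integral_add) measurable
  also have "(\<integral>\<^sup>+t. ?K (-t) \<partial>lborel) = (\<integral>\<^sup>+t. ?K t \<partial>lborel)"
    using nn_integral_real_affine[of ?K "-1" 0] Km by simp
  finally show False using fin inf by (auto simp: top_unique)
qed

text \<open>
  A vertical line of integration may be moved across a simple pole. Uniform bounds on the
  \<open>L1\<close>-norms along the lines give, by Tonelli's theorem, integrability in the height of the
  contribution of the horizontal sides, so suitable rectangles exist. The bound is asked for only at
  some distance above and below the pole, because the lines in between pass close to it.
\<close>

lemma line_integral_jump:
  fixes k :: "complex \<Rightarrow> complex" and w :: complex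
  assumes k: "k holomorphic_on {z. A < Re z \<and> Re z < B}"
    and x: "A < x1" "x1 < Re w" "Re w < x2" "x2 < B"
  defines "h \<equiv> \<lambda>z. k z / (z - w)"
  assumes int: "integrable lborel (line_fun h x1)" "integrable lborel (line_fun h x2)"
    and bound: "\<And>x. x \<in> {x1..x2} \<Longrightarrow> (\<integral>\<^sup>+y. ennreal (cmod (h (Complex x y))) * indicator {y. \<bar>Im w\<bar> + 1 \<le> \<bar>y\<bar>} y \<partial>lborel) \<le> ennreal C"
  shows "(LINT y|lborel. h (Complex x2 y)) - (LINT y|lborel. h (Complex x1 y)) = 2 * pi * k w"
proof -
  define S where "S = {z. A < Re z \<and> Re z < B}"
  have S: "open S" unfolding S_def by (rule open_vertical_strip)
  define R where "R = \<bar>Im w\<bar> + 1"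
  define k0 where "k0 z = (if z \<in> S then k z else 0)" for z
  have k0[measurable]: "k0 \<in> borel_measurable borel"
  proof -
    have "(\<lambda>z. if z \<in> S then k z else 0) \<in> borel_measurable borel"
      using holomorphic_on_imp_continuous_on[OF k] S
      by (intro borel_measurable_continuous_on_if) (auto simp: S_def continuous_on_const)
    then show ?thesis by (simp add: k0_def[abs_def])
  qed
  define h0 where "h0 z = k0 z / (z - w)" for z
  have h0m[measurable]: "h0 \<in> borel_measurable borel" unfolding h0_def[abs_def] by measurable
  define seg where "seg t = x1 + t * (x2 - x1)" for t
  have seg: "seg t \<in> {x1..x2}" if "t \<in> {0..1}" for t
  proof -
    have "0 \<le> t * (x2 - x1)" "t * (x2 - x1) \<le> 1 * (x2 - x1)" using that x
      by (auto intro!: mult_nonneg_nonneg mult_right_mono)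
    then show ?thesis by (auto simp: seg_def)
  qed
  have h0: "h0 (Complex x y) = h (Complex x y)" if "x \<in> {x1..x2}" for x y
    using that x by (simp add: h0_def h_def k0_def S_def)
  define G where "G T t = ennreal (cmod (h0 (Complex (seg t) T))) * indicator {0..1} t" for T t :: real
  define J where "J T = (\<integral>\<^sup>+t. G T t \<partial>lborel)" for T
  have Gm[measurable]: "case_prod G \<in> borel_measurable (lborel \<Otimes>\<^sub>M lborel)"
    unfolding G_def[abs_def] seg_def by measurable
  have Jm[measurable]: "J \<in> borel_measurable borel"
    unfolding J_def[abs_def] using lborel.borel_measurable_nn_integral_fst[OF Gm] by simp
  have "(\<integral>\<^sup>+T. J T * indicator {T. R \<le> \<bar>T\<bar>} T \<partial>lborel) = (\<integral>\<^sup>+T. (\<integral>\<^sup>+t. G T t * indicator {T. R \<le> \<bar>T\<bar>} T \<partial>lborel) \<partial>lborel)"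
    unfolding J_def by (subst nn_integral_multc) auto
  also have "\<dots> = (\<integral>\<^sup>+t. (\<integral>\<^sup>+T. G T t * indicator {T. R \<le> \<bar>T\<bar>} T \<partial>lborel) \<partial>lborel)"
    by (rule lborel_pair.Fubini') measurable
  also have "\<dots> \<le> (\<integral>\<^sup>+t. ennreal C * indicator {0..1::real} t \<partial>lborel)"
  proof (rule nn_integral_mono)
    fix t :: real
    show "(\<integral>\<^sup>+T. G T t * indicator {T. R \<le> \<bar>T\<bar>} T \<partial>lborel) \<le> ennreal C * indicator {0..1} t"
      using bound[OF seg[of t]] h0[OF seg[of t]] by (cases "t \<in> {0..1}") (auto simp: G_def R_def)
  qed
  also have "\<dots> = ennreal C"
    by (subst nn_integral_cmult_indicator) auto
  also have "\<dots> < \<infinity>" by simp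
  finally have fin: "(\<integral>\<^sup>+T. J T * indicator {T. R \<le> \<bar>T\<bar>} T \<partial>lborel) < \<infinity>" .
  have "\<forall>n::nat. \<exists>T\<ge>real n. T \<ge> R \<and> J T + J (-T) < ennreal (1 / real (Suc n))"
    by (intro allI exists_small_tail[OF Jm fin]) simp
  then obtain T where T: "\<And>n. T n \<ge> real n" "\<And>n. T n \<ge> R" "\<And>n. J (T n) + J (- T n) < ennreal (1 / real (Suc n))"
    by metis
  have Tlim: "filterlim T at_top sequentially"
    by (rule filterlim_at_top_mono[OF filterlim_real_sequentially]) (use T in auto)
  have Jint: "ennreal (integral {0..1} (\<lambda>t. cmod (h (Complex (x1 + t * (x2 - x1)) s)))) = J s" if s: "\<bar>s\<bar> \<ge> R" for s
  proof -
    have hc: "continuous_on (S - {w}) h"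
      unfolding h_def using holomorphic_on_imp_continuous_on[OF k]
      by (intro continuous_intros) (auto simp: S_def intro: continuous_on_subset)
    have c: "continuous_on {0..1} (\<lambda>t. h (Complex (seg t) s))"
    proof (rule continuous_on_compose2[OF hc])
      show "continuous_on {0..1} (\<lambda>t. Complex (seg t) s)" unfolding seg_def by (intro continuous_intros)
      show "(\<lambda>t. Complex (seg t) s) ` {0..1} \<subseteq> S - {w}"
      proof safe
        fix t :: real assume "t \<in> {0..1}"
        then have "A < seg t" "seg t < B" using seg[of t] x by auto
        then show "Complex (seg t) s \<in> S" by (simp add: S_def)
      next
        fix t :: real assume "w = Complex (seg t) s" then show False using s by (auto simp: R_def)
      qed
    qed
    have "J s = (\<integral>\<^sup>+t\<in>{0..1}. ennreal (cmod (h (Complex (seg t) s))) \<partial>lborel)"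
      unfolding J_def G_def by (intro nn_integral_cong) (use h0[OF seg] in \<open>auto simp: indicator_def\<close>)
    also have "\<dots> = ennreal (integral {0..1} (\<lambda>t. cmod (h (Complex (seg t) s))))"
    proof -
      have si: "set_integrable lborel {0..1} (\<lambda>t. cmod (h (Complex (seg t) s)))"
        by (rule borel_integrable_atLeastAtMost') (rule continuous_on_norm[OF c])
      have "(\<integral>\<^sup>+t\<in>{0..1}. ennreal (cmod (h (Complex (seg t) s))) \<partial>lborel)
          = (\<integral>\<^sup>+t. ennreal (indicator {0..1} t *\<^sub>R cmod (h (Complex (seg t) s))) \<partial>lborel)"
        by (rule nn_integral_cong) (simp add: indicator_def)
      also have "\<dots> = ennreal (LINT t:{0..1}|lborel. cmod (h (Complex (seg t) s)))"
        unfolding set_lebesgue_integral_def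
        by (rule nn_integral_eq_integral) (use si in \<open>auto simp: set_integrable_def\<close>)
      finally show ?thesis using set_borel_integral_eq_integral(2)[OF si] by simp
    qed
    finally show ?thesis by (simp add: seg_def)
  qed
  define D where "D n = integral {- T n..T n} (line_fun h x2) - integral {- T n..T n} (line_fun h x1) - 2 * pi * k w" for n
  have "D \<longlonglongrightarrow> 0"
  proof (rule Lim_null_comparison)
    show "\<forall>\<^sub>F n in sequentially. norm (D n) \<le> (x2 - x1) * (1 / real (Suc n))"
    proof (intro always_eventually allI)
      fix n
      let ?I = "\<lambda>s. integral {0..1} (\<lambda>t. cmod (h (Complex (x1 + t * (x2 - x1)) s)))"
      have R0: "R > 0" by (simp add: R_def)
      have nn: "?I s \<ge> 0" for s by (cases "(\<lambda>t. cmod (h (Complex (x1 + t * (x2 - x1)) s))) integrable_on {0..1}")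
          (auto intro: integral_nonneg simp: not_integrable_integral)
      have "norm (D n) \<le> (x2 - x1) * (?I (T n) + ?I (- T n))"
        unfolding D_def h_def using T(2)[of n] by (intro rectangle_residue_bound[OF k]) (use x in \<open>auto simp: R_def\<close>)
      also have "ennreal (?I (T n) + ?I (- T n)) = J (T n) + J (- T n)"
        using T(2)[of n] R0 nn by (simp add: Jint ennreal_plus)
      then have "?I (T n) + ?I (- T n) \<le> 1 / real (Suc n)"
        using T(3)[of n] by (metis ennreal_less_iff less_imp_le nn add_nonneg_nonneg)
      then have "(x2 - x1) * (?I (T n) + ?I (- T n)) \<le> (x2 - x1) * (1 / real (Suc n))"
        using x by (intro mult_left_mono) auto
      finally show "norm (D n) \<le> (x2 - x1) * (1 / real (Suc n))" .
    qed
    show "(\<lambda>n. (x2 - x1) * (1 / real (Suc n))) \<longlonglongrightarrow> 0"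
      using tendsto_mult_left[OF LIMSEQ_inverse_real_of_nat, of "x2 - x1"] by (simp add: inverse_eq_divide)
  qed
  have lim: "(\<lambda>n. integral {- T n..T n} (line_fun h x)) \<longlonglongrightarrow> (LINT y|lborel. h (Complex x y))"
    if i: "integrable lborel (line_fun h x)" for x
  proof -
    have "integral {- T n..T n} (line_fun h x) = (LINT y|lborel. indicator {- T n..T n} y *\<^sub>R line_fun h x y)" for n
    proof -
      have "set_integrable lborel {- T n..T n} (line_fun h x)"
        using i unfolding set_integrable_def by (rule integrable_mult_indicator[rotated]) simp
      from set_borel_integral_eq_integral(2)[OF this] show ?thesis by (simp add: set_lebesgue_integral_def)
    qed
    moreover have "(\<lambda>n. LINT y|lborel. indicator {- T n..T n} y *\<^sub>R line_fun h x y) \<longlonglongrightarrow> (LINT y|lborel. line_fun h x y)"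
    proof (rule integral_dominated_convergence[where w="\<lambda>y. norm (line_fun h x y)"])
      show "AE y in lborel. (\<lambda>n. indicator {- T n..T n} y *\<^sub>R line_fun h x y) \<longlonglongrightarrow> line_fun h x y"
      proof (rule AE_I2)
        fix y
        have "\<forall>\<^sub>F n in sequentially. \<bar>y\<bar> \<le> T n"
          using Tlim by (simp add: filterlim_at_top)
        then have "\<forall>\<^sub>F n in sequentially. indicator {- T n..T n} y *\<^sub>R line_fun h x y = line_fun h x y"
          by eventually_elim (auto simp: indicator_def)
        then show "(\<lambda>n. indicator {- T n..T n} y *\<^sub>R line_fun h x y) \<longlonglongrightarrow> line_fun h x y"
          by (rule tendsto_eventually)
      qed
      show "line_fun h x \<in> borel_measurable lborel" using i by simp
      then show "(\<lambda>y. indicator {- T n..T n} y *\<^sub>R line_fun h x y) \<in> borel_measurable lborel" for n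
        by measurable
      show "AE y in lborel. norm (indicator {- T n..T n} y *\<^sub>R line_fun h x y) \<le> norm (line_fun h x y)" for n
        by (auto simp: indicator_def)
    qed (use i in auto)
    ultimately show ?thesis by (simp add: line_fun_def)
  qed
  have "D \<longlonglongrightarrow> (LINT y|lborel. h (Complex x2 y)) - (LINT y|lborel. h (Complex x1 y)) - 2 * pi * k w"
    unfolding D_def by (intro tendsto_intros lim int)
  from LIMSEQ_unique[OF this \<open>D \<longlonglongrightarrow> 0\<close>] show ?thesis by simp
qed

text \<open>
  The case of no pole: with \<open>w\<close> an auxiliary point between the lines, \<open>h\<close> is \<open>k z / (z - w)\<close> for
  \<open>k z = h z * (z - w)\<close>, and the jump vanishes because \<open>k w = 0\<close>.
\<close>

lemma line_integral_shift:
  assumes h: "h holomorphic_on {z. A < Re z \<and> Re z < B}"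
    and x: "A < x1" "x1 < B" "A < x2" "x2 < B"
    and int: "\<And>x. min x1 x2 \<le> x \<Longrightarrow> x \<le> max x1 x2 \<Longrightarrow> integrable lborel (\<lambda>y. h (Complex x y)) \<and> (LINT y|lborel. cmod (h (Complex x y))) \<le> C"
  shows "(LINT y|lborel. h (Complex x1 y)) = (LINT y|lborel. h (Complex x2 y))"
proof -
  have *: "(LINT y|lborel. h (Complex x2 y)) - (LINT y|lborel. h (Complex x1 y)) = 0"
    if xx: "A < x1" "x1 < x2" "x2 < B" and int: "\<And>x. x1 \<le> x \<Longrightarrow> x \<le> x2 \<Longrightarrow> integrable lborel (\<lambda>y. h (Complex x y)) \<and> (LINT y|lborel. cmod (h (Complex x y))) \<le> C"
    for x1 x2
  proof -
    \<comment> \<open>any point strictly between the two lines serves as the artificial pole\<close>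
    define w where "w = Complex ((x1 + x2) / 2) 0"
    define k where "k z = h z * (z - w)" for z
    have kh: "k z / (z - w) = (if z = w then 0 else h z)" for z by (simp add: k_def)
    have kl: "line_fun (\<lambda>z. k z / (z - w)) x = (\<lambda>y. h (Complex x y))" if "x \<noteq> (x1+x2)/2" for x
      using that unfolding line_fun_def kh by (auto simp: fun_eq_iff w_def)
    have kl': "k (Complex x y) / (Complex x y - w) = h (Complex x y)" if "x \<noteq> (x1+x2)/2" for x y
      using fun_cong[OF kl[OF that]] by (simp add: line_fun_def)
    have "(LINT y|lborel. k (Complex x2 y) / (Complex x2 y - w)) - (LINT y|lborel. k (Complex x1 y) / (Complex x1 y - w)) = 2 * pi * k w"
    proof (rule line_integral_jump[where A=A and B=B and C=C])
      show "k holomorphic_on {z. A < Re z \<and> Re z < B}" unfolding k_def by (intro holomorphic_intros h)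
      show "integrable lborel (line_fun (\<lambda>z. k z / (z - w)) x1)" "integrable lborel (line_fun (\<lambda>z. k z / (z - w)) x2)"
        using xx int by (auto simp: kl)
      fix x assume "x \<in> {x1..x2}"
      then have i: "integrable lborel (\<lambda>y. h (Complex x y))" "(LINT y|lborel. cmod (h (Complex x y))) \<le> C" using int by auto
      have "(\<integral>\<^sup>+y. ennreal (cmod (k (Complex x y) / (Complex x y - w))) * indicator {y. \<bar>Im w\<bar> + 1 \<le> \<bar>y\<bar>} y \<partial>lborel)
          \<le> (\<integral>\<^sup>+y. ennreal (cmod (h (Complex x y))) \<partial>lborel)"
        by (intro nn_integral_mono) (auto simp: kh indicator_def)
      also have "\<dots> = ennreal (LINT y|lborel. cmod (h (Complex x y)))"
        by (rule nn_integral_eq_integral) (use i in auto)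
      also have "\<dots> \<le> ennreal C" using i by (intro ennreal_leI)
      finally show "(\<integral>\<^sup>+y. ennreal (cmod (k (Complex x y) / (Complex x y - w))) * indicator {y. \<bar>Im w\<bar> + 1 \<le> \<bar>y\<bar>} y \<partial>lborel) \<le> ennreal C" .
    qed (use xx in \<open>auto simp: w_def\<close>)
    moreover have "k w = 0" by (simp add: k_def)
    ultimately show ?thesis using xx by (simp add: kl')
  qed
  show ?thesis
  proof (cases x1 x2 rule: linorder_cases)
    case less then show ?thesis using *[of x1 x2] x int by (simp add: min_def max_def)
  next
    case greater then show ?thesis using *[of x2 x1] x int by (simp add: min_def max_def)
  qed simp
qed

section \<open>Boundary values in the Hardy space of a strip\<close>

abbreviation line_sq :: "(complex \<Rightarrow> complex) \<Rightarrow> real \<Rightarrow> real" where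
  "line_sq f x \<equiv> norm_sq lborel (line_fun f x)"

lemma strip_vertical: "strip b = {z. 0 < Re z \<and> Re z < b}"
  by (simp add: strip_def)

lemma line_fun_measurable:
  assumes "f holomorphic_on strip b" "0 < x" "x < b"
  shows "line_fun f x \<in> borel_measurable lborel"
proof -
  have "continuous_on UNIV (line_fun f x)"
    unfolding line_fun_def
  proof (rule continuous_on_compose2[OF holomorphic_on_imp_continuous_on[OF assms(1)]])
    show "range (Complex x) \<subseteq> strip b" using assms by (auto simp: strip_def)
  qed (intro continuous_intros)
  then show ?thesis by (simp add: borel_measurable_continuous_onI)
qed

lemma hardy_strip_L2:
  assumes f: "f \<in> hardy_strip b" and x: "0 < x" "x < b"
  shows "line_fun f x \<in> L2 lborel"
proof (rule L2I_nn_integral)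
  show "line_fun f x \<in> borel_measurable lborel" using assms by (intro line_fun_measurable) (auto simp: hardy_strip_def)
  have "(\<integral>\<^sup>+y. ennreal ((cmod (f (Complex x y)))\<^sup>2) \<partial>lborel) \<le> (SUP x\<in>{0<..<b}. \<integral>\<^sup>+y. ennreal ((cmod (f (Complex x y)))\<^sup>2) \<partial>lborel)"
    by (rule SUP_upper) (use x in auto)
  also have "\<dots> < \<infinity>" using f by (auto simp: hardy_strip_def)
  finally show "(\<integral>\<^sup>+y. ennreal ((cmod (line_fun f x y))\<^sup>2) \<partial>lborel) < \<infinity>" by (simp add: line_fun_def)
qed

lemma hardy_strip_bounded:
  assumes f: "f \<in> hardy_strip b"
  obtains C where "C \<ge> 0" "\<And>x. 0 < x \<Longrightarrow> x < b \<Longrightarrow> line_sq f x \<le> C"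
proof -
  define S where "S = (SUP x\<in>{0<..<b}. \<integral>\<^sup>+y. ennreal ((cmod (f (Complex x y)))\<^sup>2) \<partial>lborel)"
  have S: "S < top" using f by (auto simp: hardy_strip_def S_def)
  have "line_sq f x \<le> enn2real S" if x: "0 < x" "x < b" for x
  proof (rule norm_sq_le_nn_integral[OF hardy_strip_L2[OF f x]])
    have "(\<integral>\<^sup>+y. ennreal ((cmod (f (Complex x y)))\<^sup>2) \<partial>lborel) \<le> S"
      unfolding S_def by (rule SUP_upper) (use x in auto)
    then show "(\<integral>\<^sup>+y. ennreal ((cmod (line_fun f x y))\<^sup>2) \<partial>lborel) \<le> ennreal (enn2real S)" using S by (simp add: line_fun_def)
  qed (simp add: enn2real_nonneg)
  then show ?thesis using that[of "enn2real S"] by (simp add: enn2real_nonneg)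
qed

lemma hardy_stripI:
  assumes "f holomorphic_on strip b"
    and "\<And>x. 0 < x \<Longrightarrow> x < b \<Longrightarrow> line_fun f x \<in> L2 lborel \<and> line_sq f x \<le> C"
  shows "f \<in> hardy_strip b"
proof -
  have "(SUP x\<in>{0<..<b}. \<integral>\<^sup>+y. ennreal ((cmod (f (Complex x y)))\<^sup>2) \<partial>lborel) \<le> ennreal C"
  proof (rule SUP_least)
    fix x assume "x \<in> {0<..<b}"
    then have "line_fun f x \<in> L2 lborel" "line_sq f x \<le> C" using assms(2) by auto
    then show "(\<integral>\<^sup>+y. ennreal ((cmod (f (Complex x y)))\<^sup>2) \<partial>lborel) \<le> ennreal C"
      using nn_integral_norm_sq[of "line_fun f x" lborel] by (simp add: line_fun_def ennreal_leI)
  qed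
  then show ?thesis using assms(1) by (auto simp: hardy_strip_def intro: le_less_trans)
qed

text \<open>
  With \<open>s = x1 + x2\<close>, the function \<open>f z * cnj (f (s - cnj z))\<close> is holomorphic. It is the integrand of
  the inner product on the line \<open>Re z = x1\<close>, and it is \<open>|f z|^2\<close> on the line \<open>Re z = s / 2\<close>.
\<close>

lemma hardy_strip_inner:
  assumes f: "f \<in> hardy_strip b" and x1: "0 < x1" "x1 < b" and x2: "0 < x2" "x2 < b"
  shows "L2_inner lborel (line_fun f x1) (line_fun f x2) = of_real (line_sq f ((x1 + x2) / 2))"
proof -
  define s where "s = x1 + x2"
  define A where "A = max 0 (s - b)"
  define B where "B = min b s"
  have AB: "0 < x \<and> x < b \<and> 0 < s - x \<and> s - x < b" if "A < x" "x < B" for x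
    using that by (auto simp: A_def B_def)
  obtain C where C: "C \<ge> 0" "\<And>x. 0 < x \<Longrightarrow> x < b \<Longrightarrow> line_sq f x \<le> C" using hardy_strip_bounded[OF f] by blast
  define h where "h z = f z * cnj (f (s - cnj z))" for z
  have hol: "f holomorphic_on strip b" using f by (simp add: hardy_strip_def)
  have hh: "h holomorphic_on {z. A < Re z \<and> Re z < B}"
  proof -
    have [simp]: "cnj ` strip b = strip b"
    proof safe
      fix z assume "z \<in> strip b" then show "z \<in> cnj ` strip b" by (intro image_eqI[of _ _ "cnj z"]) (auto simp: strip_def)
    qed (auto simp: strip_def)
    have "cnj \<circ> f \<circ> cnj holomorphic_on strip b"
      by (rule holomorphic_on_compose_cnj_cnj) (use hol in \<open>auto simp: strip_vertical open_vertical_strip\<close>)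
    then have "(\<lambda>z. (cnj \<circ> f \<circ> cnj) (s - z)) holomorphic_on {z. A < Re z \<and> Re z < B}"
      by (intro holomorphic_on_compose_gen[of "\<lambda>z. s - z" _ "cnj \<circ> f \<circ> cnj", unfolded o_def[of "cnj \<circ> f \<circ> cnj"]] holomorphic_intros)
        (use AB in \<open>auto simp: strip_def\<close>)
    moreover have "f holomorphic_on {z. A < Re z \<and> Re z < B}"
      by (rule holomorphic_on_subset[OF hol]) (use AB in \<open>auto simp: strip_def\<close>)
    ultimately show ?thesis unfolding h_def by (intro holomorphic_on_mult) (simp_all add: o_def)
  qed
  have hl: "h (Complex x y) = line_fun f x y * cnj (line_fun f (s - x) y)" for x y
  proof -
    have "of_real s - cnj (Complex x y) = Complex (s - x) y" by (simp add: complex_eq_iff)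
    then show ?thesis unfolding h_def line_fun_def by simp
  qed
  have x1AB: "A < x1" "x1 < B" "A < s/2" "s/2 < B" using x1 x2 by (auto simp: A_def B_def s_def max_def)
  have int: "integrable lborel (\<lambda>y. h (Complex x y)) \<and> (LINT y|lborel. cmod (h (Complex x y))) \<le> sqrt C * sqrt C"
    if "A < x" "x < B" for x
  proof
    have L: "line_fun f x \<in> L2 lborel" "line_fun f (s - x) \<in> L2 lborel" using AB[OF that] by (auto intro: hardy_strip_L2[OF f])
    then show "integrable lborel (\<lambda>y. h (Complex x y))" unfolding hl by (rule L2_inner_integrable)
    have "(LINT y|lborel. cmod (h (Complex x y))) \<le> sqrt (line_sq f x) * sqrt (line_sq f (s - x))"
      using L2_mult_integral_le[OF L(1) L2_cnj[OF L(2)]] by (simp add: hl norm_sq_def)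
    also have "\<dots> \<le> sqrt C * sqrt C" using AB[OF that] C by (intro mult_mono real_sqrt_le_mono C(2)) auto
    finally show "(LINT y|lborel. cmod (h (Complex x y))) \<le> sqrt C * sqrt C" .
  qed
  have ss: "s - x1 = x2" "s - s / 2 = s / 2" by (simp_all add: s_def field_simps)
  have "(LINT y|lborel. h (Complex x1 y)) = (LINT y|lborel. h (Complex (s/2) y))"
    by (rule line_integral_shift[OF hh x1AB(1,2) x1AB(3,4), of "sqrt C * sqrt C"], rule int) (use x1AB in auto)
  then have "L2_inner lborel (line_fun f x1) (line_fun f x2) = L2_inner lborel (line_fun f (s/2)) (line_fun f (s/2))"
    unfolding hl L2_inner_def ss .
  then show ?thesis by (simp add: L2_inner_self s_def)
qed

lemma hardy_strip_diff:
  assumes f: "f \<in> hardy_strip b" and x1: "0 < x1" "x1 < b" and x2: "0 < x2" "x2 < b"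
  shows "norm_sq lborel (\<lambda>y. line_fun f x1 y - line_fun f x2 y) = line_sq f x1 + line_sq f x2 - 2 * line_sq f ((x1 + x2) / 2)"
  using norm_sq_diff[OF hardy_strip_L2[OF f x1] hardy_strip_L2[OF f x2]] hardy_strip_inner[OF f x1 x2] by simp

lemma hardy_strip_midpoint_convex:
  assumes f: "f \<in> hardy_strip b" and x1: "0 < x1" "x1 < b" and x2: "0 < x2" "x2 < b"
  shows "2 * line_sq f ((x1 + x2) / 2) \<le> line_sq f x1 + line_sq f x2"
  using hardy_strip_diff[OF assms] norm_sq_nonneg[of lborel "\<lambda>y. line_fun f x1 y - line_fun f x2 y"] by linarith

text \<open>
  Let \<open>L\<close> be the upper limit at \<open>0\<close>, and let \<open>N s > L - r\<close> at a small \<open>s\<close>. For \<open>0 < u < 2 * s\<close> the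
  point \<open>s\<close> is the midpoint of \<open>u\<close> and \<open>2 * s - u\<close>, and \<open>N (2 * s - u) < L + r\<close>; hence
  \<open>N u > L - 3 * r\<close>.
\<close>

lemma midpoint_convex_limit_at_0:
  fixes N :: "real \<Rightarrow> real"
  assumes b: "b > 0" and bd: "\<And>x. 0 < x \<Longrightarrow> x < b \<Longrightarrow> 0 \<le> N x \<and> N x \<le> C"
    and mid: "\<And>x1 x2. 0 < x1 \<Longrightarrow> x1 < b \<Longrightarrow> 0 < x2 \<Longrightarrow> x2 < b \<Longrightarrow> 2 * N ((x1 + x2) / 2) \<le> N x1 + N x2"
  shows "\<exists>L. (N \<longlongrightarrow> L) (at_right 0)"
proof -
  define M where "M d = (SUP x\<in>{0<..<d}. N x)" for d
  define L where "L = (INF d\<in>{0<..b}. M d)"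
  have bdd: "bdd_above (N ` {0<..<d})" if "0 < d" "d \<le> b" for d
    using that bd by (intro bdd_aboveI2[of _ _ C]) auto
  have M: "N x \<le> M d" if "0 < x" "x < d" "d \<le> b" for x d
    unfolding M_def using that by (intro cSUP_upper bdd) auto
  have M0: "0 \<le> M d" if "d \<in> {0<..b}" for d
    using M[of "d/2" d] bd[of "d/2"] that by auto
  have bl: "bdd_below (M ` {0<..b})" by (rule bdd_belowI2[OF M0])
  have LM: "L \<le> M d" if "0 < d" "d \<le> b" for d
    unfolding L_def using that by (intro cINF_lower bl) auto
  have "(N \<longlongrightarrow> L) (at_right 0)"
  proof (rule tendstoI)
    fix e :: real assume e: "e > 0"
    define r where "r = e / 4"
    have r: "r > 0" using e by (simp add: r_def)
    have "(INF d\<in>{0<..b}. M d) < L + r" using r by (simp add: L_def)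
    then obtain d where d: "0 < d" "d \<le> b" "M d < L + r"
      using cINF_less_iff[OF _ bl, of "L + r"] b by auto
    have "L - r < M (d/2)" using LM[of "d/2"] d r by auto
    then obtain s where s: "0 < s" "s < d/2" "L - r < N s"
      unfolding M_def using less_cSUP_iff[of "{0<..<d/2}" N "L - r"] bdd[of "d/2"] d by auto
    have "dist (N u) L < e" if u: "0 < u" "u < 2 * s" for u
    proof -
      have "N (2 * s - u) \<le> M d" "N u \<le> M d" using u s d by (auto intro!: M)
      moreover have "2 * N s \<le> N u + N (2 * s - u)" using mid[of u "2 * s - u"] u s d by auto
      ultimately have "N u < L + r" "N u > L - 3 * r" using d s by linarith+
      then show ?thesis using r by (simp add: dist_real_def r_def abs_less_iff)
    qed
    then show "\<forall>\<^sub>F x in at_right 0. dist (N x) L < e"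
      unfolding eventually_at_right_field using s by (intro exI[of _ "2 * s"]) auto
  qed
  then show ?thesis by blast
qed

text \<open>
  By \<open>hardy_strip_diff\<close> and the existence of the limit of the squared norms, the vertical sections
  form a Cauchy family at \<open>0\<close>.
\<close>

lemma hardy_strip_boundary_exists:
  assumes f: "f \<in> hardy_strip b" and b: "b > 0"
  shows "\<exists>\<phi>\<in>L2 lborel. ((\<lambda>x. norm_sq lborel (\<lambda>y. line_fun f x y - \<phi> y)) \<longlongrightarrow> 0) (at_right 0)"
proof -
  obtain C where C: "C \<ge> 0" "\<And>x. 0 < x \<Longrightarrow> x < b \<Longrightarrow> line_sq f x \<le> C" using hardy_strip_bounded[OF f] by blast
  obtain L where L: "(line_sq f \<longlongrightarrow> L) (at_right 0)"
    using midpoint_convex_limit_at_0[OF b, of "line_sq f" C] C hardy_strip_midpoint_convex[OF f] by auto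
  have Cauchy: "\<exists>d>0. d \<le> b \<and> (\<forall>x1 x2. 0 < x1 \<longrightarrow> x1 < d \<longrightarrow> 0 < x2 \<longrightarrow> x2 < d \<longrightarrow>
      norm_sq lborel (\<lambda>y. line_fun f x1 y - line_fun f x2 y) < e)" if e: "e > 0" for e
  proof -
    have "\<forall>\<^sub>F x in at_right 0. dist (line_sq f x) L < e / 4" using tendstoD[OF L, of "e/4"] e by simp
    then obtain d where d: "d > 0" "\<And>x. 0 < x \<Longrightarrow> x < d \<Longrightarrow> dist (line_sq f x) L < e / 4"
      unfolding eventually_at_right_field by auto
    show ?thesis
    proof (intro exI[of _ "min d b"] conjI allI impI)
      fix x1 x2 assume x: "0 < x1" "x1 < min d b" "0 < x2" "x2 < min d b"
      then have "0 < (x1 + x2) / 2" "(x1 + x2) / 2 < d" by auto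
      with x have "dist (line_sq f x1) L < e / 4" "dist (line_sq f x2) L < e / 4" "dist (line_sq f ((x1 + x2) / 2)) L < e / 4"
        using d(2)[of x1] d(2)[of x2] d(2)[of "(x1 + x2) / 2"] by (auto simp del: divide_const_simps)
      then have "line_sq f x1 + line_sq f x2 - 2 * line_sq f ((x1 + x2) / 2) < e"
        unfolding dist_real_def by linarith
      then show "norm_sq lborel (\<lambda>y. line_fun f x1 y - line_fun f x2 y) < e"
        using x hardy_strip_diff[OF f, of x1 x2] by auto
    qed (use b d in auto)
  qed
  \<comment> \<open>a sequence in the open interval from 0 to b tending to 0\<close>
  define t where "t n = b * inverse (real (Suc (Suc n)))" for n
  have t: "0 < t n" "t n < b" for n
    using b mult_strict_left_mono[of "inverse (real (Suc (Suc n)))" 1 b] by (auto simp: t_def divide_simps)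
  have tl: "t \<longlonglongrightarrow> 0" unfolding t_def by (rule tendsto_mult_right_zero[OF LIMSEQ_Suc[OF LIMSEQ_inverse_real_of_nat]])
  have "\<exists>\<phi>\<in>L2 lborel. (\<lambda>n. norm_sq lborel (\<lambda>y. line_fun f (t n) y - \<phi> y)) \<longlonglongrightarrow> 0"
  proof (rule L2_complete)
    show "line_fun f (t n) \<in> L2 lborel" for n using hardy_strip_L2[OF f t] .
    fix e :: real assume "e > 0"
    from Cauchy[OF this] obtain d where d: "d > 0"
      "\<And>x1 x2. 0 < x1 \<Longrightarrow> x1 < d \<Longrightarrow> 0 < x2 \<Longrightarrow> x2 < d \<Longrightarrow> norm_sq lborel (\<lambda>y. line_fun f x1 y - line_fun f x2 y) < e" by blast
    obtain N where "\<And>n. n \<ge> N \<Longrightarrow> t n < d" using order_tendstoD(2)[OF tl d(1)] by (auto simp: eventually_sequentially)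
    then show "\<exists>N. \<forall>m\<ge>N. \<forall>n\<ge>N. norm_sq lborel (\<lambda>x. line_fun f (t m) x - line_fun f (t n) x) < e"
      using d t by (intro exI[of _ N]) auto
  qed
  then obtain \<phi> where \<phi>: "\<phi> \<in> L2 lborel" "(\<lambda>n. norm_sq lborel (\<lambda>y. line_fun f (t n) y - \<phi> y)) \<longlonglongrightarrow> 0" by blast
  have "((\<lambda>x. norm_sq lborel (\<lambda>y. line_fun f x y - \<phi> y)) \<longlongrightarrow> 0) (at_right 0)"
  proof (rule tendstoI)
    fix e :: real assume e: "e > 0"
    then obtain d where d: "d > 0" "d \<le> b"
      "\<And>x1 x2. 0 < x1 \<Longrightarrow> x1 < d \<Longrightarrow> 0 < x2 \<Longrightarrow> x2 < d \<Longrightarrow> norm_sq lborel (\<lambda>y. line_fun f x1 y - line_fun f x2 y) < e / 4" 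
      using Cauchy[of "e/4"] by auto
    have "\<forall>\<^sub>F n in sequentially. t n < d \<and> norm_sq lborel (\<lambda>y. line_fun f (t n) y - \<phi> y) < e / 4"
      using order_tendstoD(2)[OF tl d(1)] order_tendstoD(2)[OF \<phi>(2), of "e/4"] e by (auto intro: eventually_conj)
    then obtain n where n: "t n < d" "norm_sq lborel (\<lambda>y. line_fun f (t n) y - \<phi> y) < e / 4"
      using eventually_happens by fastforce
    have "dist (norm_sq lborel (\<lambda>y. line_fun f x y - \<phi> y)) 0 < e" if x: "0 < x" "x < d" for x
    proof -
      have "norm_sq lborel (\<lambda>y. line_fun f x y - \<phi> y)
          \<le> 2 * norm_sq lborel (\<lambda>y. line_fun f x y - line_fun f (t n) y) + 2 * norm_sq lborel (\<lambda>y. line_fun f (t n) y - \<phi> y)"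
        by (rule norm_sq_diff_le) (use x d t[of n] \<phi>(1) in \<open>auto intro: hardy_strip_L2[OF f]\<close>)
      moreover have "norm_sq lborel (\<lambda>y. line_fun f x y - line_fun f (t n) y) < e / 4" using d(3)[of x "t n"] x n t by auto
      ultimately show ?thesis using n by simp
    qed
    then show "\<forall>\<^sub>F x in at_right 0. dist (norm_sq lborel (\<lambda>y. line_fun f x y - \<phi> y)) 0 < e"
      unfolding eventually_at_right_field using d by (intro exI[of _ d]) auto
  qed
  with \<phi> show ?thesis by blast
qed

text \<open>
  The chosen boundary function is only known to be measurable and to be a limit with respect to a
  nonnegative integral. It differs from some section by a function of finite norm, and this makes it
  square integrable.
\<close>

lemma boundary_value_spec:
  assumes f: "f \<in> hardy_strip b" and b: "b > 0"
  shows "boundary_value f \<in> L2 lborel"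
    and "((\<lambda>x. norm_sq lborel (\<lambda>y. line_fun f x y - boundary_value f y)) \<longlongrightarrow> 0) (at_right 0)"
proof -
  let ?P = "\<lambda>\<phi>. \<phi> \<in> borel_measurable lborel \<and>
     ((\<lambda>x. \<integral>\<^sup>+y. ennreal ((cmod (f (Complex x y) - \<phi> y))\<^sup>2) \<partial>lborel) \<longlongrightarrow> 0) (at_right 0)"
  have ev: "\<forall>\<^sub>F x in at_right 0. 0 < x \<and> x < b"
    unfolding eventually_at_right_field using b by (intro exI[of _ b]) auto
  have eq: "\<forall>\<^sub>F x in at_right 0. (\<integral>\<^sup>+y. ennreal ((cmod (f (Complex x y) - \<phi> y))\<^sup>2) \<partial>lborel)
      = ennreal (norm_sq lborel (\<lambda>y. line_fun f x y - \<phi> y))" if "\<phi> \<in> L2 lborel" for \<phi>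
    using ev
  proof eventually_elim
    case (elim x)
    then have "(\<lambda>y. line_fun f x y - \<phi> y) \<in> L2 lborel" using that by (intro L2_diff hardy_strip_L2[OF f]) auto
    from nn_integral_norm_sq[OF this] show ?case by (simp add: line_fun_def)
  qed
  obtain \<phi> where \<phi>: "\<phi> \<in> L2 lborel" "((\<lambda>x. norm_sq lborel (\<lambda>y. line_fun f x y - \<phi> y)) \<longlongrightarrow> 0) (at_right 0)"
    using hardy_strip_boundary_exists[OF assms] by blast
  have "((\<lambda>x. ennreal (norm_sq lborel (\<lambda>y. line_fun f x y - \<phi> y))) \<longlongrightarrow> 0) (at_right 0)"
    using tendsto_ennrealI[OF \<phi>(2)] by simp
  then have "?P \<phi>" using \<phi>(1) tendsto_cong[OF eq[OF \<phi>(1)]] using L2_measurable[OF \<phi>(1)] by simp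
  then have P: "?P (boundary_value f)" unfolding boundary_value_def by (rule someI[of ?P])
  have "\<forall>\<^sub>F x in at_right 0. (\<integral>\<^sup>+y. ennreal ((cmod (f (Complex x y) - boundary_value f y))\<^sup>2) \<partial>lborel) < 1"
    using P by (auto intro: order_tendstoD)
  then have "\<forall>\<^sub>F x in at_right 0. (\<integral>\<^sup>+y. ennreal ((cmod (f (Complex x y) - boundary_value f y))\<^sup>2) \<partial>lborel) < 1 \<and> 0 < x \<and> x < b"
    using ev by eventually_elim auto
  then obtain x where x: "(\<integral>\<^sup>+y. ennreal ((cmod (f (Complex x y) - boundary_value f y))\<^sup>2) \<partial>lborel) < 1" "0 < x" "x < b"
    using eventually_happens[of _ "at_right (0::real)"] by auto
  have L: "line_fun f x \<in> L2 lborel" using x by (intro hardy_strip_L2[OF f])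
  have "(\<lambda>y. line_fun f x y - boundary_value f y) \<in> L2 lborel"
  proof (rule L2I_nn_integral)
    show "(\<lambda>y. line_fun f x y - boundary_value f y) \<in> borel_measurable lborel"
      by (intro borel_measurable_diff L2_measurable[OF L] conjunct1[OF P])
    show "(\<integral>\<^sup>+y. ennreal ((cmod (line_fun f x y - boundary_value f y))\<^sup>2) \<partial>lborel) < \<infinity>"
      using x(1) by (simp add: line_fun_def less_trans)
  qed
  from L2_diff[OF L this] show bL: "boundary_value f \<in> L2 lborel" by simp
  have "((\<lambda>x. ennreal (norm_sq lborel (\<lambda>y. line_fun f x y - boundary_value f y))) \<longlongrightarrow> ennreal 0) (at_right 0)"
    using P tendsto_cong[OF eq[OF bL]] by simp
  then show "((\<lambda>x. norm_sq lborel (\<lambda>y. line_fun f x y - boundary_value f y)) \<longlongrightarrow> 0) (at_right 0)"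
    by (subst (asm) tendsto_ennreal_iff) auto
qed

lemma line_sq_tendsto_boundary:
  assumes f: "f \<in> hardy_strip b" and b: "b > 0"
  shows "(line_sq f \<longlongrightarrow> norm_sq lborel (boundary_value f)) (at_right 0)"
proof (rule norm_sq_tendsto[OF _ boundary_value_spec[OF assms]])
  show "\<forall>\<^sub>F x in at_right 0. line_fun f x \<in> L2 lborel"
    unfolding eventually_at_right_field using b by (intro exI[of _ b]) (auto intro: hardy_strip_L2[OF f])
qed

lemma line_inner_tendsto_boundary:
  assumes f: "f \<in> hardy_strip b" and g: "g \<in> hardy_strip b" and b: "b > 0"
  shows "((\<lambda>x. L2_inner lborel (line_fun f x) (line_fun g x)) \<longlongrightarrow> L2_inner lborel (boundary_value f) (boundary_value g)) (at_right 0)"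
proof (rule L2_inner_tendsto[OF _ boundary_value_spec[OF f b] _ boundary_value_spec[OF g b]])
  show "\<forall>\<^sub>F x in at_right 0. line_fun f x \<in> L2 lborel" "\<forall>\<^sub>F x in at_right 0. line_fun g x \<in> L2 lborel"
    unfolding eventually_at_right_field using b by (auto intro!: exI[of _ b] hardy_strip_L2[OF f] hardy_strip_L2[OF g])
qed

text \<open>
  Every point is the midpoint of the nearer endpoint and another point of the interval. So the
  supremum is at most the average of itself and the larger endpoint value.
\<close>

lemma midpoint_convex_le_max:
  fixes N :: "real \<Rightarrow> real"
  assumes bd: "\<And>x. a \<le> x \<Longrightarrow> x \<le> c \<Longrightarrow> N x \<le> C"
    and mid: "\<And>x1 x2. a \<le> x1 \<Longrightarrow> x1 \<le> c \<Longrightarrow> a \<le> x2 \<Longrightarrow> x2 \<le> c \<Longrightarrow> 2 * N ((x1 + x2) / 2) \<le> N x1 + N x2"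
    and x: "a \<le> x" "x \<le> c"
  shows "N x \<le> max (N a) (N c)"
proof -
  define S where "S = (SUP x\<in>{a..c}. N x)"
  have bdd: "bdd_above (N ` {a..c})" using bd by (intro bdd_aboveI2[of _ _ C]) auto
  have S: "N x \<le> S" if "a \<le> x" "x \<le> c" for x unfolding S_def by (intro cSUP_upper bdd) (use that in auto)
  let ?m = "max (N a) (N c)"
  have "N x \<le> (?m + S) / 2" if x: "a \<le> x" "x \<le> c" for x
  proof (cases "x \<le> (a + c) / 2")
    case True
    then have "2 * N ((a + (2 * x - a)) / 2) \<le> N a + N (2 * x - a)" using x by (intro mid) auto
    moreover have "N (2 * x - a) \<le> S" using x True by (intro S) auto
    ultimately show ?thesis by auto
  next
    case False
    then have "2 * N ((c + (2 * x - c)) / 2) \<le> N c + N (2 * x - c)" using x by (intro mid) auto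
    moreover have "N (2 * x - c) \<le> S" using x False by (intro S) auto
    ultimately show ?thesis by auto
  qed
  then have "S \<le> (?m + S) / 2" unfolding S_def by (intro cSUP_least) (use x in auto)
  then show ?thesis using S[OF x] by simp
qed

text \<open>
  A three-lines theorem: the sections inside a strip are controlled by those on its two boundary
  lines. It is the reason why a norm that only sees the half-integer lines controls all lines.
\<close>

lemma hardy_strip_le_max:
  assumes f: "f \<in> hardy_strip b" and c: "0 < x" "x \<le> c" "c < b"
  shows "line_sq f x \<le> max (norm_sq lborel (boundary_value f)) (line_sq f c)"
proof -
  obtain C where C: "C \<ge> 0" "\<And>x. 0 < x \<Longrightarrow> x < b \<Longrightarrow> line_sq f x \<le> C" using hardy_strip_bounded[OF f] by blast
  have "\<forall>\<^sub>F a in at_right 0. line_sq f x \<le> max (line_sq f a) (line_sq f c)"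
    unfolding eventually_at_right_field
  proof (intro exI[of _ x] conjI allI impI)
    fix a assume a: "0 < a" "a < x"
    show "line_sq f x \<le> max (line_sq f a) (line_sq f c)"
      by (rule midpoint_convex_le_max[of a c "line_sq f" C x]) (use a c in \<open>auto intro!: C(2) hardy_strip_midpoint_convex[OF f]\<close>)
  qed (use c in auto)
  moreover have "((\<lambda>a. max (line_sq f a) (line_sq f c)) \<longlongrightarrow> max (norm_sq lborel (boundary_value f)) (line_sq f c)) (at_right 0)"
    using c by (intro tendsto_max tendsto_const line_sq_tendsto_boundary[OF f]) auto
  ultimately show ?thesis by (intro tendsto_lowerbound[where F="at_right (0::real)"]) auto
qed

lemma norm_sq_eq_0_AE:
  assumes "u \<in> L2 M" "norm_sq M u = 0"
  shows "AE x in M. u x = 0"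
proof -
  have "AE x in M. (cmod (u x))\<^sup>2 = 0"
    using assms integral_nonneg_eq_0_iff_AE[of M "\<lambda>x. (cmod (u x))\<^sup>2"] by (auto simp: norm_sq_def L2_integrable)
  then show ?thesis by eventually_elim simp
qed

text \<open>
  Limits in the mean are unique up to null sets.
\<close>

lemma boundary_value_lincomb:
  assumes f: "f \<in> hardy_strip b" and g: "g \<in> hardy_strip b" and h: "(\<lambda>z. p * f z + q * g z) \<in> hardy_strip b" and b: "b > 0"
  shows "AE y in lborel. boundary_value (\<lambda>z. p * f z + q * g z) y = p * boundary_value f y + q * boundary_value g y"
proof -
  let ?h = "\<lambda>z. p * f z + q * g z"
  define d where "d = (\<lambda>y. boundary_value ?h y - (p * boundary_value f y + q * boundary_value g y))"
  note F = boundary_value_spec[OF f b] and G = boundary_value_spec[OF g b] and H = boundary_value_spec[OF h b]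
  have d: "d \<in> L2 lborel" unfolding d_def by (intro L2_diff L2_lincomb F G H)
  let ?e = "\<lambda>x. 2 * norm_sq lborel (\<lambda>y. line_fun ?h x y - boundary_value ?h y)
     + 4 * (cmod p)\<^sup>2 * norm_sq lborel (\<lambda>y. line_fun f x y - boundary_value f y)
     + 4 * (cmod q)\<^sup>2 * norm_sq lborel (\<lambda>y. line_fun g x y - boundary_value g y)"
  have "norm_sq lborel d \<le> 0"
  proof (rule tendsto_lowerbound)
    show "(?e \<longlongrightarrow> 0) (at_right 0)"
      by (rule tendsto_eq_rhs[OF tendsto_add[OF tendsto_add[OF tendsto_mult_left[OF H(2)] tendsto_mult_left[OF F(2)]] tendsto_mult_left[OF G(2)]]]) simp
    show "\<forall>\<^sub>F x in at_right 0. norm_sq lborel d \<le> ?e x"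
      unfolding eventually_at_right_field
    proof (intro exI[of _ b] conjI allI impI)
      fix x assume x: "0 < x" "x < b"
      define dh where "dh y = line_fun ?h x y - boundary_value ?h y" for y
      define df where "df y = line_fun f x y - boundary_value f y" for y
      define dg where "dg y = line_fun g x y - boundary_value g y" for y
      have L: "dh \<in> L2 lborel" "df \<in> L2 lborel" "dg \<in> L2 lborel"
        unfolding dh_def dg_def df_def by (intro L2_diff hardy_strip_L2[OF h] hardy_strip_L2[OF f] hardy_strip_L2[OF g] x F G H)+
      have dd: "(cmod (d y))\<^sup>2 \<le> 2 * (cmod (dh y))\<^sup>2 + 4 * (cmod p)\<^sup>2 * (cmod (df y))\<^sup>2 + 4 * (cmod q)\<^sup>2 * (cmod (dg y))\<^sup>2" for y
      proof -
        have "d y = - dh y + (p * df y + q * dg y)" by (simp add: d_def dh_def df_def dg_def line_fun_def algebra_simps)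
        then have "(cmod (d y))\<^sup>2 \<le> 2 * (cmod (- dh y))\<^sup>2 + 2 * (cmod (p * df y + q * dg y))\<^sup>2" using cmod_add_sq_le by metis
        moreover have "(cmod (p * df y + q * dg y))\<^sup>2 \<le> 2 * (cmod (p * df y))\<^sup>2 + 2 * (cmod (q * dg y))\<^sup>2" by (rule cmod_add_sq_le)
        ultimately show ?thesis by (simp add: norm_mult power_mult_distrib)
      qed
      have "norm_sq lborel d \<le> (LINT y|lborel. 2 * (cmod (dh y))\<^sup>2 + 4 * (cmod p)\<^sup>2 * (cmod (df y))\<^sup>2 + 4 * (cmod q)\<^sup>2 * (cmod (dg y))\<^sup>2)"
        unfolding norm_sq_def by (rule integral_mono) (use d L dd in \<open>auto simp: L2_integrable\<close>)
      also have "\<dots> = 2 * norm_sq lborel dh + 4 * (cmod p)\<^sup>2 * norm_sq lborel df + 4 * (cmod q)\<^sup>2 * norm_sq lborel dg"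
        using L unfolding norm_sq_def by (simp add: L2_integrable)
      finally show "norm_sq lborel d \<le> ?e x" unfolding dh_def df_def dg_def .
    qed (use b in auto)
  qed simp
  then have "norm_sq lborel d = 0" using norm_sq_nonneg[of lborel d] by linarith
  from norm_sq_eq_0_AE[OF d this] show ?thesis by eventually_elim (simp add: d_def)
qed

section \<open>Functions square-integrable on the half-integer lines\<close>

lemma sets_omega [simp, measurable_cong]: "sets omega = sets borel"
  by (simp add: omega_def)

lemma space_omega [simp]: "space omega = UNIV"
  by (simp add: omega_def)

lemma measurable_half_integer_lines:
  "(\<lambda>(n, y). Complex (real n / 2) y)
     \<in> density (count_space (UNIV :: nat set)) (\<lambda>n. ennreal (2 ^ n / fact n)) \<Otimes>\<^sub>M lborel \<rightarrow>\<^sub>M borel"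
proof -
  let ?D = "density (count_space (UNIV :: nat set)) (\<lambda>n. ennreal (2 ^ n / fact n))"
  have "(\<lambda>n. real n / 2) \<in> ?D \<rightarrow>\<^sub>M borel" by (simp cong: measurable_cong_sets)
  then have "(\<lambda>p. real (fst p) / 2) \<in> ?D \<Otimes>\<^sub>M lborel \<rightarrow>\<^sub>M borel"
    using measurable_compose[OF measurable_fst] by blast
  moreover have "snd \<in> ?D \<Otimes>\<^sub>M lborel \<rightarrow>\<^sub>M borel"
    using measurable_snd[of ?D lborel] by (simp cong: measurable_cong_sets)
  ultimately have "(\<lambda>p. Complex (real (fst p) / 2) (snd p)) \<in> borel_measurable (?D \<Otimes>\<^sub>M lborel)"
    by (intro measurable_Complex)
  then show ?thesis by (simp add: case_prod_beta')
qed

lemma nn_integral_omega: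
  assumes F: "F \<in> borel_measurable borel"
  shows "(\<integral>\<^sup>+z. F z \<partial>omega) = (\<Sum>n. ennreal (2 ^ n / fact n) * (\<integral>\<^sup>+y. F (Complex (real n / 2) y) \<partial>lborel))"
proof -
  let ?D = "density (count_space (UNIV :: nat set)) (\<lambda>n. ennreal (2 ^ n / fact n))"
  let ?g = "\<lambda>(n, y). Complex (real n / 2) y"
  have "(\<integral>\<^sup>+z. F z \<partial>omega) = (\<integral>\<^sup>+p. F (?g p) \<partial>(?D \<Otimes>\<^sub>M lborel))"
    unfolding omega_def by (rule nn_integral_distr[OF measurable_half_integer_lines]) (simp add: F)
  also have "\<dots> = (\<integral>\<^sup>+n. \<integral>\<^sup>+y. F (?g (n, y)) \<partial>lborel \<partial>?D)"
    by (rule lborel.nn_integral_fst[symmetric]) (rule measurable_compose[OF measurable_half_integer_lines F])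
  also have "\<dots> = (\<integral>\<^sup>+n. ennreal (2 ^ n / fact n) * (\<integral>\<^sup>+y. F (Complex (real n / 2) y) \<partial>lborel) \<partial>count_space UNIV)"
    by (subst nn_integral_density) auto
  also have "\<dots> = (\<Sum>n. ennreal (2 ^ n / fact n) * (\<integral>\<^sup>+y. F (Complex (real n / 2) y) \<partial>lborel))"
    by (rule nn_integral_count_space_nat)
  finally show ?thesis .
qed

lemma integral_omega:
  fixes F :: "complex \<Rightarrow> 'a::{banach, second_countable_topology}"
  assumes F: "integrable omega F"
  shows "(\<lambda>n. (2 ^ n / fact n) *\<^sub>R (LINT y|lborel. F (Complex (real n / 2) y))) sums (LINT z|omega. F z)"
proof -
  let ?D = "density (count_space (UNIV :: nat set)) (\<lambda>n. ennreal (2 ^ n / fact n))"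
  let ?g = "\<lambda>(n, y). Complex (real n / 2) y"
  have sf: "sigma_finite_measure ?D"
  proof (subst sigma_finite_measure.sigma_finite_iff_density_finite)
    show "sigma_finite_measure (count_space (UNIV :: nat set))"
      by (rule sigma_finite_measure_count_space)
  qed auto
  interpret P: pair_sigma_finite ?D lborel
    by (rule pair_sigma_finite.intro[OF sf]) (rule lborel.sigma_finite_measure_axioms)
  have Fm: "F \<in> borel_measurable borel" using borel_measurable_integrable[OF F] by (simp cong: measurable_cong_sets)
  have int: "integrable (?D \<Otimes>\<^sub>M lborel) (\<lambda>p. F (?g p))"
    using F integrable_distr_eq[OF measurable_half_integer_lines Fm] unfolding omega_def by simp
  have "(LINT z|omega. F z) = (LINT p|(?D \<Otimes>\<^sub>M lborel). F (?g p))"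
    unfolding omega_def by (rule integral_distr[OF measurable_half_integer_lines Fm])
  also have "\<dots> = (LINT n|?D. LINT y|lborel. F (?g (n, y)))"
    by (rule P.integral_fst'[OF int, symmetric])
  also have "\<dots> = (LINT n|count_space UNIV. (2 ^ n / fact n) *\<^sub>R (LINT y|lborel. F (Complex (real n / 2) y)))"
    by (subst integral_density) auto
  finally have eq: "(LINT z|omega. F z) = (LINT n|count_space UNIV. (2 ^ n / fact n) *\<^sub>R (LINT y|lborel. F (Complex (real n / 2) y)))" .
  have "integrable ?D (\<lambda>n. LINT y|lborel. F (?g (n, y)))"
    by (rule P.integrable_fst'[OF int])
  then have "integrable (count_space UNIV) (\<lambda>n. (2 ^ n / fact n) *\<^sub>R (LINT y|lborel. F (Complex (real n / 2) y)))"
    by (subst (asm) integrable_density) auto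
  from sums_integral_count_space_nat[OF this] show ?thesis by (simp add: eq)
qed

abbreviation (input) RHP where "RHP \<equiv> right_half_plane"

lemma open_RHP: "open RHP"
  by (simp add: right_half_plane_def open_halfspace_Re_gt)

lemma holo_space_measurable:
  assumes "open D" "f \<in> holo_space D"
  shows "f \<in> borel_measurable borel"
proof -
  have "(\<lambda>z. if z \<in> D then f z else 0) \<in> borel_measurable borel"
    using assms holomorphic_on_imp_continuous_on[of f D]
    by (intro borel_measurable_continuous_on_if) (auto simp: holo_space_def continuous_on_const)
  moreover have "(\<lambda>z. if z \<in> D then f z else 0) = f" using assms by (auto simp: holo_space_def)
  ultimately show ?thesis by simp
qed

lemma with_boundary_measurable:
  assumes "f \<in> holo_space RHP" "boundary_value f \<in> borel_measurable borel"
  shows "with_boundary f \<in> borel_measurable borel"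
proof -
  note [measurable] = holo_space_measurable[OF open_RHP assms(1)] assms(2)
  show ?thesis unfolding with_boundary_def[abs_def] by measurable
qed

lemma line_fun_with_boundary:
  "line_fun (with_boundary f) (real n / 2) = (if n = 0 then boundary_value f else line_fun f (real n / 2))"
  by (auto simp: line_fun_def with_boundary_def)

lemma L2_line_with_boundary:
  assumes "\<And>b. b > 0 \<Longrightarrow> f \<in> hardy_strip b"
  shows "line_fun (with_boundary f) (real n / 2) \<in> L2 lborel"
  unfolding line_fun_with_boundary
  using boundary_value_spec(1)[OF assms[of 1]] hardy_strip_L2[OF assms[of "real n"], of "real n / 2"] by auto

lemma M2_omega_hardy_strip: "f \<in> M2_omega \<Longrightarrow> b > 0 \<Longrightarrow> f \<in> hardy_strip b"
  by (simp add: M2_omega_def)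

lemma M2_omega_L2: "f \<in> M2_omega \<Longrightarrow> with_boundary f \<in> L2 omega"
  by (simp add: M2_omega_def L2_def)

text \<open>
  The share of the \<open>n\<close>-th line in the squared norm; for \<open>n = 0\<close> this line carries the boundary
  values.
\<close>

definition omega_term :: "(complex \<Rightarrow> complex) \<Rightarrow> nat \<Rightarrow> real" where
  "omega_term f n = 2 ^ n / fact n * line_sq (with_boundary f) (real n / 2)"

lemma omega_term_nonneg: "omega_term f n \<ge> 0"
  by (simp add: omega_term_def)

lemma M2_omegaI:
  assumes f: "f \<in> holo_space RHP" "\<And>b. b > 0 \<Longrightarrow> f \<in> hardy_strip b" and s: "summable (omega_term f)"
  shows "f \<in> M2_omega"
proof -
  have "boundary_value f \<in> borel_measurable borel" using L2_measurable[OF boundary_value_spec(1)[OF f(2)[of 1]]] by simp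
  then have m[measurable]: "with_boundary f \<in> borel_measurable borel" by (rule with_boundary_measurable[OF f(1)])
  have "(\<integral>\<^sup>+z. ennreal ((cmod (with_boundary f z))\<^sup>2) \<partial>omega)
     = (\<Sum>n. ennreal (2 ^ n / fact n) * (\<integral>\<^sup>+y. ennreal ((cmod (with_boundary f (Complex (real n / 2) y)))\<^sup>2) \<partial>lborel))"
    by (rule nn_integral_omega) measurable
  also have "\<dots> = (\<Sum>n. ennreal (omega_term f n))"
  proof (rule suminf_cong)
    fix n
    have "(\<integral>\<^sup>+y. ennreal ((cmod (with_boundary f (Complex (real n / 2) y)))\<^sup>2) \<partial>lborel) = ennreal (line_sq (with_boundary f) (real n / 2))"
      using nn_integral_norm_sq[OF L2_line_with_boundary[OF f(2), of n]] by (simp add: line_fun_def)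
    then show "ennreal (2 ^ n / fact n) * (\<integral>\<^sup>+y. ennreal ((cmod (with_boundary f (Complex (real n / 2) y)))\<^sup>2) \<partial>lborel) = ennreal (omega_term f n)"
      by (simp add: omega_term_def ennreal_mult[symmetric])
  qed
  also have "\<dots> = ennreal (\<Sum>n. omega_term f n)"
    by (rule suminf_ennreal2[OF omega_term_nonneg s])
  also have "\<dots> < \<infinity>" by simp
  finally have "with_boundary f \<in> L2 omega" using m by (intro L2I_nn_integral) (simp_all cong: measurable_cong_sets)
  then show ?thesis using f by (simp add: M2_omega_def L2_def)
qed

lemma omega_term_sums:
  assumes f: "f \<in> M2_omega"
  shows "omega_term f sums norm_sq omega (with_boundary f)"
  using integral_omega[OF L2_integrable[OF M2_omega_L2[OF f]]]
  by (simp add: omega_term_def[abs_def] norm_sq_def line_fun_def)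

lemma M2_omega_norm_eq: "f \<in> M2_omega \<Longrightarrow> M2_omega_norm f = sqrt (norm_sq omega (with_boundary f))"
  using sums_unique[OF omega_term_sums[of f]]
  by (simp add: M2_omega_norm_def omega_term_def[abs_def] norm_sq_def[of lborel] line_fun_def)

lemma M2_omega_inner_sums:
  assumes "f \<in> M2_omega" "g \<in> M2_omega"
  shows "(\<lambda>n. of_real (2 ^ n / fact n) * L2_inner lborel (line_fun (with_boundary f) (real n / 2)) (line_fun (with_boundary g) (real n / 2)))
     sums L2_inner omega (with_boundary f) (with_boundary g)"
  using integral_omega[OF L2_inner_integrable[OF assms[THEN M2_omega_L2]]]
  by (simp add: L2_inner_def line_fun_def scaleR_conv_of_real)

lemma M2_omega_inner_eq:
  assumes "f \<in> M2_omega" "g \<in> M2_omega"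
  shows "M2_omega_inner f g = L2_inner omega (with_boundary f) (with_boundary g)"
  using sums_unique[OF M2_omega_inner_sums[OF assms]]
  by (simp add: M2_omega_inner_def L2_inner_def[of lborel] line_fun_def)

lemma hardy_strip_lincomb:
  assumes f: "f \<in> hardy_strip b" and g: "g \<in> hardy_strip b"
  shows "(\<lambda>z. p * f z + q * g z) \<in> hardy_strip b"
proof -
  obtain C where C: "C \<ge> 0" "\<And>x. 0 < x \<Longrightarrow> x < b \<Longrightarrow> line_sq f x \<le> C" using hardy_strip_bounded[OF f] by blast
  obtain D where D: "D \<ge> 0" "\<And>x. 0 < x \<Longrightarrow> x < b \<Longrightarrow> line_sq g x \<le> D" using hardy_strip_bounded[OF g] by blast
  show ?thesis
  proof (rule hardy_stripI)
    show "(\<lambda>z. p * f z + q * g z) holomorphic_on strip b" using f g by (auto simp: hardy_strip_def intro!: holomorphic_intros)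
    fix x assume x: "0 < x" "x < b"
    note L = hardy_strip_L2[OF f x] hardy_strip_L2[OF g x]
    have eq: "line_fun (\<lambda>z. p * f z + q * g z) x = (\<lambda>y. p * line_fun f x y + q * line_fun g x y)" by (simp add: line_fun_def)
    have L': "line_fun (\<lambda>z. p * f z + q * g z) x \<in> L2 lborel" unfolding eq by (intro L2_lincomb L)
    have "line_sq (\<lambda>z. p * f z + q * g z) x \<le> (LINT y|lborel. 2 * (cmod p)\<^sup>2 * (cmod (line_fun f x y))\<^sup>2 + 2 * (cmod q)\<^sup>2 * (cmod (line_fun g x y))\<^sup>2)"
      unfolding norm_sq_def
    proof (rule integral_mono)
      show "(cmod (line_fun (\<lambda>z. p * f z + q * g z) x y))\<^sup>2 \<le> 2 * (cmod p)\<^sup>2 * (cmod (line_fun f x y))\<^sup>2 + 2 * (cmod q)\<^sup>2 * (cmod (line_fun g x y))\<^sup>2" for y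
        using cmod_add_sq_le[of "p * line_fun f x y" "q * line_fun g x y"] by (simp add: eq norm_mult power_mult_distrib)
    qed (use L L' in \<open>auto simp: L2_integrable\<close>)
    also have "\<dots> = 2 * (cmod p)\<^sup>2 * line_sq f x + 2 * (cmod q)\<^sup>2 * line_sq g x"
      using L unfolding norm_sq_def by (simp add: L2_integrable)
    also have "\<dots> \<le> 2 * (cmod p)\<^sup>2 * C + 2 * (cmod q)\<^sup>2 * D" using x by (intro add_mono mult_left_mono C(2) D(2)) auto
    finally show "line_fun (\<lambda>z. p * f z + q * g z) x \<in> L2 lborel \<and> line_sq (\<lambda>z. p * f z + q * g z) x \<le> 2 * (cmod p)\<^sup>2 * C + 2 * (cmod q)\<^sup>2 * D" using L' by simp
  qed
qed

text \<open>
  The functions agree off the imaginary axis, and almost everywhere on it by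
  \<open>boundary_value_lincomb\<close>; the exceptional set is null for \<open>omega\<close>.
\<close>

lemma with_boundary_lincomb:
  assumes f: "f \<in> M2_omega" and g: "g \<in> M2_omega"
  shows "(\<lambda>z. p * f z + q * g z) \<in> M2_omega"
    and "AE z in omega. with_boundary (\<lambda>z. p * f z + q * g z) z = p * with_boundary f z + q * with_boundary g z"
proof -
  let ?h = "\<lambda>z. p * f z + q * g z"
  let ?k = "\<lambda>z. p * with_boundary f z + q * with_boundary g z"
  have hs: "?h \<in> hardy_strip b" if "b > 0" for b
    using that by (intro hardy_strip_lincomb M2_omega_hardy_strip f g)
  have bv: "AE y in lborel. boundary_value ?h y = p * boundary_value f y + q * boundary_value g y"
    by (rule boundary_value_lincomb[of _ 1]) (use f g hs in \<open>auto simp: M2_omega_hardy_strip\<close>)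
  have line: "AE y in lborel. with_boundary ?h (Complex (real n / 2) y) = ?k (Complex (real n / 2) y)" for n
    using bv by eventually_elim (simp add: with_boundary_def)
  have hol: "?h \<in> holo_space RHP" using f g by (auto simp: M2_omega_def holo_space_def intro!: holomorphic_intros)
  have m[measurable]: "with_boundary ?h \<in> borel_measurable borel"
    by (rule with_boundary_measurable[OF hol]) (use L2_measurable[OF boundary_value_spec(1)[OF hs[of 1]]] in simp)
  have k: "?k \<in> L2 omega" by (intro L2_lincomb M2_omega_L2 f g)
  have km[measurable]: "?k \<in> borel_measurable borel" using L2_measurable[OF k] by (simp cong: measurable_cong_sets)
  have "(\<integral>\<^sup>+z. ennreal (cmod (with_boundary ?h z - ?k z)) \<partial>omega)
     = (\<Sum>n. ennreal (2 ^ n / fact n) * (\<integral>\<^sup>+y. ennreal (cmod (with_boundary ?h (Complex (real n / 2) y) - ?k (Complex (real n / 2) y))) \<partial>lborel))"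
    by (rule nn_integral_omega) measurable
  also have "\<dots> = (\<Sum>n::nat. 0)"
  proof (rule suminf_cong)
    fix n
    have "(\<integral>\<^sup>+y. ennreal (cmod (with_boundary ?h (Complex (real n / 2) y) - ?k (Complex (real n / 2) y))) \<partial>lborel) = integral\<^sup>N (lborel :: real measure) (\<lambda>_. 0)"
      by (rule nn_integral_cong_AE) (use line[of n] in \<open>eventually_elim, simp\<close>)
    then show "ennreal (2 ^ n / fact n) * (\<integral>\<^sup>+y. ennreal (cmod (with_boundary ?h (Complex (real n / 2) y) - ?k (Complex (real n / 2) y))) \<partial>lborel) = 0" by simp
  qed
  finally have "(\<integral>\<^sup>+z. ennreal (cmod (with_boundary ?h z - ?k z)) \<partial>omega) = 0" by simp
  then have "AE z in omega. ennreal (cmod (with_boundary ?h z - ?k z)) = 0"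
    by (subst (asm) nn_integral_0_iff_AE) simp_all
  then show ae: "AE z in omega. with_boundary ?h z = ?k z"
    by eventually_elim simp
  have "integrable omega (\<lambda>z. (cmod (?k z))\<^sup>2)" by (rule L2_integrable[OF k])
  then have "integrable omega (\<lambda>z. (cmod (with_boundary ?h z))\<^sup>2)"
    by (subst integrable_cong_AE[of _ _ "\<lambda>z. (cmod (?k z))\<^sup>2"]) (use ae in \<open>auto elim: eventually_mono\<close>)
  then show "?h \<in> M2_omega" using hol hs m by (simp add: M2_omega_def cong: measurable_cong_sets)
qed

text \<open>
  Each single line is dominated by the whole norm. The constant is far from optimal, but it depends
  on \<open>m\<close> alone.
\<close>

lemma line_sq_le_M2_omega:
  assumes f: "f \<in> M2_omega" and x: "0 < x" "x \<le> real m / 2"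
  shows "line_sq f x \<le> fact m * norm_sq omega (with_boundary f)"
proof -
  let ?n = "norm_sq omega (with_boundary f)"
  have m: "m > 0" using x by (cases m) auto
  have le: "omega_term f k \<le> ?n" for k
    using sum_le_suminf[OF sums_summable[OF omega_term_sums[OF f]], of "{k}"] omega_term_nonneg[of f]
      sums_unique[OF omega_term_sums[OF f]] by simp
  have n1: "?n \<le> fact m * ?n" using mult_right_mono[OF fact_ge_1 norm_sq_nonneg[of omega "with_boundary f"], of m] by simp
  have "norm_sq lborel (boundary_value f) \<le> fact m * ?n"
    using le[of 0] n1 line_fun_with_boundary[of f 0] by (simp add: omega_term_def)
  moreover have "line_sq f (real m / 2) \<le> fact m * ?n"
  proof -
    have "line_sq f (real m / 2) \<le> 2 ^ m * line_sq f (real m / 2)"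
      using mult_right_mono[of 1 "2 ^ m" "line_sq f (real m / 2)"] by simp
    also have "\<dots> = fact m * omega_term f m" using m by (simp add: omega_term_def line_fun_with_boundary)
    also have "\<dots> \<le> fact m * ?n" by (intro mult_left_mono le) simp
    finally show ?thesis .
  qed
  moreover have "line_sq f x \<le> max (norm_sq lborel (boundary_value f)) (line_sq f (real m / 2))"
    by (rule hardy_strip_le_max[OF M2_omega_hardy_strip[OF f, of "real m"]]) (use x m in auto)
  ultimately show ?thesis by linarith
qed

section \<open>The Gamma function on vertical lines and the kernel functions\<close>

lemma Re_pos_not_nonpos_Int: "Re z > 0 \<Longrightarrow> z \<notin> \<int>\<^sub>\<le>\<^sub>0"
  by (auto elim!: nonpos_Ints_cases)

text \<open>
  In the products approximating \<open>1 / Gamma z\<close>, each factor satisfies \<open>|z + i| \<ge> Re z + i\<close>.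
\<close>

lemma norm_Gamma_le:
  assumes "Re z > 0"
  shows "cmod (Gamma z) \<le> Gamma (Re z)"
proof (rule LIMSEQ_le)
  show "(\<lambda>n. cmod (Gamma_series z n)) \<longlonglongrightarrow> cmod (Gamma z)" by (intro tendsto_norm Gamma_series_LIMSEQ)
  show "Gamma_series (Re z) \<longlonglongrightarrow> Gamma (Re z)" by (rule Gamma_series_LIMSEQ)
  have "cmod (Gamma_series z n) \<le> Gamma_series (Re z) n" for n
  proof -
    have "pochhammer (Re z) (n+1) = (\<Prod>i\<in>{0..n}. Re (z + of_nat i))"
      by (simp add: pochhammer_Suc_prod)
    also have "\<dots> \<le> (\<Prod>i\<in>{0..n}. cmod (z + of_nat i))"
    proof (rule prod_mono)
      fix i assume "i \<in> {0..n}"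
      show "0 \<le> Re (z + of_nat i) \<and> Re (z + of_nat i) \<le> cmod (z + of_nat i)"
        using assms complex_Re_le_cmod[of "z + of_nat i"] by simp
    qed
    also have "\<dots> = cmod (pochhammer z (n+1))" by (simp add: pochhammer_Suc_prod prod_norm)
    finally have *: "pochhammer (Re z) (n+1) \<le> cmod (pochhammer z (n+1))" .
    have "pochhammer (Re z) (n+1) > 0" using assms by (intro pochhammer_pos)
    with * show ?thesis
      unfolding Gamma_series_def norm_divide norm_mult
      by (intro frac_le) (auto simp: norm_exp_eq_Re)
  qed
  then show "\<exists>N. \<forall>n\<ge>N. cmod (Gamma_series z n) \<le> Gamma_series (Re z) n" by blast
qed

text \<open>
  From \<open>Gamma z = Gamma (z + 2) / (z * (z + 1))\<close>, with the numerator bounded on the strip. The decay is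
  in fact exponential, but quadratic decay already gives integrability with uniform bounds.
\<close>

lemma Gamma_strip_bound:
  assumes "0 < a"
  obtains C where "C \<ge> 0" "\<And>z. a \<le> Re z \<Longrightarrow> Re z \<le> b \<Longrightarrow> cmod (Gamma z) \<le> C / (1 + (Im z)\<^sup>2)"
proof -
  have "bounded (Gamma ` {a+2..b+2})"
  proof (intro compact_imp_bounded compact_continuous_image continuous_on_Gamma)
    show "{a + 2..b + 2} \<inter> \<int>\<^sub>\<le>\<^sub>0 = {}"
    proof safe
      fix x :: real assume "x \<in> {a + 2..b + 2}" "x \<in> \<int>\<^sub>\<le>\<^sub>0"
      then show "x \<in> {}" using assms nonpos_Ints_nonpos[of x] by auto
    qed
  qed simp
  then obtain D where D: "D > 0" "\<And>x. x \<in> {a+2..b+2} \<Longrightarrow> \<bar>Gamma x\<bar> \<le> D"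
    by (auto simp: bounded_pos)
  \<comment> \<open>the largest constant with m * (1 + y^2) \<le> a^2 + y^2 for all y\<close>
  define m where "m = min 1 (a\<^sup>2)"
  have m: "0 < m" "m \<le> 1" "m \<le> a\<^sup>2" using assms by (auto simp: m_def)
  have "cmod (Gamma z) \<le> (D / m) / (1 + (Im z)\<^sup>2)" if z: "a \<le> Re z" "Re z \<le> b" for z
  proof -
    have z0: "Re z > 0" using z assms by simp
    have G: "Gamma (z + 2) = (z + 1) * (z * Gamma z)"
      using Gamma_plus1[of z] Gamma_plus1[of "z + 1"] Re_pos_not_nonpos_Int[of z] Re_pos_not_nonpos_Int[of "z+1"] z0
      by (simp add: add.assoc)
    have "cmod (Gamma (z + 2)) \<le> Gamma (Re z + 2)" using norm_Gamma_le[of "z+2"] z0 by simp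
    also have "\<dots> \<le> D" using D(2)[of "Re z + 2"] z by auto
    finally have 1: "cmod (z + 1) * (cmod z * cmod (Gamma z)) \<le> D" by (simp add: G norm_mult)
    have "cmod z \<le> cmod (z + 1)" using z0 by (simp add: cmod_def power2_sum)
    then have "(cmod z)\<^sup>2 \<le> cmod (z + 1) * cmod z" by (simp add: power2_eq_square mult_right_mono)
    moreover have "m * (1 + (Im z)\<^sup>2) \<le> (cmod z)\<^sup>2"
    proof -
      have "a\<^sup>2 \<le> (Re z)\<^sup>2" using z assms by (intro power_mono) auto
      moreover have "m * (Im z)\<^sup>2 \<le> 1 * (Im z)\<^sup>2" using m by (intro mult_right_mono) auto
      ultimately show ?thesis using m by (simp add: cmod_power2 distrib_left)
    qed
    ultimately have "m * (1 + (Im z)\<^sup>2) * cmod (Gamma z) \<le> cmod (z + 1) * cmod z * cmod (Gamma z)"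
      by (intro mult_right_mono) auto
    also have "\<dots> \<le> D" using 1 by (simp add: mult.assoc)
    finally have "cmod (Gamma z) * (m * (1 + (Im z)\<^sup>2)) \<le> D" by (simp add: mult_ac)
    moreover have "0 < m * (1 + (Im z)\<^sup>2)" using m by (intro mult_pos_pos add_pos_nonneg) auto
    ultimately have "cmod (Gamma z) \<le> D / (m * (1 + (Im z)\<^sup>2))" by (simp only: pos_le_divide_eq)
    then show ?thesis by simp
  qed
  then show ?thesis using that[of "D / m"] D m by auto
qed

lemma integrable_lorentz: "integrable lborel (\<lambda>y::real. 1 / (1 + (y - v)\<^sup>2))"
proof -
  let ?f = "\<lambda>y::real. 1 / (1 + y\<^sup>2)"
  have half: "(\<integral>\<^sup>+y. ennreal (?f y) * indicator {0..} y \<partial>lborel) = ennreal (pi / 2 - arctan 0)"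
  proof (rule nn_integral_FTC_atLeast)
    show "DERIV arctan x :> 1 / (1 + x\<^sup>2)" for x using DERIV_arctan[of x] by (simp add: inverse_eq_divide)
  qed (auto intro: tendsto_arctan_at_top)
  have "(\<integral>\<^sup>+y. ennreal (?f y) \<partial>lborel) \<le> (\<integral>\<^sup>+y. ennreal (?f y) * indicator {0..} y + ennreal (?f (-y)) * indicator {0..} (-y) \<partial>lborel)"
    by (rule nn_integral_mono) (auto simp: indicator_def)
  also have "\<dots> = (\<integral>\<^sup>+y. ennreal (?f y) * indicator {0..} y \<partial>lborel) + (\<integral>\<^sup>+y. ennreal (?f (-y)) * indicator {0..} (-y) \<partial>lborel)"
    by (rule nn_integral_add) measurable
  also have "(\<integral>\<^sup>+y. ennreal (?f (-y)) * indicator {0..} (-y) \<partial>lborel) = (\<integral>\<^sup>+y. ennreal (?f y) * indicator {0..} y \<partial>lborel)"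
    using nn_integral_real_affine[of "\<lambda>y. ennreal (?f y) * indicator {0..} y" "-1" 0] by simp
  finally have "(\<integral>\<^sup>+y. ennreal (?f y) \<partial>lborel) < \<infinity>" unfolding half by (simp add: le_less_trans)
  then have "integrable lborel ?f"
    by (intro integrableI_bounded) (auto simp: add_nonneg_nonneg)
  from lborel_integrable_real_affine[OF this, of 1 "-v"] show ?thesis by (simp add: algebra_simps)
qed

definition lorentz_mass :: real where "lorentz_mass = (LINT y|lborel. 1 / (1 + y\<^sup>2))"

lemma integral_lorentz: "(LINT y|lborel. 1 / (1 + (y - v)\<^sup>2)) = lorentz_mass"
  unfolding lorentz_mass_def
  by (subst lborel_integral_real_affine[of 1 _ v]) (simp_all)

lemma lorentz_mass_nonneg: "lorentz_mass \<ge> 0"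
  unfolding lorentz_mass_def by (intro integral_nonneg_AE AE_I2) (simp add: add_nonneg_nonneg)

text \<open>
  The bounds do not depend on the position \<open>v\<close> of the peak. So they hold uniformly for the translates
  of the Gamma function that occur in the kernels.
\<close>

lemma decay_L2:
  assumes m: "u \<in> borel_measurable borel" and C: "C \<ge> 0" and le: "\<And>y. cmod (u y) \<le> C / (1 + (y - v)\<^sup>2)"
  shows "u \<in> L2 lborel" "norm_sq lborel u \<le> C\<^sup>2 * lorentz_mass"
    "integrable lborel u" "(LINT y|lborel. cmod (u y)) \<le> C * lorentz_mass"
proof -
  have p: "1 + (y - v)\<^sup>2 \<ge> 1" for y :: real by simp
  have sq: "(cmod (u y))\<^sup>2 \<le> C\<^sup>2 * (1 / (1 + (y - v)\<^sup>2))" for y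
  proof -
    have "(cmod (u y))\<^sup>2 \<le> (C / (1 + (y - v)\<^sup>2))\<^sup>2" using le by (intro power_mono) auto
    also have "\<dots> = C\<^sup>2 * (1 / (1 + (y - v)\<^sup>2)\<^sup>2)" by (simp add: power_divide)
    also have "\<dots> \<le> C\<^sup>2 * (1 / (1 + (y - v)\<^sup>2))"
    proof (intro mult_left_mono divide_left_mono mult_pos_pos zero_less_power)
      show "1 + (y - v)\<^sup>2 \<le> (1 + (y - v)\<^sup>2)\<^sup>2" using self_le_power[OF p[of y], of 2] by simp
      show "0 < 1 + (y - v)\<^sup>2" "0 < 1 + (y - v)\<^sup>2" using p[of y] by linarith+
    qed auto
    finally show ?thesis .
  qed
  have i: "integrable lborel (\<lambda>y. c * (1 / (1 + (y - v)\<^sup>2)))" for c :: real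
    using integrable_lorentz by (rule integrable_mult_right)
  show L: "u \<in> L2 lborel" unfolding L2_def
    using m sq by (auto intro!: Bochner_Integration.integrable_bound[OF i[of "C\<^sup>2"]] AE_I2 simp del: times_divide_eq_right)
  have "norm_sq lborel u \<le> (LINT y|lborel. C\<^sup>2 * (1 / (1 + (y - v)\<^sup>2)))"
    unfolding norm_sq_def by (intro integral_mono i sq L2_integrable L)
  also have "\<dots> = C\<^sup>2 * lorentz_mass" by (subst integral_mult_right_zero) (simp only: integral_lorentz)
  finally show "norm_sq lborel u \<le> C\<^sup>2 * lorentz_mass" .
  show I: "integrable lborel u"
    by (rule Bochner_Integration.integrable_bound[OF i[of C]]) (use m C le in auto)
  have "(LINT y|lborel. cmod (u y)) \<le> (LINT y|lborel. C * (1 / (1 + (y - v)\<^sup>2)))"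
    by (intro integral_mono i integrable_norm I) (use le in simp)
  also have "\<dots> = C * lorentz_mass" by (subst integral_mult_right_zero) (simp only: integral_lorentz)
  finally show "(LINT y|lborel. cmod (u y)) \<le> C * lorentz_mass" .
qed

lemma Gamma_line_measurable:
  assumes "x > 0" shows "(\<lambda>y. Gamma (Complex x (e * y + v))) \<in> borel_measurable borel"
proof (rule borel_measurable_continuous_onI)
  have "continuous_on (range (\<lambda>y. Complex x (e * y + v))) Gamma"
    using assms by (intro continuous_on_Gamma) (auto dest!: nonpos_Ints_Int elim!: Ints_cases simp: complex_eq_iff nonpos_Ints_def)
  then show "continuous_on UNIV (\<lambda>y. Gamma (Complex x (e * y + v)))"
    by (rule continuous_on_compose2) (auto intro!: continuous_intros)
qed

definition Gamma_line_sq :: "real \<Rightarrow> real" where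
  "Gamma_line_sq x = line_sq Gamma x"

lemma Gamma_line_L2:
  assumes "x > 0" shows "line_fun Gamma x \<in> L2 lborel"
proof -
  obtain C where "C \<ge> 0" "\<And>z. x \<le> Re z \<Longrightarrow> Re z \<le> x \<Longrightarrow> cmod (Gamma z) \<le> C / (1 + (Im z)\<^sup>2)"
    using Gamma_strip_bound[OF assms, of x] by blast
  note C = this
  have "cmod (Gamma (Complex x y)) \<le> C / (1 + (y - 0)\<^sup>2)" for y using C(2)[of "Complex x y"] by simp
  then show ?thesis using Gamma_line_measurable[OF assms, of 1 0] \<open>C \<ge> 0\<close>
    by (intro decay_L2(1)[of _ C 0]) (simp_all add: line_fun_def)
qed

text \<open>
  The function \<open>Gamma z * Gamma (2 * x + 1 - z)\<close> is \<open>|Gamma z|^2\<close> on \<open>Re z = x + 1 / 2\<close>, and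
  \<open>(x + \<i> * y) * |Gamma (x + \<i> * y)|^2\<close> on the line \<open>Re z = x + 1\<close>. Taking real parts of the equal
  integrals gives the recursion.
\<close>

lemma Gamma_line_sq_shift:
  assumes "x > 0"
  shows "Gamma_line_sq (x + 1/2) = x * Gamma_line_sq x"
proof -
  define h where "h z = Gamma z * Gamma (of_real (2 * x + 1) - z)" for z :: complex
  have hol: "h holomorphic_on {z. 0 < Re z \<and> Re z < 2 * x + 1}"
    unfolding h_def by (intro holomorphic_intros Re_pos_not_nonpos_Int) (auto intro!: Re_pos_not_nonpos_Int)
  obtain C where C: "C \<ge> 0" "\<And>z. x \<le> Re z \<Longrightarrow> Re z \<le> x + 1 \<Longrightarrow> cmod (Gamma z) \<le> C / (1 + (Im z)\<^sup>2)"
    using Gamma_strip_bound[OF assms, of "x + 1"] by blast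
  have hl: "h (Complex t y) = Gamma (Complex t (1 * y + 0)) * Gamma (Complex (2 * x + 1 - t) ((-1) * y + 0))" for t y
    unfolding h_def by (rule arg_cong2[where f="\<lambda>a b. Gamma a * Gamma b"]) (auto simp: complex_eq_iff)
  have int: "integrable lborel (\<lambda>y. h (Complex t y)) \<and> (LINT y|lborel. cmod (h (Complex t y))) \<le> C\<^sup>2 * lorentz_mass"
    if t: "x \<le> t" "t \<le> x + 1" for t
  proof -
    have m: "(\<lambda>y. h (Complex t y)) \<in> borel_measurable borel"
      unfolding hl using t assms by (intro borel_measurable_times Gamma_line_measurable) auto
    have "cmod (h (Complex t y)) \<le> C\<^sup>2 / (1 + (y - 0)\<^sup>2)" for y
    proof -
      have "cmod (h (Complex t y)) \<le> (C / (1 + y\<^sup>2)) * (C / (1 + y\<^sup>2))"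
        unfolding hl norm_mult using C(2)[of "Complex t (1 * y + 0)"] C(2)[of "Complex (2 * x + 1 - t) ((-1) * y + 0)"] t C(1)
        by (intro mult_mono) (auto simp: add_nonneg_nonneg)
      also have "\<dots> = C\<^sup>2 / (1 + y\<^sup>2) * (1 / (1 + y\<^sup>2))" by (simp add: power2_eq_square)
      also have "\<dots> \<le> C\<^sup>2 / (1 + y\<^sup>2) * 1"
      proof (rule mult_left_mono)
        have "0 < 1 + y\<^sup>2" by (rule add_pos_nonneg) auto
        then show "1 / (1 + y\<^sup>2) \<le> 1" by (simp add: divide_le_eq_1)
      qed (simp add: add_nonneg_nonneg)
      finally show ?thesis by simp
    qed
    from decay_L2(3,4)[OF m _ this] show ?thesis by simp
  qed
  have eq: "(LINT y|lborel. h (Complex (x + 1/2) y)) = (LINT y|lborel. h (Complex (x + 1) y))"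
    by (rule line_integral_shift[OF hol, of _ _ "C\<^sup>2 * lorentz_mass"]) (use assms in \<open>auto intro!: conjunct1[OF int] conjunct2[OF int]\<close>)
  have l: "h (Complex (x + 1/2) y) = of_real ((cmod (line_fun Gamma (x + 1/2) y))\<^sup>2)" for y
  proof -
    have "Complex (2 * x + 1 - (x + 1/2)) ((-1) * y + 0) = cnj (Complex (x + 1/2) y)" by (simp add: complex_eq_iff)
    then show ?thesis unfolding hl by (simp only: cnj_Gamma[symmetric] line_fun_def complex_norm_square mult_1 add_0_right)
  qed
  have r: "h (Complex (x + 1) y) = Complex x y * of_real ((cmod (line_fun Gamma x y))\<^sup>2)" for y
  proof -
    have "Complex (2 * x + 1 - (x + 1)) ((-1) * y + 0) = cnj (Complex x y)" by (simp add: complex_eq_iff)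
    moreover have "Complex (x + 1) (1 * y + 0) = Complex x y + 1" by (simp add: complex_eq_iff)
    moreover have "Gamma (Complex x y + 1) = Complex x y * Gamma (Complex x y)"
      using assms by (intro Gamma_plus1 Re_pos_not_nonpos_Int) simp
    ultimately show ?thesis unfolding hl by (simp only: cnj_Gamma[symmetric] line_fun_def complex_norm_square mult_1 add_0_right mult.assoc)
  qed
  have "complex_of_real (Gamma_line_sq (x + 1/2)) = (LINT y|lborel. h (Complex (x + 1/2) y))"
    unfolding l Gamma_line_sq_def norm_sq_def by (rule integral_complex_of_real[symmetric])
  then have "Gamma_line_sq (x + 1/2) = Re (LINT y|lborel. h (Complex (x + 1) y))" by (metis eq Re_complex_of_real)
  also have "\<dots> = (LINT y|lborel. Re (h (Complex (x + 1) y)))" by (rule integral_Re[symmetric]) (use int[of "x+1"] in simp)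
  also have "\<dots> = (LINT y|lborel. x * (cmod (line_fun Gamma x y))\<^sup>2)" unfolding r by simp
  also have "\<dots> = x * Gamma_line_sq x" by (simp add: Gamma_line_sq_def norm_sq_def)
  finally show ?thesis .
qed

lemma Gamma_line_sq_nonneg: "Gamma_line_sq x \<ge> 0"
  by (simp add: Gamma_line_sq_def)

text \<open>
  By the recursion, the quotient of consecutive terms is \<open>(n / 2 + u) / (n + 1)\<close>, which tends to
  \<open>1 / 2\<close>.
\<close>

lemma summable_Gamma_line_sq:
  assumes u: "u > 0"
  shows "summable (\<lambda>n. Gamma_line_sq (real n / 2 + u) / fact n)"
proof -
  obtain N :: nat where N: "real N \<ge> 4 * u" using real_arch_simple by blast
  show ?thesis
  proof (rule summable_ratio_test[of "3/4" N])
    fix n assume n: "N \<le> n"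
    have "Gamma_line_sq (real (Suc n) / 2 + u) = (real n / 2 + u) * Gamma_line_sq (real n / 2 + u)"
      using Gamma_line_sq_shift[of "real n / 2 + u"] u by (simp add: add_divide_distrib algebra_simps)
    moreover have "real n / 2 + u \<le> 3/4 * real (Suc n)" using of_nat_mono[OF n, where 'a=real] N by simp
    ultimately have "Gamma_line_sq (real (Suc n) / 2 + u) \<le> 3/4 * real (Suc n) * Gamma_line_sq (real n / 2 + u)"
      using mult_right_mono[OF _ Gamma_line_sq_nonneg] by metis
    then have "Gamma_line_sq (real (Suc n) / 2 + u) / fact (Suc n) \<le> 3/4 * real (Suc n) * Gamma_line_sq (real n / 2 + u) / fact (Suc n)"
      by (intro divide_right_mono) auto
    also have "\<dots> = 3/4 * (Gamma_line_sq (real n / 2 + u) / fact n)"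
      by (simp del: of_nat_Suc)
    finally show "norm (Gamma_line_sq (real (Suc n) / 2 + u) / fact (Suc n)) \<le> 3/4 * norm (Gamma_line_sq (real n / 2 + u) / fact n)"
      by (simp add: Gamma_line_sq_nonneg del: fact_Suc of_nat_Suc)
  qed simp
qed

text \<open>
  The candidate for the reproducing kernel at \<open>w\<close>.
\<close>

definition mellin_kernel :: "complex \<Rightarrow> complex \<Rightarrow> complex" where
  "mellin_kernel w = zero_ext RHP
     (\<lambda>z. 1 / (2 * of_real pi) * (Gamma (z + cnj w) / (Gamma (1 + z) * Gamma (1 + cnj w))))"

definition kernel_const :: "complex \<Rightarrow> complex" where
  "kernel_const w = 1 / (2 * of_real pi * Gamma (1 + cnj w))"

lemma Gamma_RHP_nonzero: "Re z > 0 \<Longrightarrow> Gamma z \<noteq> 0"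
  using Re_pos_not_nonpos_Int by (simp add: Gamma_eq_zero_iff)

lemma gamma_mult_kernel:
  "gamma_mult (mellin_kernel w) = zero_ext RHP (\<lambda>z. kernel_const w * Gamma (z + cnj w) / 2 powr z)"
proof
  fix z
  show "gamma_mult (mellin_kernel w) z = zero_ext RHP (\<lambda>z. kernel_const w * Gamma (z + cnj w) / 2 powr z) z"
    using Gamma_RHP_nonzero[of "1 + z"]
    by (auto simp: gamma_mult_def mellin_kernel_def zero_ext_def kernel_const_def right_half_plane_def)
qed

lemma line_fun_gamma_mult_kernel:
  assumes "x > 0"
  shows "line_fun (gamma_mult (mellin_kernel w)) x y = kernel_const w * Gamma (Complex (x + Re w) (1 * y + (- Im w))) / 2 powr (Complex x y)"
proof -
  have "Complex x y + cnj w = Complex (x + Re w) (1 * y + (- Im w))" by (simp add: complex_eq_iff)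
  then show ?thesis using assms by (simp add: line_fun_def gamma_mult_kernel zero_ext_def right_half_plane_def)
qed

lemma norm_2_powr: "cmod (2 powr z) = 2 powr Re z"
  by (simp add: norm_powr_real_powr)

lemma kernel_in_holo_space:
  assumes w: "Re w > 0"
  shows "mellin_kernel w \<in> holo_space RHP"
proof -
  have "(\<lambda>z. 1 / (2 * of_real pi) * (Gamma (z + cnj w) / (Gamma (1 + z) * Gamma (1 + cnj w)))) holomorphic_on RHP"
    using w by (intro holomorphic_intros) (auto simp: right_half_plane_def Gamma_RHP_nonzero intro!: Re_pos_not_nonpos_Int)
  then have "mellin_kernel w holomorphic_on RHP"
    by (rule holomorphic_transform) (simp add: mellin_kernel_def zero_ext_def)
  then show ?thesis by (auto simp: holo_space_def mellin_kernel_def zero_ext_def)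
qed

lemma gamma_mult_holo_space:
  assumes "g \<in> holo_space RHP" shows "gamma_mult g \<in> holo_space RHP"
proof -
  have "(\<lambda>z. Gamma (1 + z) / 2 powr z * g z) holomorphic_on RHP"
    using assms by (intro holomorphic_intros) (auto simp: holo_space_def right_half_plane_def intro!: Re_pos_not_nonpos_Int)
  then show ?thesis using assms by (auto simp: holo_space_def gamma_mult_def[abs_def])
qed

lemma kernel_line_L2:
  assumes w: "Re w > 0" and x: "x > 0"
  shows "line_fun (gamma_mult (mellin_kernel w)) x \<in> L2 lborel"
    "line_sq (gamma_mult (mellin_kernel w)) x = (cmod (kernel_const w))\<^sup>2 * (2 powr (-x))\<^sup>2 * Gamma_line_sq (x + Re w)"
proof -
  let ?f = "line_fun (gamma_mult (mellin_kernel w)) x"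
  let ?G = "line_fun Gamma (x + Re w)"
  let ?c = "(cmod (kernel_const w))\<^sup>2 * (2 powr (-x))\<^sup>2"
  have G: "?G \<in> L2 lborel" using w x by (intro Gamma_line_L2) auto
  have sq: "(cmod (?f y))\<^sup>2 = ?c * (cmod (?G (- Im w + 1 * y)))\<^sup>2" for y
    unfolding line_fun_gamma_mult_kernel[OF x]
    by (simp add: norm_mult norm_divide norm_2_powr power_mult_distrib power_divide powr_minus line_fun_def field_simps)
  have "gamma_mult (mellin_kernel w) holomorphic_on strip (x + 1)"
    using gamma_mult_holo_space[OF kernel_in_holo_space[OF w]]
    by (auto simp: holo_space_def strip_def right_half_plane_def elim: holomorphic_on_subset)
  then have m: "?f \<in> borel_measurable lborel" by (rule line_fun_measurable) (use x in auto)
  have i: "integrable lborel (\<lambda>y. (cmod (?G (- Im w + 1 * y)))\<^sup>2)"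
    by (rule lborel_integrable_real_affine[OF L2_integrable[OF G]]) simp
  show "?f \<in> L2 lborel" using m integrable_mult_right[OF i, of ?c] unfolding L2_def by (simp add: sq)
  have "Gamma_line_sq (x + Re w) = (LINT y|lborel. (cmod (?G (- Im w + 1 * y)))\<^sup>2)"
    unfolding Gamma_line_sq_def norm_sq_def by (subst lborel_integral_real_affine[of 1 _ "- Im w"]) simp_all
  then show "line_sq (gamma_mult (mellin_kernel w)) x = ?c * Gamma_line_sq (x + Re w)"
    unfolding norm_sq_def sq by simp
qed

text \<open>
  Multiplication by \<open>Gamma (1 + z) / 2 powr z\<close> turns the kernel into a multiple of
  \<open>Gamma (z + cnj w) / 2 powr z\<close>. The powers of \<open>2\<close> cancel against the weight of the \<open>n\<close>-th line, which
  leaves the terms of \<open>summable_Gamma_line_sq\<close>.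
\<close>

lemma kernel_in_H_space:
  assumes w: "Re w > 0"
  shows "mellin_kernel w \<in> H_space"
proof -
  let ?k = "gamma_mult (mellin_kernel w)"
  have hol: "?k \<in> holo_space RHP" by (intro gamma_mult_holo_space kernel_in_holo_space w)
  have hs: "?k \<in> hardy_strip b" if b: "b > 0" for b
  proof -
    obtain C where C: "C \<ge> 0" "\<And>z. Re w \<le> Re z \<Longrightarrow> Re z \<le> b + Re w \<Longrightarrow> cmod (Gamma z) \<le> C / (1 + (Im z)\<^sup>2)"
      using Gamma_strip_bound[OF w, of "b + Re w"] by blast
    show ?thesis
    proof (rule hardy_stripI)
      show "?k holomorphic_on strip b" using hol by (auto simp: holo_space_def strip_def right_half_plane_def elim: holomorphic_on_subset)
      fix x assume x: "0 < x" "x < b"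
      have "line_sq ?k x = ((cmod (kernel_const w))\<^sup>2 * (2 powr (-x))\<^sup>2) * Gamma_line_sq (x + Re w)" by (rule kernel_line_L2(2)[OF w x(1)])
      also have "\<dots> \<le> ((cmod (kernel_const w))\<^sup>2 * 1) * (C\<^sup>2 * lorentz_mass)"
      proof (intro mult_mono mult_left_mono)
        have "2 powr (-x) \<le> 2 powr 0" using x by (intro powr_mono) auto
        then show "(2 powr (-x))\<^sup>2 \<le> 1" by (simp add: power_le_one)
        have "norm_sq lborel (line_fun Gamma (x + Re w)) \<le> C\<^sup>2 * lorentz_mass"
        proof (rule decay_L2(2)[OF _ C(1), where v=0])
          show "line_fun Gamma (x + Re w) \<in> borel_measurable borel"
            using Gamma_line_measurable[of "x + Re w" 1 0] x w by (simp add: line_fun_def)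
          show "cmod (line_fun Gamma (x + Re w) y) \<le> C / (1 + (y - 0)\<^sup>2)" for y
            using C(2)[of "Complex (x + Re w) y"] x by (simp add: line_fun_def)
        qed
        then show "Gamma_line_sq (x + Re w) \<le> C\<^sup>2 * lorentz_mass" by (simp add: Gamma_line_sq_def)
      qed (auto simp: Gamma_line_sq_nonneg)
      finally show "line_fun ?k x \<in> L2 lborel \<and> line_sq ?k x \<le> ((cmod (kernel_const w))\<^sup>2 * 1) * (C\<^sup>2 * lorentz_mass)"
        using kernel_line_L2(1)[OF w x(1)] by simp
    qed
  qed
  have t: "omega_term ?k n = (cmod (kernel_const w))\<^sup>2 * (Gamma_line_sq (real n / 2 + Re w) / fact n)" if "n > 0" for n
  proof -
    have "(2 powr (- (real n / 2)))\<^sup>2 = (1::real) / 2 ^ n"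
    proof -
      have "(2 powr (- (real n / 2)))\<^sup>2 = 2 powr (- real n)" by (simp add: powr_power)
      also have "\<dots> = 1 / 2 ^ n" by (simp only: powr_minus powr_realpow[OF zero_less_numeral] divide_inverse mult_1)
      finally show ?thesis .
    qed
    then show ?thesis using that kernel_line_L2(2)[OF w, of "real n / 2"]
      by (simp add: omega_term_def line_fun_with_boundary)
  qed
  have "summable (\<lambda>n. (cmod (kernel_const w))\<^sup>2 * (Gamma_line_sq (real n / 2 + Re w) / fact n))"
    by (intro summable_mult summable_Gamma_line_sq w)
  then have "summable (omega_term ?k)"
    by (rule summable_cong[THEN iffD1, rotated]) (use t in \<open>auto simp: eventually_sequentially intro!: exI[of _ 1]\<close>)
  then have "?k \<in> M2_omega" by (intro M2_omegaI hol hs)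
  then show ?thesis using kernel_in_holo_space[OF w] by (simp add: H_space_def)
qed

section \<open>The reproducing formula\<close>

lemma H_space_holo: "g \<in> H_space \<Longrightarrow> g \<in> holo_space RHP"
  and H_space_M2: "g \<in> H_space \<Longrightarrow> gamma_mult g \<in> M2_omega"
  by (simp_all add: H_space_def)

text \<open>
  Induction with the functional equation. As \<open>N\<close> grows the sum is a partial sum of the divergent series
  \<open>Gamma s * (1 - 1) powr (- s)\<close>; the point is the pole at \<open>s = 0\<close>, which has residue \<open>1\<close> for every
  \<open>N\<close>.
\<close>

lemma sum_Gamma_over_fact:
  assumes s: "Re s > 0"
  shows "(\<Sum>n<Suc N. Gamma (s + of_nat n) / fact n) = Gamma (s + of_nat (Suc N)) / (fact N * s)"
proof (induction N)
  case 0
  have "Gamma (s + 1) = s * Gamma s" by (rule Gamma_plus1[OF Re_pos_not_nonpos_Int[OF s]])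
  moreover have "s \<noteq> 0" using s by auto
  ultimately show ?case by simp
next
  case (Suc N)
  let ?G = "Gamma (s + of_nat (Suc N))"
  have s0: "s \<noteq> 0" using s by auto
  have g: "Gamma (s + of_nat (Suc N) + 1) = (s + of_nat (Suc N)) * ?G"
    by (rule Gamma_plus1[OF Re_pos_not_nonpos_Int]) (use s in auto)
  have "(\<Sum>n<Suc (Suc N). Gamma (s + of_nat n) / fact n) = ?G / (fact N * s) + ?G / fact (Suc N)"
    by (subst sum.lessThan_Suc) (simp only: Suc.IH)
  also have "\<dots> = (s + of_nat (Suc N)) * ?G / (fact (Suc N) * s)"
    using s0 by (simp add: divide_simps del: of_nat_Suc) (simp add: algebra_simps)
  also have "\<dots> = Gamma (s + of_nat (Suc (Suc N))) / (fact (Suc N) * s)"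
  proof -
    have e: "s + of_nat (Suc N) + 1 = s + of_nat (Suc (Suc N))" by simp
    show ?thesis using g unfolding e by (simp only:)
  qed
  finally show ?case .
qed

text \<open>
  In this block \<open>F z = Gamma (1 + z) * g z\<close>. It is written as \<open>2 powr z * gamma_mult g z\<close> because its bounds
  on vertical lines are inherited from \<open>gamma_mult g\<close>, whose lines carry the norm.
\<close>

context
  fixes g :: "complex \<Rightarrow> complex" and F :: "complex \<Rightarrow> complex"
  assumes g: "g \<in> H_space"
  defines "F \<equiv> \<lambda>z. 2 powr z * gamma_mult g z"
begin

lemma gamma_weighted_eq: "F z = Gamma (1 + z) * g z"
  by (simp add: F_def gamma_mult_def)

lemma gamma_weighted_holomorphic: "F holomorphic_on RHP"
  unfolding F_def using gamma_mult_holo_space[OF H_space_holo[OF g]]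
  by (intro holomorphic_intros) (auto simp: holo_space_def)

lemma gamma_weighted_line_L2:
  assumes "x > 0"
  shows "line_fun F x \<in> L2 lborel" "line_sq F x = (2 powr x)\<^sup>2 * line_sq (gamma_mult g) x"
proof -
  have L: "line_fun (gamma_mult g) x \<in> L2 lborel"
    by (rule hardy_strip_L2[OF M2_omega_hardy_strip[OF H_space_M2[OF g], of "x+1"]]) (use assms in auto)
  have sq: "(cmod (line_fun F x y))\<^sup>2 = (2 powr x)\<^sup>2 * (cmod (line_fun (gamma_mult g) x y))\<^sup>2" for y
    by (simp add: line_fun_def F_def norm_mult norm_2_powr power_mult_distrib)
  have "F holomorphic_on strip (x + 1)"
    by (rule holomorphic_on_subset[OF gamma_weighted_holomorphic]) (auto simp: strip_def right_half_plane_def)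
  then have m: "line_fun F x \<in> borel_measurable lborel" by (rule line_fun_measurable) (use assms in auto)
  show "line_fun F x \<in> L2 lborel"
    using m integrable_mult_right[OF L2_integrable[OF L], of "(2 powr x)\<^sup>2"] unfolding L2_def by (simp add: sq)
  show "line_sq F x = (2 powr x)\<^sup>2 * line_sq (gamma_mult g) x"
    unfolding norm_sq_def sq by simp
qed

lemma gamma_weighted_line_bounded:
  obtains C where "C \<ge> 0" "\<And>x. 0 < x \<Longrightarrow> x \<le> b \<Longrightarrow> line_sq F x \<le> C"
proof (cases "b > 0")
  case True
  obtain C where C: "C \<ge> 0" "\<And>x. 0 < x \<Longrightarrow> x < b + 1 \<Longrightarrow> line_sq (gamma_mult g) x \<le> C"
    using hardy_strip_bounded[OF M2_omega_hardy_strip[OF H_space_M2[OF g], of "b+1"]] True by auto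
  have "line_sq F x \<le> (2 powr b)\<^sup>2 * C" if "0 < x" "x \<le> b" for x
    unfolding gamma_weighted_line_L2(2)[OF that(1)] using that C(1) C(2)[of x] by (intro mult_mono power_mono powr_mono) auto
  then show ?thesis using that[of "(2 powr b)\<^sup>2 * C"] C(1) by auto
qed (use that[of 0] in auto)

lemma gamma_weighted_times_Gamma_bounded:
  assumes a: "0 < a" "b < Re s"
  obtains C where "C \<ge> 0"
    "\<And>x. a \<le> x \<Longrightarrow> x \<le> b \<Longrightarrow> integrable lborel (\<lambda>y. F (Complex x y) * Gamma (s - Complex x y))"
    "\<And>x. a \<le> x \<Longrightarrow> x \<le> b \<Longrightarrow> (LINT y|lborel. cmod (F (Complex x y) * Gamma (s - Complex x y))) \<le> C"
proof -
  obtain D where D: "D \<ge> 0" "\<And>x. 0 < x \<Longrightarrow> x \<le> b \<Longrightarrow> line_sq F x \<le> D" using gamma_weighted_line_bounded by blast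
  obtain B where B: "B \<ge> 0" "\<And>z. Re s - b \<le> Re z \<Longrightarrow> Re z \<le> Re s - a \<Longrightarrow> cmod (Gamma z) \<le> B / (1 + (Im z)\<^sup>2)"
    using Gamma_strip_bound[of "Re s - b" "Re s - a"] a by auto
  have G: "(\<lambda>y. Gamma (s - Complex x y)) \<in> L2 lborel \<and> norm_sq lborel (\<lambda>y. Gamma (s - Complex x y)) \<le> B\<^sup>2 * lorentz_mass"
    if x: "a \<le> x" "x \<le> b" for x
  proof -
    have eq: "s - Complex x y = Complex (Re s - x) ((-1) * y + Im s)" for y by (simp add: complex_eq_iff)
    have m: "(\<lambda>y. Gamma (s - Complex x y)) \<in> borel_measurable borel"
      unfolding eq by (rule Gamma_line_measurable) (use x a in auto)
    have "cmod (Gamma (s - Complex x y)) \<le> B / (1 + (y - Im s)\<^sup>2)" for y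
      using B(2)[of "s - Complex x y"] x by (simp add: power2_commute)
    from decay_L2(1,2)[OF m B(1) this] show ?thesis by simp
  qed
  show ?thesis
  proof (rule that[of "sqrt D * sqrt (B\<^sup>2 * lorentz_mass)"])
    fix x assume x: "a \<le> x" "x \<le> b"
    have L: "line_fun F x \<in> L2 lborel" using x a by (intro gamma_weighted_line_L2) auto
    show "integrable lborel (\<lambda>y. F (Complex x y) * Gamma (s - Complex x y))"
      using L2_mult_integrable[OF L conjunct1[OF G[OF x]]] by (simp add: line_fun_def)
    have "(LINT y|lborel. cmod (F (Complex x y) * Gamma (s - Complex x y))) \<le> sqrt (line_sq F x) * sqrt (norm_sq lborel (\<lambda>y. Gamma (s - Complex x y)))"
      using L2_mult_integral_le[OF L conjunct1[OF G[OF x]]] by (simp add: line_fun_def)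
    also have "\<dots> \<le> sqrt D * sqrt (B\<^sup>2 * lorentz_mass)"
      using D x a conjunct2[OF G[OF x]] by (intro mult_mono real_sqrt_le_mono) auto
    finally show "(LINT y|lborel. cmod (F (Complex x y) * Gamma (s - Complex x y))) \<le> sqrt D * sqrt (B\<^sup>2 * lorentz_mass)" .
  qed (use D lorentz_mass_nonneg in auto)
qed

text \<open>
  The integral over \<open>Re z = x\<close> in terms of which the inner products with kernel functions are
  expressed. By \<open>Gamma_pairing_shift\<close> it does not change with \<open>x\<close> as long as \<open>0 < x < Re s\<close>.
\<close>

definition Gamma_pairing :: "real \<Rightarrow> complex \<Rightarrow> complex" where
  "Gamma_pairing x s = (LINT y|lborel. F (Complex x y) * Gamma (s - Complex x y))"

lemma gamma_weighted_times_Gamma_integrable: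
  assumes "0 < c" "c < Re s"
  shows "integrable lborel (\<lambda>y. F (Complex c y) * Gamma (s - Complex c y))"
  using gamma_weighted_times_Gamma_bounded[OF assms] order_refl by blast

lemma gamma_weighted_times_Gamma_holomorphic: "(\<lambda>z. F z * Gamma (s - z)) holomorphic_on {z. 0 < Re z \<and> Re z < Re s}"
  by (intro holomorphic_intros holomorphic_on_subset[OF gamma_weighted_holomorphic])
    (auto simp: right_half_plane_def intro!: Re_pos_not_nonpos_Int)

lemma Gamma_pairing_shift:
  assumes "0 < x1" "x1 < Re s" "0 < x2" "x2 < Re s"
  shows "Gamma_pairing x1 s = Gamma_pairing x2 s"
proof -
  obtain C where C: "\<And>x. min x1 x2 \<le> x \<Longrightarrow> x \<le> max x1 x2 \<Longrightarrow> integrable lborel (\<lambda>y. F (Complex x y) * Gamma (s - Complex x y))"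
    "\<And>x. min x1 x2 \<le> x \<Longrightarrow> x \<le> max x1 x2 \<Longrightarrow> (LINT y|lborel. cmod (F (Complex x y) * Gamma (s - Complex x y))) \<le> C"
  proof -
    have "0 < min x1 x2" "max x1 x2 < Re s" using assms by auto
    from gamma_weighted_times_Gamma_bounded[OF this] that show ?thesis by blast
  qed
  show ?thesis unfolding Gamma_pairing_def
    by (rule line_integral_shift[OF gamma_weighted_times_Gamma_holomorphic assms, of C]) (use C in blast)
qed

text \<open>
  On the line \<open>Re z = x\<close> the conjugate of \<open>z\<close> is \<open>2 * x - z\<close>, which makes the conjugated kernel
  holomorphic in \<open>z\<close>.
\<close>

lemma line_inner_kernel:
  assumes w: "Re w > 0" and x: "x > 0"
  shows "L2_inner lborel (line_fun (gamma_mult g) x) (line_fun (gamma_mult (mellin_kernel w)) x)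
     = cnj (kernel_const w) * (2 powr (-2 * x)) * Gamma_pairing x (of_real (2 * x) + w)"
proof -
  have pt: "line_fun (gamma_mult g) x y * cnj (line_fun (gamma_mult (mellin_kernel w)) x y)
      = cnj (kernel_const w) * of_real (2 powr (-2 * x)) * (F (Complex x y) * Gamma (of_real (2 * x) + w - Complex x y))" for y
  proof -
    let ?z = "Complex x y"
    have p: "gamma_mult g ?z = F ?z / 2 powr ?z" by (simp add: F_def)
    have a: "Complex (x + Re w) (1 * y + - Im w) = cnj (of_real (2 * x) + w - ?z)" by (simp add: complex_eq_iff)
    have q: "2 powr ?z * cnj (2 powr ?z) = of_real (2 powr (2 * x))"
      by (simp only: complex_norm_square[symmetric] norm_2_powr complex.sel) (simp add: powr_power)
    have q': "complex_of_real (2 powr (-2 * x)) = 1 / (2 powr ?z * cnj (2 powr ?z))"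
      unfolding q by (simp add: powr_minus inverse_eq_divide)
    show ?thesis unfolding line_fun_gamma_mult_kernel[OF x] a cnj_Gamma[symmetric] q'
      by (simp add: line_fun_def p)
  qed
  show ?thesis unfolding L2_inner_def pt Gamma_pairing_def by (simp add: mult.assoc)
qed

text \<open>
  Dominated convergence: as \<open>s\<close> runs through a bounded set to the right of the line, the Gamma factor
  stays below one square-integrable function.
\<close>

lemma Gamma_pairing_continuous:
  assumes c: "0 < c" "c < Re w"
  shows "(\<lambda>n. Gamma_pairing c (of_real (2 * (1 / real (Suc n))) + w)) \<longlonglongrightarrow> Gamma_pairing c w"
proof -
  obtain B where B: "B \<ge> 0" "\<And>z. Re w - c \<le> Re z \<Longrightarrow> Re z \<le> Re w - c + 2 \<Longrightarrow> cmod (Gamma z) \<le> B / (1 + (Im z)\<^sup>2)"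
    using Gamma_strip_bound[of "Re w - c" "Re w - c + 2"] c by auto
  have L: "line_fun F c \<in> L2 lborel" using c by (intro gamma_weighted_line_L2) auto
  have D: "(\<lambda>y. of_real (B / (1 + (y - Im w)\<^sup>2))) \<in> L2 (lborel :: real measure)"
  proof (rule decay_L2(1)[where v="Im w", OF _ B(1)])
    show "(\<lambda>y. complex_of_real (B / (1 + (y - Im w)\<^sup>2))) \<in> borel_measurable borel" by measurable
    have "0 \<le> B / (1 + (y - Im w)\<^sup>2)" for y using B(1) by (intro divide_nonneg_nonneg add_nonneg_nonneg) auto
    then show "cmod (of_real (B / (1 + (y - Im w)\<^sup>2))) \<le> B / (1 + (y - Im w)\<^sup>2)" for y
      by (simp only: norm_of_real abs_of_nonneg order_refl)
  qed
  show ?thesis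
    unfolding Gamma_pairing_def
  proof (rule integral_dominated_convergence[where w="\<lambda>y. cmod (line_fun F c y * of_real (B / (1 + (y - Im w)\<^sup>2)))"])
  show "integrable lborel (\<lambda>y. cmod (line_fun F c y * of_real (B / (1 + (y - Im w)\<^sup>2))))"
    by (rule integrable_norm[OF L2_mult_integrable[OF L D]])
  show "AE y in lborel. cmod (F (Complex c y) * Gamma (of_real (2 * (1 / real (Suc n))) + w - Complex c y))
      \<le> cmod (line_fun F c y * of_real (B / (1 + (y - Im w)\<^sup>2)))" for n
  proof (rule AE_I2)
    fix y
    define p where "p = 1 / real (Suc n)"
    have "0 \<le> p" "p \<le> 1" by (simp_all add: p_def)
    then have "cmod (Gamma (of_real (2 * (1 / real (Suc n))) + w - Complex c y)) \<le> B / (1 + (Im w - y)\<^sup>2)"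
      using B(2)[of "of_real (2 * p) + w - Complex c y"] unfolding p_def[symmetric] by simp
    then show "cmod (F (Complex c y) * Gamma (of_real (2 * (1 / real (Suc n))) + w - Complex c y))
      \<le> cmod (line_fun F c y * of_real (B / (1 + (y - Im w)\<^sup>2)))"
      using B(1) unfolding norm_mult line_fun_def norm_of_real
      by (intro mult_left_mono) (simp_all add: power2_commute add_nonneg_nonneg)
  qed
  show "AE y in lborel. (\<lambda>n. F (Complex c y) * Gamma (of_real (2 * (1 / real (Suc n))) + w - Complex c y)) \<longlonglongrightarrow> F (Complex c y) * Gamma (w - Complex c y)"
  proof (rule AE_I2, rule tendsto_mult_left, rule tendsto_Gamma)
    fix y
    have "(\<lambda>n. of_real (2 * (1 / real (Suc n))) + (w - Complex c y)) \<longlonglongrightarrow> of_real (2 * 0) + (w - Complex c y)"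
      using LIMSEQ_inverse_real_of_nat by (intro tendsto_intros) (simp only: inverse_eq_divide)
    then show "(\<lambda>n. of_real (2 * (1 / real (Suc n))) + w - Complex c y) \<longlonglongrightarrow> w - Complex c y" by (simp add: add_diff_eq)
    show "w - Complex c y \<notin> \<int>\<^sub>\<le>\<^sub>0" using c by (intro Re_pos_not_nonpos_Int) simp
  qed
  have Gm: "(\<lambda>y. F (Complex c y) * Gamma (s - Complex c y)) \<in> borel_measurable lborel" if "Re s > c" for s
    using c that by (intro borel_measurable_integrable gamma_weighted_times_Gamma_integrable)
  show "(\<lambda>y. F (Complex c y) * Gamma (w - Complex c y)) \<in> borel_measurable lborel" using Gm c by auto
  show "(\<lambda>y. F (Complex c y) * Gamma (of_real (2 * (1 / real (Suc n))) + w - Complex c y)) \<in> borel_measurable lborel" for n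
    by (rule Gm) (use c in \<open>auto simp: add_pos_nonneg intro: less_le_trans\<close>)
  qed
qed

text \<open>
  For \<open>n > 0\<close> only a shift to the common line is needed. For \<open>n = 0\<close> the boundary inner product is the
  limit of the inner products on \<open>Re z = x\<close> as \<open>x\<close> tends to \<open>0\<close>, and each of these is first shifted to
  the common line, where dominated convergence applies.
\<close>

lemma inner_term_kernel:
  assumes w: "Re w > 0"
  shows "of_real (2 ^ n / fact n) * L2_inner lborel (line_fun (with_boundary (gamma_mult g)) (real n / 2)) (line_fun (with_boundary (gamma_mult (mellin_kernel w))) (real n / 2))
     = cnj (kernel_const w) * Gamma_pairing (Re w / 2) (of_nat n + w) / fact n"
proof (cases "n = 0")
  case False
  then have n: "real n / 2 > 0" by simp
  have "of_real (2 ^ n / fact n) * L2_inner lborel (line_fun (with_boundary (gamma_mult g)) (real n / 2)) (line_fun (with_boundary (gamma_mult (mellin_kernel w))) (real n / 2))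
     = of_real (2 ^ n / fact n) * (cnj (kernel_const w) * (2 powr (- real n)) * Gamma_pairing (real n / 2) (of_nat n + w))"
    using False line_inner_kernel[OF w n] by (simp add: line_fun_with_boundary)
  also have "Gamma_pairing (real n / 2) (of_nat n + w) = Gamma_pairing (Re w / 2) (of_nat n + w)" using w n by (intro Gamma_pairing_shift) auto
  also have "(2::real) powr (- real n) = 1 / 2 ^ n" by (simp only: powr_minus powr_realpow[OF zero_less_numeral] divide_inverse mult_1)
  finally show ?thesis by simp
next
  case True
  have H: "gamma_mult g \<in> hardy_strip 1" "gamma_mult (mellin_kernel w) \<in> hardy_strip 1"
    using g kernel_in_H_space[OF w] by (auto intro: M2_omega_hardy_strip H_space_M2)
  let ?x = "\<lambda>n. 1 / real (Suc n)"
  let ?I = "\<lambda>x. L2_inner lborel (line_fun (gamma_mult g) x) (line_fun (gamma_mult (mellin_kernel w)) x)"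
  have x0: "filterlim ?x (at_right 0) sequentially"
    unfolding filterlim_at using LIMSEQ_inverse_real_of_nat by (auto simp: inverse_eq_divide)
  have 1: "(\<lambda>n. ?I (?x n)) \<longlonglongrightarrow> L2_inner lborel (boundary_value (gamma_mult g)) (boundary_value (gamma_mult (mellin_kernel w)))"
    by (rule filterlim_compose[OF line_inner_tendsto_boundary[OF H] x0]) simp
  have "?I (?x n) = cnj (kernel_const w) * (2 powr (-2 * ?x n)) * Gamma_pairing (Re w / 2) (of_real (2 * ?x n) + w)" for n
  proof -
    have "Gamma_pairing (?x n) (of_real (2 * ?x n) + w) = Gamma_pairing (Re w / 2) (of_real (2 * ?x n) + w)"
    proof (rule Gamma_pairing_shift)
      define p where "p = ?x n"
      have "p > 0" by (simp add: p_def)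
      then show "?x n < Re (of_real (2 * ?x n) + w)" "Re w / 2 < Re (of_real (2 * ?x n) + w)"
        using w unfolding p_def[symmetric] by auto
    qed (use w in auto)
    then show ?thesis using line_inner_kernel[OF w, of "?x n"] by simp
  qed
  moreover have "(\<lambda>n. cnj (kernel_const w) * (2 powr (-2 * ?x n)) * Gamma_pairing (Re w / 2) (of_real (2 * ?x n) + w))
      \<longlonglongrightarrow> cnj (kernel_const w) * of_real (2 powr (-2 * 0)) * Gamma_pairing (Re w / 2) w"
    using LIMSEQ_inverse_real_of_nat w
    by (intro tendsto_mult Gamma_pairing_continuous tendsto_const tendsto_of_real tendsto_powr) (auto simp: inverse_eq_divide)
  ultimately have "(\<lambda>n. ?I (?x n)) \<longlonglongrightarrow> cnj (kernel_const w) * Gamma_pairing (Re w / 2) w" by simp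
  from LIMSEQ_unique[OF 1 this] show ?thesis using True line_fun_with_boundary[of _ 0] by simp
qed

text \<open>
  By Cauchy--Schwarz on the line \<open>Re z = (N + 1) / 2\<close>, at distance at least a quarter of \<open>N\<close> from
  \<open>w\<close>, the integral is at most a constant times the geometric mean of the \<open>(N + 1)\<close>-st terms of two
  convergent series.
\<close>

lemma remainder_tendsto_0:
  assumes w: "Re w > 0"
  shows "(\<lambda>N. LINT y|lborel. F (Complex (real (Suc N) / 2) y) * Gamma (w + of_nat (Suc N) - Complex (real (Suc N) / 2) y)
          / (fact N * (w - Complex (real (Suc N) / 2) y))) \<longlonglongrightarrow> 0"
proof (rule Lim_null_comparison)
  let ?o = "omega_term (gamma_mult g)"
  let ?t = "\<lambda>n. Gamma_line_sq (real n / 2 + Re w) / fact n"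
  have o0: "?o \<longlonglongrightarrow> 0" by (rule summable_LIMSEQ_zero[OF sums_summable[OF omega_term_sums[OF H_space_M2[OF g]]]])
  have t0: "?t \<longlonglongrightarrow> 0" by (rule summable_LIMSEQ_zero[OF summable_Gamma_line_sq[OF w]])
  have "(\<lambda>N. 4 * (sqrt (?o N) * sqrt (?t N))) \<longlonglongrightarrow> 4 * (sqrt 0 * sqrt 0)"
    by (intro tendsto_intros o0 t0)
  from LIMSEQ_Suc[OF this] show "(\<lambda>N. 4 * (sqrt (?o (Suc N)) * sqrt (?t (Suc N)))) \<longlonglongrightarrow> 0" by simp
  show "\<forall>\<^sub>F N in sequentially. norm (LINT y|lborel. F (Complex (real (Suc N) / 2) y) * Gamma (w + of_nat (Suc N) - Complex (real (Suc N) / 2) y)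
          / (fact N * (w - Complex (real (Suc N) / 2) y))) \<le> 4 * (sqrt (?o (Suc N)) * sqrt (?t (Suc N)))"
    using eventually_ge_at_top[of "nat \<lceil>4 * Re w\<rceil>"]
  proof eventually_elim
    case (elim N)
    define M where "M = Suc N"
    define x where "x = real M / 2"
    have "4 * Re w \<le> real N" using elim by (simp add: nat_ceiling_le_eq)
    then have x: "x > 0" "x - Re w \<ge> x / 2" by (auto simp: x_def M_def field_simps)
    define u where "u y = Gamma (w + of_nat M - Complex x y)" for y
    have eq: "w + of_nat M - Complex x y = Complex (x + Re w) ((-1) * y + Im w)" for y by (auto simp: complex_eq_iff x_def)
    have ueq: "u y = line_fun Gamma (x + Re w) (Im w + (-1) * y)" for y by (simp add: u_def eq line_fun_def add.commute)
    have GL: "line_fun Gamma (x + Re w) \<in> L2 lborel" using x w by (intro Gamma_line_L2) auto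
    have u: "u \<in> L2 lborel"
    proof -
      have "integrable lborel (\<lambda>y. (cmod (line_fun Gamma (x + Re w) (Im w + (-1) * y)))\<^sup>2)"
        by (rule lborel_integrable_real_affine[OF L2_integrable[OF GL]]) simp
      moreover have "u \<in> borel_measurable borel" unfolding u_def[abs_def] eq using x w by (intro Gamma_line_measurable) auto
      ultimately show ?thesis by (simp add: L2_def ueq)
    qed
    have usq: "norm_sq lborel u = Gamma_line_sq (x + Re w)"
      unfolding Gamma_line_sq_def norm_sq_def ueq by (subst (2) lborel_integral_real_affine[of "-1" _ "Im w"]) simp_all
    have FL: "line_fun F x \<in> L2 lborel" by (rule gamma_weighted_line_L2[OF x(1)])
    let ?h = "\<lambda>y. F (Complex x y) * Gamma (w + of_nat M - Complex x y) / (fact N * (w - Complex x y))"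
    let ?c = "1 / (fact N * (x / 2))"
    have i: "integrable lborel (\<lambda>y. ?c * cmod (line_fun F x y * u y))"
      by (intro integrable_mult_right integrable_norm L2_mult_integrable FL u)
    have le: "norm (?h y) \<le> ?c * cmod (line_fun F x y * u y)" for y
    proof -
      have "x / 2 \<le> cmod (w - Complex x y)" using x abs_Re_le_cmod[of "w - Complex x y"] by simp
      then have "1 / (fact N * cmod (w - Complex x y)) \<le> ?c" using x
        by (intro divide_left_mono mult_left_mono mult_pos_pos) auto
      then have "cmod (line_fun F x y * u y) * (1 / (fact N * cmod (w - Complex x y))) \<le> cmod (line_fun F x y * u y) * ?c"
        by (rule mult_left_mono) simp
      moreover have "norm (?h y) = cmod (line_fun F x y * u y) * (1 / (fact N * cmod (w - Complex x y)))"
        by (simp add: norm_mult norm_divide line_fun_def u_def)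
      ultimately show ?thesis by (simp only: mult.commute)
    qed
    have "norm (LINT y|lborel. ?h y) \<le> (LINT y|lborel. ?c * cmod (line_fun F x y * u y))"
    proof (rule Bochner_Integration.integral_norm_bound_integral[OF _ i le])
      have "(\<lambda>y. line_fun F x y * u y / (fact N * (w - Complex x y))) \<in> borel_measurable lborel"
        using L2_measurable[OF FL] L2_measurable[OF u] by measurable
      then have m: "?h \<in> borel_measurable lborel" by (simp add: line_fun_def u_def)
      show "integrable lborel ?h"
        by (rule Bochner_Integration.integrable_bound[OF i m]) (rule AE_I2, rule order_trans[OF le], simp only: real_norm_def abs_ge_self)
    qed
    also have "\<dots> = ?c * (LINT y|lborel. cmod (line_fun F x y * u y))" by simp
    also have "\<dots> \<le> ?c * (sqrt (line_sq F x) * sqrt (Gamma_line_sq (x + Re w)))"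
      using L2_mult_integral_le[OF FL u] x unfolding usq by (intro mult_left_mono) auto
    also have "line_sq F x = fact M * ?o M"
    proof -
      have "(2 powr x)\<^sup>2 = (2::real) ^ M" by (simp add: x_def powr_power powr_realpow)
      moreover have "?o M = 2 ^ M / fact M * line_sq (gamma_mult g) x" using line_fun_with_boundary[of "gamma_mult g" M] by (simp add: omega_term_def x_def M_def)
      ultimately show ?thesis by (simp add: gamma_weighted_line_L2(2)[OF x(1)] del: fact_Suc)
    qed
    also have "Gamma_line_sq (x + Re w) = fact M * ?t M" by (simp add: x_def del: fact_Suc)
    also have "?c * (sqrt (fact M * ?o M) * sqrt (fact M * ?t M)) = 4 * (sqrt (?o M) * sqrt (?t M))"
    proof -
      have f: "sqrt (fact M) * sqrt (fact M) = real M * fact N" by (simp add: M_def)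
      have "?c * (sqrt (fact M * ?o M) * sqrt (fact M * ?t M)) = ?c * (sqrt (fact M) * sqrt (fact M)) * (sqrt (?o M) * sqrt (?t M))"
        by (simp only: real_sqrt_mult) (simp only: mult_ac)
      also have "?c * (sqrt (fact M) * sqrt (fact M)) = 4" unfolding f x_def by (simp add: M_def)
      finally show ?thesis .
    qed
    finally show ?case by (simp add: M_def x_def)
  qed
qed

text \<open>
  The partial sum is an integral over \<open>Re z = Re w / 2\<close> of a function with a simple pole at \<open>w\<close>;
  moving the line to \<open>Re z = (N + 1) / 2\<close> produces the value at \<open>w\<close>.
\<close>

lemma partial_sum_residue:
  assumes w: "Re w > 0" and N: "real N > 2 * Re w"
  shows "(\<Sum>n<Suc N. Gamma_pairing (Re w / 2) (of_nat n + w) / fact n) = 2 * pi * F w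
     + (LINT y|lborel. F (Complex (real (Suc N) / 2) y) * Gamma (w + of_nat (Suc N) - Complex (real (Suc N) / 2) y)
          / (fact N * (w - Complex (real (Suc N) / 2) y)))"
proof -
  define c where "c = Re w / 2"
  define x where "x = real (Suc N) / 2"
  define s where "s = w + of_nat (Suc N)"
  have c: "0 < c" "c < Re w" using w by (auto simp: c_def)
  have x: "Re w < x" "x < Re s" "c < x" using w N by (auto simp: x_def s_def c_def)
  \<comment> \<open>the sign turns the denominator w - z of the telescoped sum into z - w\<close>
  define k where "k z = - (F z * Gamma (s - z)) / fact N" for z
  let ?FG = "\<lambda>t y. F (Complex t y) * Gamma (s - Complex t y)"
  let ?h = "\<lambda>t y. k (Complex t y) / (Complex t y - w)"
  have kz: "k z / (z - w) = F z * Gamma (s - z) / (fact N * (w - z))" for z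
  proof -
    have "- a / b / d = a / (b * (- d))" for a b d :: complex by simp
    from this[of "F z * Gamma (s - z)" "fact N" "z - w"] show ?thesis by (simp only: k_def minus_diff_eq)
  qed
  obtain C where C: "C \<ge> 0"
    "\<And>t. c \<le> t \<Longrightarrow> t \<le> x \<Longrightarrow> integrable lborel (\<lambda>y. ?FG t y)"
    "\<And>t. c \<le> t \<Longrightarrow> t \<le> x \<Longrightarrow> (LINT y|lborel. cmod (?FG t y)) \<le> C"
    using gamma_weighted_times_Gamma_bounded[of c x s] c x by auto
  have int: "integrable lborel (\<lambda>y. ?h t y)" if t: "c \<le> t" "t \<le> x" "t \<noteq> Re w" for t
  proof -
    let ?d = "\<bar>t - Re w\<bar>"
    have d: "?d > 0" using t by simp
    have i: "integrable lborel (\<lambda>y. (1 / (fact N * ?d)) * cmod (?FG t y))"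
      by (intro integrable_mult_right integrable_norm C t)
    show ?thesis
    proof (rule Bochner_Integration.integrable_bound[OF i])
      show "(\<lambda>y. ?h t y) \<in> borel_measurable lborel"
        unfolding kz using borel_measurable_integrable[OF C(2)[OF t(1,2)]] by measurable
      show "AE y in lborel. norm (?h t y) \<le> norm ((1 / (fact N * ?d)) * cmod (?FG t y))"
      proof (rule AE_I2)
        fix y
        have "?d \<le> cmod (w - Complex t y)" using abs_Re_le_cmod[of "w - Complex t y"] by simp
        then have "1 / (fact N * cmod (w - Complex t y)) \<le> 1 / (fact N * ?d)" using d
          by (intro divide_left_mono mult_left_mono mult_pos_pos) auto
        then have "cmod (?FG t y) * (1 / (fact N * cmod (w - Complex t y)))
            \<le> cmod (?FG t y) * (1 / (fact N * ?d))"
          by (rule mult_left_mono) simp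
        then show "norm (?h t y) \<le> norm ((1 / (fact N * ?d)) * cmod (?FG t y))"
          unfolding kz by (simp add: norm_mult norm_divide mult_ac)
      qed
    qed
  qed
  have jump: "(LINT y|lborel. ?h x y) - (LINT y|lborel. ?h c y) = 2 * pi * k w"
  proof (rule line_integral_jump[where A=0 and B="Re s" and C=C])
    show "k holomorphic_on {z. 0 < Re z \<and> Re z < Re s}"
      unfolding k_def by (intro holomorphic_intros gamma_weighted_times_Gamma_holomorphic) simp
    show "integrable lborel (line_fun (\<lambda>z. k z / (z - w)) c)" "integrable lborel (line_fun (\<lambda>z. k z / (z - w)) x)"
      unfolding line_fun_def using int[of c] int[of x] c x by auto
    fix t assume "t \<in> {c..x}"
    then have t: "c \<le> t" "t \<le> x" by auto
    have "(\<integral>\<^sup>+y. ennreal (cmod (?h t y)) * indicator {y. \<bar>Im w\<bar> + 1 \<le> \<bar>y\<bar>} y \<partial>lborel)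
        \<le> (\<integral>\<^sup>+y. ennreal (cmod (?FG t y)) \<partial>lborel)"
    proof (rule nn_integral_mono)
      fix y
      show "ennreal (cmod (?h t y)) * indicator {y. \<bar>Im w\<bar> + 1 \<le> \<bar>y\<bar>} y
          \<le> ennreal (cmod (?FG t y))"
      proof (cases "\<bar>Im w\<bar> + 1 \<le> \<bar>y\<bar>")
        case True
        then have "1 \<le> cmod (w - Complex t y)" using abs_Im_le_cmod[of "w - Complex t y"] by simp
        moreover have "(1::real) \<le> fact N" by (rule fact_ge_1)
        ultimately have "1 * 1 \<le> fact N * cmod (w - Complex t y)" by (intro mult_mono) auto
        then have "cmod (?FG t y) / (fact N * cmod (w - Complex t y)) \<le> cmod (?FG t y) / 1"
          by (intro divide_left_mono) auto
        then show ?thesis using True unfolding kz by (simp add: norm_divide norm_mult ennreal_leI)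
      qed simp
    qed
    also have "\<dots> = ennreal (LINT y|lborel. cmod (?FG t y))"
      by (rule nn_integral_eq_integral) (use C(2)[OF t] in auto)
    also have "\<dots> \<le> ennreal C" using C t by (intro ennreal_leI)
    finally show "(\<integral>\<^sup>+y. ennreal (cmod (?h t y)) * indicator {y. \<bar>Im w\<bar> + 1 \<le> \<bar>y\<bar>} y \<partial>lborel) \<le> ennreal C" .
  qed (use c x in auto)
  have kw: "k w = - F w"
  proof -
    have "Gamma (s - w) = fact N" using Gamma_fact[of N, where 'a=complex] by (simp add: s_def)
    then show ?thesis by (simp add: k_def)
  qed
  have "(\<Sum>n<Suc N. Gamma_pairing c (of_nat n + w) / fact n) = (\<Sum>n<Suc N. LINT y|lborel. F (Complex c y) * Gamma (of_nat n + w - Complex c y) / fact n)"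
    unfolding Gamma_pairing_def by (intro sum.cong refl) simp
  also have "\<dots> = (LINT y|lborel. (\<Sum>n<Suc N. F (Complex c y) * Gamma (of_nat n + w - Complex c y) / fact n))"
  proof (rule Bochner_Integration.integral_sum[symmetric])
    fix n
    have "integrable lborel (\<lambda>y. F (Complex c y) * Gamma (of_nat n + w - Complex c y))"
      using c by (intro gamma_weighted_times_Gamma_integrable) auto
    then show "integrable lborel (\<lambda>y. F (Complex c y) * Gamma (of_nat n + w - Complex c y) / fact n)" by simp
  qed
  also have "\<dots> = (LINT y|lborel. ?h c y)"
  proof (rule Bochner_Integration.integral_cong[OF refl])
    fix y
    have "(\<Sum>n<Suc N. F (Complex c y) * Gamma (of_nat n + w - Complex c y) / fact n)
        = F (Complex c y) * (\<Sum>n<Suc N. Gamma (w - Complex c y + of_nat n) / fact n)"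
      unfolding sum_distrib_left by (intro sum.cong refl) (simp add: algebra_simps)
    also have "\<dots> = F (Complex c y) * (Gamma (w - Complex c y + of_nat (Suc N)) / (fact N * (w - Complex c y)))"
      by (subst sum_Gamma_over_fact) (use c in auto)
    also have "w - Complex c y + of_nat (Suc N) = s - Complex c y" by (simp add: s_def)
    finally show "(\<Sum>n<Suc N. F (Complex c y) * Gamma (of_nat n + w - Complex c y) / fact n) = ?h c y"
      unfolding kz by simp
  qed
  also have "\<dots> = 2 * pi * F w + (LINT y|lborel. ?h x y)"
    using jump unfolding kw by (simp add: algebra_simps)
  finally show ?thesis unfolding kz by (simp only: c_def x_def s_def)
qed

lemma reproducing_gamma_mult:
  assumes w: "Re w > 0"
  shows "L2_inner omega (with_boundary (gamma_mult g)) (with_boundary (gamma_mult (mellin_kernel w))) = g w"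
proof -
  let ?S = "\<lambda>N. \<Sum>n<Suc N. Gamma_pairing (Re w / 2) (of_nat n + w) / fact n"
  have "(\<lambda>n. cnj (kernel_const w) * (Gamma_pairing (Re w / 2) (of_nat n + w) / fact n)) sums
      L2_inner omega (with_boundary (gamma_mult g)) (with_boundary (gamma_mult (mellin_kernel w)))"
    using M2_omega_inner_sums[OF H_space_M2[OF g] H_space_M2[OF kernel_in_H_space[OF w]]]
    unfolding inner_term_kernel[OF w] by simp
  then have 1: "(\<lambda>N. cnj (kernel_const w) * ?S N) \<longlonglongrightarrow> L2_inner omega (with_boundary (gamma_mult g)) (with_boundary (gamma_mult (mellin_kernel w)))"
    unfolding sums_def by (subst (asm) sum_distrib_left[symmetric]) (rule LIMSEQ_Suc)
  have "\<forall>\<^sub>F N in sequentially. real N > 2 * Re w"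
    using filterlim_real_sequentially by (auto simp: filterlim_at_top_dense)
  then have "\<forall>\<^sub>F N in sequentially. 2 * pi * F w
     + (LINT y|lborel. F (Complex (real (Suc N) / 2) y) * Gamma (w + of_nat (Suc N) - Complex (real (Suc N) / 2) y)
          / (fact N * (w - Complex (real (Suc N) / 2) y))) = ?S N"
    by eventually_elim (rule partial_sum_residue[OF w, symmetric])
  then have "?S \<longlonglongrightarrow> 2 * pi * F w + 0"
    by (rule Lim_transform_eventually[rotated]) (intro tendsto_add tendsto_const remainder_tendsto_0 w)
  from LIMSEQ_unique[OF 1 tendsto_mult_left[OF this]]
  have "L2_inner omega (with_boundary (gamma_mult g)) (with_boundary (gamma_mult (mellin_kernel w))) = cnj (kernel_const w) * (2 * pi * F w)" by simp
  also have "\<dots> = g w"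
    using Gamma_RHP_nonzero[of "1 + w"] w by (simp add: kernel_const_def gamma_weighted_eq cnj_Gamma)
  finally show ?thesis .
qed

end

lemma H_inner_eq:
  assumes "f \<in> H_space" "g \<in> H_space"
  shows "H_inner f g = L2_inner omega (with_boundary (gamma_mult f)) (with_boundary (gamma_mult g))"
  unfolding H_inner_def using assms by (intro M2_omega_inner_eq H_space_M2)

lemma H_inner_kernel:
  assumes "g \<in> H_space" "Re w > 0"
  shows "H_inner g (mellin_kernel w) = g w"
  using assms reproducing_gamma_mult kernel_in_H_space by (simp add: H_inner_eq)

section \<open>Completeness of the space of transforms\<close>

lemma gamma_mult_lincomb:
  "gamma_mult (\<lambda>z. a * f z + b * g z) = (\<lambda>z. a * gamma_mult f z + b * gamma_mult g z)"
  by (simp add: gamma_mult_def fun_eq_iff distrib_left mult.left_commute)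

lemma H_space_lincomb:
  assumes "f \<in> H_space" "g \<in> H_space"
  shows "(\<lambda>z. a * f z + b * g z) \<in> H_space"
proof -
  have "(\<lambda>z. a * f z + b * g z) \<in> holo_space RHP"
    using assms[THEN H_space_holo] by (auto simp: holo_space_def intro!: holomorphic_intros)
  then show ?thesis
    using with_boundary_lincomb(1)[OF assms[THEN H_space_M2], of a b] by (simp add: H_space_def gamma_mult_lincomb)
qed

lemma H_space_diff:
  assumes "f \<in> H_space" "g \<in> H_space"
  shows "(\<lambda>z. f z - g z) \<in> H_space"
  using H_space_lincomb[OF assms, of 1 "-1"] by simp

lemma H_space_cmult: "f \<in> H_space \<Longrightarrow> (\<lambda>z. c * f z) \<in> H_space"
  using H_space_lincomb[of f f c 0] by simp

lemma H_space_zero: "(\<lambda>z. 0) \<in> H_space"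
  using H_space_cmult[OF kernel_in_H_space[of 1], of 0] by simp

lemma H_inner_lincomb_left:
  assumes f: "f \<in> H_space" and g: "g \<in> H_space" and h: "h \<in> H_space"
  shows "H_inner (\<lambda>z. a * f z + b * g z) h = a * H_inner f h + b * H_inner g h"
proof -
  let ?W = "\<lambda>f. with_boundary (gamma_mult f)"
  note L = M2_omega_L2[OF H_space_M2]
  have ae: "AE z in omega. ?W (\<lambda>z. a * f z + b * g z) z = a * ?W f z + b * ?W g z"
    unfolding gamma_mult_lincomb by (rule with_boundary_lincomb(2)) (use f g in \<open>auto intro: H_space_M2\<close>)
  have "L2_inner omega (?W (\<lambda>z. a * f z + b * g z)) (?W h) = L2_inner omega (\<lambda>z. a * ?W f z + b * ?W g z) (?W h)"
    unfolding L2_inner_def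
  proof (rule integral_cong_AE)
    show "(\<lambda>x. ?W (\<lambda>z. a * f z + b * g z) x * cnj (?W h x)) \<in> borel_measurable omega"
      by (rule borel_measurable_integrable) (intro L2_inner_integrable L H_space_lincomb f g h)
    show "(\<lambda>x. (a * ?W f x + b * ?W g x) * cnj (?W h x)) \<in> borel_measurable omega"
      by (rule borel_measurable_integrable) (intro L2_inner_integrable L2_lincomb L f g h)
    show "AE x in omega. ?W (\<lambda>z. a * f z + b * g z) x * cnj (?W h x) = (a * ?W f x + b * ?W g x) * cnj (?W h x)"
      using ae by eventually_elim simp
  qed
  also have "\<dots> = a * L2_inner omega (?W f) (?W h) + b * L2_inner omega (?W g) (?W h)"
    by (rule L2_inner_lincomb_left) (intro L f g h)+
  finally show ?thesis using f g h by (simp add: H_inner_eq H_space_lincomb)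
qed

lemma H_inner_commute: "f \<in> H_space \<Longrightarrow> g \<in> H_space \<Longrightarrow> H_inner g f = cnj (H_inner f g)"
  using L2_inner_commute[of omega "with_boundary (gamma_mult g)" "with_boundary (gamma_mult f)"]
  by (simp add: H_inner_eq)

lemma H_norm_eq: "f \<in> H_space \<Longrightarrow> H_norm f = sqrt (norm_sq omega (with_boundary (gamma_mult f)))"
  by (simp add: H_norm_def M2_omega_norm_eq H_space_M2)

lemma H_norm_nonneg: "f \<in> H_space \<Longrightarrow> 0 \<le> H_norm f"
  by (simp add: H_norm_eq)

lemma H_inner_self: "f \<in> H_space \<Longrightarrow> H_inner f f = of_real ((H_norm f)\<^sup>2)"
  by (simp add: H_norm_eq H_inner_eq L2_inner_self)

lemma H_Cauchy_Schwarz: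
  assumes "f \<in> H_space" "g \<in> H_space"
  shows "cmod (H_inner f g) \<le> H_norm f * H_norm g"
  using L2_Cauchy_Schwarz[OF assms[THEN H_space_M2, THEN M2_omega_L2]] assms by (simp add: H_norm_eq H_inner_eq)

lemma H_inner_lincomb_right:
  assumes "f \<in> H_space" "g \<in> H_space" "h \<in> H_space"
  shows "H_inner h (\<lambda>z. a * f z + b * g z) = cnj a * H_inner h f + cnj b * H_inner h g"
  using assms H_inner_lincomb_left[OF assms, of a b] H_inner_commute[of _ h] H_space_lincomb[of f g a b]
  by simp

lemma H_inner_diff_left:
  assumes "f \<in> H_space" "g \<in> H_space" "h \<in> H_space"
  shows "H_inner (\<lambda>z. f z - g z) h = H_inner f h - H_inner g h"
  using H_inner_lincomb_left[OF assms, of 1 "-1"] by simp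

lemma H_norm_triangle:
  assumes f: "f \<in> H_space" and g: "g \<in> H_space"
  shows "H_norm (\<lambda>z. f z - g z) \<le> H_norm f + H_norm g"
proof -
  let ?d = "\<lambda>z. f z - g z"
  have d: "?d \<in> H_space" by (intro H_space_diff f g)
  have "(H_norm ?d)\<^sup>2 = Re (H_inner ?d ?d)" by (simp add: H_inner_self d)
  also have "\<dots> = Re (H_inner ?d f) - Re (H_inner ?d g)"
    using H_inner_lincomb_right[OF f g d, of 1 "-1"] by simp
  also have "\<dots> \<le> H_norm ?d * H_norm f + H_norm ?d * H_norm g"
    using H_Cauchy_Schwarz[OF d f] H_Cauchy_Schwarz[OF d g] abs_Re_le_cmod[of "H_inner ?d f"] abs_Re_le_cmod[of "H_inner ?d g"]
    by linarith
  finally have *: "H_norm ?d * H_norm ?d \<le> H_norm ?d * (H_norm f + H_norm g)" by (simp add: power2_eq_square distrib_left)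
  show ?thesis
  proof (cases "H_norm ?d = 0")
    case True then show ?thesis using H_norm_nonneg[OF f] H_norm_nonneg[OF g] by simp
  next
    case False then have "H_norm ?d > 0" using H_norm_nonneg[OF d] by simp
    with * show ?thesis by simp
  qed
qed

lemma H_norm_diff_commute:
  assumes "f \<in> H_space" "g \<in> H_space"
  shows "H_norm (\<lambda>z. f z - g z) = H_norm (\<lambda>z. g z - f z)"
proof -
  have "H_norm (\<lambda>z. f z - g z) \<le> H_norm (\<lambda>z. g z - f z)" if "f \<in> H_space" "g \<in> H_space" for f g
    using H_norm_triangle[OF H_space_zero H_space_diff[OF that(2,1)]] H_norm_eq[OF H_space_zero] that
      H_inner_self[OF H_space_zero] H_inner_lincomb_left[OF H_space_zero H_space_zero H_space_zero, of 0 0] by simp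
  from this[OF assms] this[OF assms(2,1)] show ?thesis by simp
qed

lemma H_pointwise_bound:
  assumes "g \<in> H_space" "Re w > 0"
  shows "cmod (g w) \<le> H_norm g * H_norm (mellin_kernel w)"
  using H_Cauchy_Schwarz[OF assms(1) kernel_in_H_space[OF assms(2)]] H_inner_kernel[OF assms] by simp

lemma H_space_zero_outside: "g \<in> H_space \<Longrightarrow> \<not> Re z > 0 \<Longrightarrow> g z = 0"
  using H_space_holo by (auto simp: holo_space_def right_half_plane_def)

lemma H_norm_eq_0:
  assumes "g \<in> H_space" "H_norm g = 0"
  shows "g = (\<lambda>z. 0)"
proof
  fix z show "g z = 0"
    using H_pointwise_bound[OF assms(1), of z] assms(2) H_space_zero_outside[OF assms(1), of z] by (cases "Re z > 0") auto
qed

lemma H_space_sum: "finite A \<Longrightarrow> (\<And>n. n \<in> A \<Longrightarrow> u n \<in> H_space) \<Longrightarrow> (\<lambda>z. \<Sum>n\<in>A. c n * u n z) \<in> H_space"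
proof (induction A rule: finite_induct)
  case empty then show ?case by (simp add: H_space_zero)
next
  case (insert x A)
  then have "(\<lambda>z. c x * u x z + 1 * (\<Sum>n\<in>A. c n * u n z)) \<in> H_space" by (intro H_space_lincomb) auto
  then show ?case using insert by simp
qed

lemma H_inner_sum_left:
  assumes "finite A" "\<And>n. n \<in> A \<Longrightarrow> u n \<in> H_space" "h \<in> H_space"
  shows "H_inner (\<lambda>z. \<Sum>n\<in>A. c n * u n z) h = (\<Sum>n\<in>A. c n * H_inner (u n) h)"
  using assms
proof (induction A rule: finite_induct)
  case empty
  then show ?case using H_inner_lincomb_left[OF H_space_zero H_space_zero, of h 0 0] by simp
next
  case (insert x A)
  have "H_inner (\<lambda>z. c x * u x z + 1 * (\<Sum>n\<in>A. c n * u n z)) h = c x * H_inner (u x) h + 1 * H_inner (\<lambda>z. \<Sum>n\<in>A. c n * u n z) h"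
    using insert by (intro H_inner_lincomb_left H_space_sum) auto
  then show ?case using insert by simp
qed

text \<open>
  Fatou's lemma for \<open>omega\<close> bounds the lines \<open>n \<ge> 1\<close>, on which the functions converge pointwise. It
  says nothing about boundary functions; the line \<open>n = 0\<close> is handled as a limit of lines inside the
  half-plane, whose sections obey the same bound. This accounts for the factor \<open>2\<close>.
\<close>

lemma M2_omega_pointwise_limit:
  assumes f: "f \<in> holo_space RHP" and F: "\<And>m. F m \<in> M2_omega" and lim: "\<And>z. (\<lambda>m. F m z) \<longlonglongrightarrow> f z"
    and bound: "\<forall>\<^sub>F m in sequentially. norm_sq omega (with_boundary (F m)) \<le> c"
  shows "f \<in> M2_omega" "norm_sq omega (with_boundary f) \<le> 2 * c"
proof -
  have Fz: "F m z = 0" if "Re z = 0" for m z using F[of m] that by (auto simp: M2_omega_def holo_space_def right_half_plane_def)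
  have fz: "f z = 0" if "Re z = 0" for z using f that by (auto simp: holo_space_def right_half_plane_def)
  have hol: "f holomorphic_on strip b" for b
    using f by (auto simp: holo_space_def strip_def right_half_plane_def elim: holomorphic_on_subset)
  have line: "line_fun f x \<in> L2 lborel \<and> line_sq f x \<le> fact M * c" if x: "0 < x" "x \<le> real M / 2" for x M
  proof -
    have m: "line_fun f x \<in> borel_measurable lborel" by (rule line_fun_measurable[OF hol[of "x+1"]]) (use x in auto)
    have L: "line_fun (F m) x \<in> L2 lborel" for m
      by (rule hardy_strip_L2[OF M2_omega_hardy_strip[OF F, of "x+1"]]) (use x in auto)
    have l: "AE y in lborel. (\<lambda>m. line_fun (F m) x y) \<longlonglongrightarrow> line_fun f x y"
      by (simp add: line_fun_def lim)
    have e: "\<forall>\<^sub>F m in sequentially. line_sq (F m) x \<le> fact M * c"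
      using bound
    proof eventually_elim
      case (elim m)
      then have "fact M * norm_sq omega (with_boundary (F m)) \<le> fact M * c" by (intro mult_left_mono) auto
      then show ?case using line_sq_le_M2_omega[OF F x, of m] by linarith
    qed
    show ?thesis using L2_Fatou[OF L l m e] by blast
  qed
  have hs: "f \<in> hardy_strip b" if "b > 0" for b
  proof (rule hardy_stripI[OF hol])
    fix x assume x: "0 < x" "x < b"
    then have "x \<le> real (nat \<lceil>2 * b\<rceil>) / 2" by (simp add: le_divide_eq) linarith
    then show "line_fun f x \<in> L2 lborel \<and> line_sq f x \<le> fact (nat \<lceil>2 * b\<rceil>) * c" using line x(1) by blast
  qed
  have bv: "norm_sq lborel (boundary_value f) \<le> c"
  proof (rule tendsto_upperbound[OF line_sq_tendsto_boundary[OF hs[of 1]]])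
    show "\<forall>\<^sub>F x in at_right 0. line_sq f x \<le> c"
      unfolding eventually_at_right_field using line[of _ 1] by (intro exI[of _ "1/2"]) auto
  qed auto
  have le: "cmod (F m z) \<le> cmod (with_boundary (F m) z)" for m z using Fz by (simp add: with_boundary_def)
  have Fm: "F m \<in> borel_measurable borel" for m using F[of m] by (intro holo_space_measurable[OF open_RHP]) (simp add: M2_omega_def)
  have FL: "F m \<in> L2 omega" for m
    unfolding L2_def using Fm le
    by (auto intro!: Bochner_Integration.integrable_bound[OF L2_integrable[OF M2_omega_L2[OF F[of m]]]] AE_I2 power_mono cong: measurable_cong_sets)
  have Fle: "norm_sq omega (F m) \<le> norm_sq omega (with_boundary (F m))" for m
    unfolding norm_sq_def by (intro integral_mono power_mono le L2_integrable FL M2_omega_L2 F) auto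
  have fm: "f \<in> borel_measurable omega" using holo_space_measurable[OF open_RHP f] by (simp cong: measurable_cong_sets)
  have "\<forall>\<^sub>F m in sequentially. norm_sq omega (F m) \<le> c" using bound by eventually_elim (rule order_trans[OF Fle])
  from L2_Fatou[OF FL AE_I2[OF lim] fm this] have fL: "f \<in> L2 omega" "norm_sq omega f \<le> c" by auto
  have s: "(\<lambda>n. 2 ^ n / fact n * line_sq f (real n / 2)) sums norm_sq omega f"
    using integral_omega[OF L2_integrable[OF fL(1)]] by (simp add: norm_sq_def line_fun_def)
  have s0: "line_sq f 0 = 0" by (simp add: norm_sq_def line_fun_def fz)
  define a where "a n = (if n = 0 then norm_sq lborel (boundary_value f) else 0)" for n :: nat
  have t: "omega_term f n = 2 ^ n / fact n * line_sq f (real n / 2) + a n" for n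
    by (cases "n = 0") (auto simp: omega_term_def line_fun_with_boundary[of f n, simplified] line_fun_with_boundary[of f 0, simplified] s0 a_def)
  have "a sums norm_sq lborel (boundary_value f)"
    using sums_single[of 0 "\<lambda>_. norm_sq lborel (boundary_value f)"] by (simp add: a_def[abs_def])
  from sums_add[OF s this] have os: "omega_term f sums (norm_sq omega f + norm_sq lborel (boundary_value f))"
    by (simp add: t[abs_def])
  then show M: "f \<in> M2_omega" by (intro M2_omegaI f hs) (auto simp: summable_def)
  show "norm_sq omega (with_boundary f) \<le> 2 * c"
    using sums_unique2[OF omega_term_sums[OF M] os] bv fL by simp
qed

lemma continuous_kernel_diagonal:
  "continuous_on RHP (\<lambda>w. 1 / (2 * of_real pi) * (Gamma (w + cnj w) / (Gamma (1 + w) * Gamma (1 + cnj w))))"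
proof -
  have Gc: "continuous_on {z :: complex. Re z > 0} Gamma"
    by (rule continuous_on_Gamma) (auto dest: Re_pos_not_nonpos_Int)
  have "continuous_on RHP (\<lambda>w. Gamma (w + cnj w))"
    by (rule continuous_on_compose2[OF Gc])
      (auto simp: right_half_plane_def intro: continuous_on_add continuous_on_id continuous_on_cnj)
  moreover have "continuous_on RHP (\<lambda>w. Gamma (1 + w))"
    by (rule continuous_on_compose2[OF Gc])
      (auto simp: right_half_plane_def intro: continuous_on_add continuous_on_id continuous_on_const)
  moreover have "continuous_on RHP (\<lambda>w. Gamma (1 + cnj w))"
    by (rule continuous_on_compose2[OF Gc])
      (auto simp: right_half_plane_def intro: continuous_on_add continuous_on_id continuous_on_cnj continuous_on_const)
  moreover have "\<forall>w\<in>RHP. Gamma (1 + w) * Gamma (1 + cnj w) \<noteq> 0"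
    by (simp add: right_half_plane_def Gamma_RHP_nonzero)
  ultimately show ?thesis
    by (intro continuous_on_mult continuous_on_divide continuous_on_const)
qed

lemma kernel_norm_sq:
  assumes "Re w > 0"
  shows "(H_norm (mellin_kernel w))\<^sup>2 = Re (mellin_kernel w w)"
  using H_inner_kernel[OF kernel_in_H_space[OF assms] assms] H_inner_self[OF kernel_in_H_space[OF assms]] by (metis Re_complex_of_real)

lemma kernel_norm_bounded:
  assumes "compact K" "K \<subseteq> RHP"
  obtains B where "B > 0" "\<And>w. w \<in> K \<Longrightarrow> H_norm (mellin_kernel w) \<le> B"
proof -
  let ?d = "\<lambda>w. 1 / (2 * of_real pi) * (Gamma (w + cnj w) / (Gamma (1 + w) * Gamma (1 + cnj w)))"
  have "compact (?d ` K)"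
    using assms continuous_kernel_diagonal by (intro compact_continuous_image) (auto elim: continuous_on_subset)
  then obtain B where B: "B > 0" "\<And>w. w \<in> K \<Longrightarrow> cmod (?d w) \<le> B"
    using compact_imp_bounded[of "?d ` K"] unfolding bounded_pos by blast
  have "H_norm (mellin_kernel w) \<le> sqrt B" if w: "w \<in> K" for w
  proof -
    have "Re w > 0" using w assms by (auto simp: right_half_plane_def)
    moreover have "mellin_kernel w w = ?d w" using w assms by (auto simp: mellin_kernel_def zero_ext_def)
    ultimately have "(H_norm (mellin_kernel w))\<^sup>2 \<le> B"
      using B(2)[OF w] kernel_norm_sq[of w] complex_Re_le_cmod[of "?d w"] by simp
    then show ?thesis by (rule real_le_rsqrt)
  qed
  then show ?thesis using that[of "sqrt B"] B by simp
qed

text \<open>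
  Point evaluations are bounded locally uniformly by the norm, because the kernel is continuous on
  the diagonal. So a Cauchy sequence converges locally uniformly, and Fatou's lemma
  (\<open>M2_omega_pointwise_limit\<close>), applied to the differences \<open>s n - s m\<close> as \<open>m\<close> grows, turns
  this into convergence in norm.
\<close>

lemma H_space_complete:
  assumes s: "\<And>n. s n \<in> H_space"
    and Cauchy: "\<And>\<epsilon>. \<epsilon> > 0 \<Longrightarrow> \<exists>N::nat. \<forall>m\<ge>N. \<forall>n\<ge>N. H_norm (\<lambda>x. s m x - s n x) < \<epsilon>"
  shows "\<exists>l\<in>H_space. (\<lambda>n. H_norm (\<lambda>x. s n x - l x)) \<longlonglongrightarrow> 0"
proof -
  have pw: "cmod (s m w - s n w) \<le> H_norm (\<lambda>x. s m x - s n x) * H_norm (mellin_kernel w)" if "Re w > 0" for m n w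
    using H_pointwise_bound[OF H_space_diff[OF s s] that] by simp
  define l where "l z = lim (\<lambda>n. s n z)" for z
  have lim: "(\<lambda>n. s n z) \<longlonglongrightarrow> l z" for z
  proof (cases "Re z > 0")
    case False then show ?thesis using H_space_zero_outside[OF s] by (simp add: l_def)
  next
    case True
    let ?B = "H_norm (mellin_kernel z) + 1"
    have B: "?B > 0" using H_norm_nonneg[OF kernel_in_H_space[OF True]] by simp
    have "Cauchy (\<lambda>n. s n z)"
    proof (rule CauchyI)
      fix e :: real assume "e > 0"
      then obtain N where N: "\<forall>m\<ge>N. \<forall>n\<ge>N. H_norm (\<lambda>x. s m x - s n x) < e / ?B" using Cauchy[of "e / ?B"] B by auto
      have "norm (s m z - s n z) < e" if "m \<ge> N" "n \<ge> N" for m n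
      proof -
        have "norm (s m z - s n z) \<le> H_norm (\<lambda>x. s m x - s n x) * ?B"
          using pw[OF True, of m n] H_norm_nonneg[OF H_space_diff[OF s s], of m n] by (simp add: distrib_left)
        also have "\<dots> < e / ?B * ?B" using N that B by (intro mult_strict_right_mono) auto
        finally show ?thesis using B by simp
      qed
      then show "\<exists>M. \<forall>m\<ge>M. \<forall>n\<ge>M. norm (s m z - s n z) < e" by blast
    qed
    then show ?thesis by (simp add: l_def Cauchy_convergent_iff convergent_LIMSEQ_iff)
  qed
  have "l holomorphic_on RHP"
  proof (rule holomorphic_uniform_sequence[OF open_RHP])
    show "s n holomorphic_on RHP" for n using H_space_holo[OF s[of n]] by (simp add: holo_space_def)
    fix z assume "z \<in> RHP"
    then obtain d where d: "d > 0" "cball z d \<subseteq> RHP" using open_RHP open_contains_cball by blast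
    obtain B where B: "B > 0" "\<And>w. w \<in> cball z d \<Longrightarrow> H_norm (mellin_kernel w) \<le> B"
      using kernel_norm_bounded[OF compact_cball d(2)] by blast
    have "uniform_limit (cball z d) s l sequentially"
    proof (rule uniform_limitI)
      fix e :: real assume e: "e > 0"
      then obtain N where N: "\<forall>m\<ge>N. \<forall>n\<ge>N. H_norm (\<lambda>x. s m x - s n x) < e / 2 / B" using Cauchy[of "e / 2 / B"] B by auto
      have "dist (s n w) (l w) < e" if n: "n \<ge> N" and w: "w \<in> cball z d" for n w
      proof -
        have "norm (s n w - l w) \<le> e / 2"
        proof (rule tendsto_upperbound[where F=sequentially])
          show "(\<lambda>m. norm (s n w - s m w)) \<longlonglongrightarrow> norm (s n w - l w)" by (intro tendsto_intros lim)
          show "\<forall>\<^sub>F m in sequentially. norm (s n w - s m w) \<le> e / 2"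
            using eventually_ge_at_top[of N]
          proof eventually_elim
            case (elim m)
            have "Re w > 0" using w d by (auto simp: right_half_plane_def)
            then have "norm (s n w - s m w) \<le> H_norm (\<lambda>x. s n x - s m x) * H_norm (mellin_kernel w)" by (rule pw)
            also have "\<dots> \<le> e / 2 / B * B" using N n elim B(2)[OF w] e B(1) \<open>Re w > 0\<close>
              by (intro mult_mono) (auto intro: less_imp_le H_norm_nonneg kernel_in_H_space)
            finally show ?case using B by simp
          qed
        qed simp
        then show ?thesis using e by (simp add: dist_norm)
      qed
      then show "\<forall>\<^sub>F n in sequentially. \<forall>x\<in>cball z d. dist (s n x) (l x) < e"
        unfolding eventually_sequentially by blast
    qed
    with d show "\<exists>d>0. cball z d \<subseteq> RHP \<and> uniform_limit (cball z d) s l sequentially" by blast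
  qed
  moreover have "l z = 0" if "z \<notin> RHP" for z
  proof -
    have "s n z = 0" for n using that H_space_zero_outside[OF s] by (auto simp: right_half_plane_def)
    then show ?thesis by (simp add: l_def)
  qed
  ultimately have lh: "l \<in> holo_space RHP" by (simp add: holo_space_def)
  have D: "(\<lambda>z. s n z - l z) \<in> H_space \<and> (H_norm (\<lambda>z. s n z - l z))\<^sup>2 \<le> 2 * e\<^sup>2"
    if n: "\<forall>m\<ge>N. H_norm (\<lambda>x. s n x - s m x) < e" for n N e
  proof -
    let ?d = "\<lambda>z. s n z - l z"
    have dh: "?d \<in> holo_space RHP" using lh H_space_holo[OF s[of n]] by (auto simp: holo_space_def intro!: holomorphic_intros)
    have b: "\<forall>\<^sub>F m in sequentially. norm_sq omega (with_boundary (gamma_mult (\<lambda>z. s n z - s m z))) \<le> e\<^sup>2"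
      using eventually_ge_at_top[of N]
    proof eventually_elim
      case (elim m)
      have "H_norm (\<lambda>x. s n x - s m x) < e" using n elim by blast
      then have "(H_norm (\<lambda>x. s n x - s m x))\<^sup>2 \<le> e\<^sup>2" using H_norm_nonneg[OF H_space_diff[OF s s]] by (intro power_mono) (auto intro: less_imp_le)
      then show ?case using H_norm_eq[OF H_space_diff[OF s s], of n m] by simp
    qed
    have l: "(\<lambda>m. gamma_mult (\<lambda>z. s n z - s m z) z) \<longlonglongrightarrow> gamma_mult ?d z" for z
      unfolding gamma_mult_def by (intro tendsto_intros lim)
    note M = M2_omega_pointwise_limit[OF gamma_mult_holo_space[OF dh] H_space_M2[OF H_space_diff[OF s s]] l b]
    have "?d \<in> H_space" using M(1) dh by (simp add: H_space_def)
    then show ?thesis using M(2) by (simp add: H_norm_eq)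
  qed
  \<comment> \<open>any fixed bound shows that some difference, and hence the limit itself, lies in the space\<close>
  obtain N where N: "\<forall>m\<ge>N. \<forall>n\<ge>N. H_norm (\<lambda>x. s m x - s n x) < 1" using Cauchy[of 1] by auto
  have "(\<lambda>z. s N z - l z) \<in> H_space" using D[of N N 1] N by blast
  from H_space_diff[OF s[of N] this] have lH: "l \<in> H_space" by simp
  have "(\<lambda>n. H_norm (\<lambda>x. s n x - l x)) \<longlonglongrightarrow> 0"
  proof (rule LIMSEQ_I)
    fix r :: real assume r: "r > 0"
    then obtain N where N: "\<forall>m\<ge>N. \<forall>n\<ge>N. H_norm (\<lambda>x. s m x - s n x) < r / 2" using Cauchy[of "r / 2"] by auto
    have "norm (H_norm (\<lambda>x. s n x - l x) - 0) < r" if n: "n \<ge> N" for n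
    proof -
      have "(H_norm (\<lambda>z. s n z - l z))\<^sup>2 \<le> 2 * (r / 2)\<^sup>2" using D[of N n "r/2"] N n by blast
      also have "\<dots> < r\<^sup>2" using r by (simp add: power2_eq_square)
      finally have "H_norm (\<lambda>z. s n z - l z) < r" by (rule power_less_imp_less_base) (use r in simp)
      then show ?thesis using H_norm_nonneg[OF H_space_diff[OF s lH]] by simp
    qed
    then show "\<exists>no. \<forall>n\<ge>no. norm (H_norm (\<lambda>x. s n x - l x) - 0) < r" by blast
  qed
  with lH show ?thesis by blast
qed

section \<open>An orthonormal sequence of polynomials\<close>

abbreviation (input) poly_RHP :: "complex poly \<Rightarrow> complex \<Rightarrow> complex" where
  "poly_RHP p \<equiv> zero_ext RHP (poly p)"

lemma prod_monic_linear:
  fixes a :: "nat \<Rightarrow> 'a::idom"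
  shows "degree (\<Prod>i<n. [:a i, 1:]) = n" "coeff (\<Prod>i<n. [:a i, 1:]) n = 1"
proof -
  have d: "degree (\<Prod>i<n. [:a i, 1:]) = (\<Sum>i<n. degree [:a i, 1:])"
    by (rule degree_prod_eq_sum_degree) auto
  then show d': "degree (\<Prod>i<n. [:a i, 1:]) = n" by simp
  have "lead_coeff (\<Prod>i<n. [:a i, 1:]) = (\<Prod>i<n. lead_coeff [:a i, 1:])" by (rule lead_coeff_prod)
  then show "coeff (\<Prod>i<n. [:a i, 1:]) n = 1" by (simp add: d')
qed

definition rising_poly :: "nat \<Rightarrow> complex poly" where
  "rising_poly n = (\<Prod>i<n. [:1 + of_nat i, 1:])"

text \<open>
  The leading coefficient of the kernel at \<open>n + 1\<close>, a polynomial of degree \<open>n\<close> by \<open>kernel_at_nat\<close>.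
\<close>

definition kernel_lead :: "nat \<Rightarrow> complex" where
  "kernel_lead n = 1 / (2 * of_real pi * fact (Suc n))"

text \<open>
  At \<open>w = n + 1\<close> the quotient \<open>Gamma (z + n + 1) / Gamma (1 + z)\<close> is a Pochhammer symbol. So the kernels
  at the positive integers form a basis of the polynomials with increasing degrees.
\<close>

lemma kernel_at_nat:
  "mellin_kernel (of_nat (Suc n)) = poly_RHP (smult (kernel_lead n) (rising_poly n))"
proof
  fix z
  show "mellin_kernel (of_nat (Suc n)) z = poly_RHP (smult (kernel_lead n) (rising_poly n)) z"
  proof (cases "z \<in> RHP")
    case True
    then have z: "Re z > 0" by (simp add: right_half_plane_def)
    have p: "poly (rising_poly n) z = pochhammer (1 + z) n"
      by (simp add: rising_poly_def poly_prod pochhammer_prod atLeast0LessThan add_ac)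
    have "pochhammer (1 + z) n = Gamma (1 + z + of_nat n) / Gamma (1 + z)"
      by (rule pochhammer_Gamma[OF Re_pos_not_nonpos_Int]) (use z in simp)
    moreover have "Gamma (1 + cnj (of_nat (Suc n))) = (fact (Suc n) :: complex)"
      using Gamma_fact[of "Suc n", where 'a=complex] by (simp del: fact_Suc of_nat_Suc)
    ultimately show ?thesis using True
      by (simp add: mellin_kernel_def zero_ext_def p kernel_lead_def add_ac del: fact_Suc)
  qed (simp add: mellin_kernel_def zero_ext_def)
qed

lemma poly_RHP_lincomb: "poly_RHP (smult a p + smult b q) = (\<lambda>z. a * poly_RHP p z + b * poly_RHP q z)"
  by (auto simp: zero_ext_def fun_eq_iff)

text \<open>
  The kernel at \<open>n + 1\<close> has degree exactly \<open>n\<close>, so a multiple of it removes the leading term. This is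
  the step of the inductions over the degree.
\<close>

lemma poly_split_lead:
  assumes "\<forall>i\<ge>Suc n. coeff p i = 0"
  obtains q where "\<forall>i\<ge>n. coeff q i = 0"
    "poly_RHP p = (\<lambda>z. (coeff p n / kernel_lead n) * mellin_kernel (of_nat (Suc n)) z + 1 * poly_RHP q z)"
proof
  let ?c = "coeff p n / kernel_lead n"
  let ?k = "smult (kernel_lead n) (rising_poly n)"
  have kl: "kernel_lead n \<noteq> 0" by (simp add: kernel_lead_def del: fact_Suc)
  define q where "q = p - smult ?c ?k"
  have "coeff q i = 0" if "i \<ge> n" for i
  proof (cases "i = n")
    case True
    then show ?thesis using kl prod_monic_linear(2)[of "\<lambda>i. 1 + of_nat i :: complex" n] by (simp add: q_def rising_poly_def)
  next
    case False
    then have "i > n" using that by simp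
    moreover have "coeff (rising_poly n) i = 0"
      using \<open>i > n\<close> prod_monic_linear(1)[of "\<lambda>i. 1 + of_nat i :: complex" n] by (intro coeff_eq_0) (simp add: rising_poly_def)
    ultimately show ?thesis using assms by (simp add: q_def)
  qed
  then show "\<forall>i\<ge>n. coeff q i = 0" by blast
  have "p = smult ?c ?k + smult 1 q" by (simp add: q_def)
  then show "poly_RHP p = (\<lambda>z. ?c * mellin_kernel (of_nat (Suc n)) z + 1 * poly_RHP q z)"
    unfolding kernel_at_nat by (metis poly_RHP_lincomb)
qed

lemma poly_RHP_zero_coeffs: "\<forall>i\<ge>0. coeff p i = 0 \<Longrightarrow> poly_RHP p = (\<lambda>z. 0)"
proof -
  assume "\<forall>i\<ge>0. coeff p i = 0"
  then have "p = 0" by (simp add: poly_eq_iff)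
  then show ?thesis by (simp add: zero_ext_def fun_eq_iff)
qed

lemma poly_in_H_space: "poly_RHP p \<in> H_space"
proof -
  have "\<forall>i\<ge>n. coeff p i = 0 \<Longrightarrow> poly_RHP p \<in> H_space" for n p
  proof (induction n arbitrary: p)
    case 0 then show ?case using poly_RHP_zero_coeffs H_space_zero by simp
  next
    case (Suc n)
    then obtain q where "\<forall>i\<ge>n. coeff q i = 0"
      "poly_RHP p = (\<lambda>z. (coeff p n / kernel_lead n) * mellin_kernel (of_nat (Suc n)) z + 1 * poly_RHP q z)"
      using poly_split_lead by blast
    then show ?case using Suc.IH by (simp only:) (intro H_space_lincomb kernel_in_H_space, auto)
  qed
  from this[of "Suc (degree p)" p] show ?thesis by (simp add: coeff_eq_0)
qed

text \<open>
  Polynomials of degree below \<open>n\<close> are combinations of the kernels at \<open>1, \<dots>, n\<close>, and the inner product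
  with a kernel is a value.
\<close>

lemma H_inner_poly_eq_0:
  assumes "f \<in> H_space"
  shows "\<forall>i\<ge>n. coeff p i = 0 \<Longrightarrow> (\<And>j. j < n \<Longrightarrow> f (of_nat (Suc j)) = 0) \<Longrightarrow> H_inner f (poly_RHP p) = 0"
proof (induction n arbitrary: p)
  case 0
  then show ?case using poly_RHP_zero_coeffs[of p] H_inner_lincomb_right[OF H_space_zero H_space_zero assms, of 0 0] by simp
next
  case (Suc n)
  then obtain q where q: "\<forall>i\<ge>n. coeff q i = 0"
      "poly_RHP p = (\<lambda>z. (coeff p n / kernel_lead n) * mellin_kernel (of_nat (Suc n)) z + 1 * poly_RHP q z)"
    using poly_split_lead by blast
  have "H_inner f (poly_RHP p) = cnj (coeff p n / kernel_lead n) * H_inner f (mellin_kernel (of_nat (Suc n))) + cnj 1 * H_inner f (poly_RHP q)"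
    unfolding q(2) by (rule H_inner_lincomb_right) (auto intro: kernel_in_H_space poly_in_H_space assms)
  then show ?case using Suc.prems(2)[of n] Suc.IH[OF q(1)] Suc.prems(2) H_inner_kernel[OF assms, of "of_nat (Suc n)"] by simp
qed

lemma H_inner_poly_lead:
  assumes f: "f \<in> H_space" and p: "\<forall>i\<ge>Suc n. coeff p i = 0" and z: "\<And>j. j < n \<Longrightarrow> f (of_nat (Suc j)) = 0"
  shows "H_inner f (poly_RHP p) = cnj (coeff p n / kernel_lead n) * f (of_nat (Suc n))"
proof -
  obtain q where q: "\<forall>i\<ge>n. coeff q i = 0"
      "poly_RHP p = (\<lambda>z. (coeff p n / kernel_lead n) * mellin_kernel (of_nat (Suc n)) z + 1 * poly_RHP q z)"
    using poly_split_lead[OF p] by blast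
  have "H_inner f (poly_RHP p) = cnj (coeff p n / kernel_lead n) * H_inner f (mellin_kernel (of_nat (Suc n))) + cnj 1 * H_inner f (poly_RHP q)"
    unfolding q(2) by (rule H_inner_lincomb_right) (auto intro: kernel_in_H_space poly_in_H_space f)
  then show ?thesis using H_inner_poly_eq_0[OF f q(1) z] H_inner_kernel[OF f, of "of_nat (Suc n)"] by simp
qed

definition newton_const :: "nat \<Rightarrow> real" where
  "newton_const n = sqrt (2 * pi * real (Suc n))"

lemma newton_const_pos: "newton_const n > 0" and newton_const_sq: "(newton_const n)\<^sup>2 = 2 * pi * real (Suc n)"
  by (simp_all add: newton_const_def del: of_nat_Suc)

definition newton_poly :: "nat \<Rightarrow> complex poly" where
  "newton_poly n = smult (1 / (fact n * of_real (newton_const n))) (\<Prod>i<n. [:- 1 - of_nat i, 1:])"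

text \<open>
  The image, under the transform divided by \<open>sqrt (2 * pi)\<close>, of the normalized monomial
  \<open>sqrt (n + 1) * (\<zeta> - 1) ^ n\<close>; see \<open>newton_eq\<close> for its values.
\<close>

definition newton :: "nat \<Rightarrow> complex \<Rightarrow> complex" where
  "newton n = poly_RHP (newton_poly n)"

lemma newton_eq: "Re z > 0 \<Longrightarrow> newton n z = ((z - 1) gchoose n) / of_real (newton_const n)"
proof -
  have "(\<Prod>i<n. poly [:- 1 - of_nat i, 1:] z) = fact n * ((z - 1) gchoose n)"
    by (simp add: gbinomial_mult_fact atLeast0LessThan algebra_simps)
  then show "Re z > 0 \<Longrightarrow> newton n z = ((z - 1) gchoose n) / of_real (newton_const n)"
    by (simp add: newton_def zero_ext_def right_half_plane_def newton_poly_def poly_prod)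
qed

lemma newton_in_H_space: "newton n \<in> H_space"
  unfolding newton_def by (rule poly_in_H_space)

lemma newton_at_nat: "newton n (of_nat (Suc m)) = of_nat (m choose n) / of_real (newton_const n)"
  by (subst newton_eq) (simp_all add: binomial_gbinomial)

lemma newton_poly_coeff:
  "coeff (newton_poly n) n = 1 / (fact n * of_real (newton_const n))" "i > n \<Longrightarrow> coeff (newton_poly n) i = 0"
  using prod_monic_linear[of "\<lambda>i. - 1 - of_nat i :: complex" n]
  by (auto simp: newton_poly_def coeff_eq_0)

text \<open>
  \<open>newton n\<close> vanishes at \<open>1, \<dots>, n\<close>, hence is orthogonal to lower degrees. Its norm is the product of its
  leading coefficient and its value at \<open>n + 1\<close>, up to the leading coefficient of the kernel there.
\<close>

lemma newton_orthonormal: "H_inner (newton n) (newton m) = (if n = m then 1 else 0)"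
proof -
  have less: "H_inner (newton n) (newton m) = 0" if "m < n" for m n
    unfolding newton_def[of m]
    by (rule H_inner_poly_eq_0[OF newton_in_H_space, of n])
      (use that newton_poly_coeff(2)[of m] in \<open>auto simp: newton_at_nat[of n, simplified] binomial_eq_0\<close>)
  have "H_inner (newton n) (poly_RHP (newton_poly n)) = cnj (coeff (newton_poly n) n / kernel_lead n) * newton n (of_nat (Suc n))"
    by (rule H_inner_poly_lead[OF newton_in_H_space])
      (use newton_poly_coeff(2)[of n] in \<open>auto simp: newton_at_nat[of n, simplified] binomial_eq_0\<close>)
  also have "\<dots> = (2 * of_real pi * of_nat (Suc n)) / (of_real (newton_const n))\<^sup>2"
    using newton_const_pos[of n]
    by (simp add: newton_poly_coeff newton_at_nat[simplified] kernel_lead_def power2_eq_square)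
  also have "(complex_of_real (newton_const n))\<^sup>2 = 2 * of_real pi * of_nat (Suc n)"
    using arg_cong[OF newton_const_sq[of n], of complex_of_real] by simp
  finally have "H_inner (newton n) (newton n) = 1" unfolding newton_def[symmetric] by (simp del: of_nat_Suc)
  then show ?thesis
    using less[of m n] less[of n m] H_inner_commute[OF newton_in_H_space newton_in_H_space, of m n]
    by (cases n m rule: linorder_cases) auto
qed

lemma H_inner_newton_sum:
  assumes "finite A"
  shows "H_inner (\<lambda>z. \<Sum>n\<in>A. c n * newton n z) (newton m) = (if m \<in> A then c m else 0)"
  using assms by (subst H_inner_sum_left) (auto simp: newton_in_H_space newton_orthonormal if_distrib cong: if_cong)

lemma newton_sum_in_H_space: "finite A \<Longrightarrow> (\<lambda>z. \<Sum>n\<in>A. c n * newton n z) \<in> H_space"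
  by (intro H_space_sum newton_in_H_space)

lemma H_norm_newton_sum:
  assumes "finite A"
  shows "(H_norm (\<lambda>z. \<Sum>n\<in>A. c n * newton n z))\<^sup>2 = (\<Sum>n\<in>A. (cmod (c n))\<^sup>2)"
proof -
  let ?S = "\<lambda>z. \<Sum>n\<in>A. c n * newton n z"
  have "H_inner ?S ?S = (\<Sum>n\<in>A. c n * H_inner (newton n) ?S)"
    by (rule H_inner_sum_left) (auto simp: assms newton_in_H_space intro: newton_sum_in_H_space)
  also have "\<dots> = (\<Sum>n\<in>A. c n * cnj (c n))"
  proof (rule sum.cong[OF refl])
    fix n assume n: "n \<in> A"
    have "H_inner (newton n) ?S = cnj (H_inner ?S (newton n))"
      by (rule H_inner_commute) (auto simp: assms newton_in_H_space intro: newton_sum_in_H_space)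
    then show "c n * H_inner (newton n) ?S = c n * cnj (c n)" using n H_inner_newton_sum[OF assms, of c n] by simp
  qed
  also have "\<dots> = of_real (\<Sum>n\<in>A. (cmod (c n))\<^sup>2)" by (simp only: of_real_sum complex_norm_square)
  finally show ?thesis using H_inner_self[OF newton_sum_in_H_space[OF assms], of c] of_real_eq_iff by metis
qed

text \<open>
  By orthonormality the partial sums are Cauchy, so they converge in norm by completeness. The limit is
  also the pointwise sum, because values are inner products with kernels.
\<close>

lemma newton_series_converges:
  assumes "summable (\<lambda>n. (cmod (c n))\<^sup>2)"
  obtains g where "g \<in> H_space" "\<And>z. (\<lambda>n. c n * newton n z) sums g z"
    "(\<lambda>N. H_norm (\<lambda>z. (\<Sum>n<N. c n * newton n z) - g z)) \<longlonglongrightarrow> 0"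
    "\<And>n. H_inner g (newton n) = c n" "(\<lambda>n. (cmod (c n))\<^sup>2) sums (H_norm g)\<^sup>2"
proof -
  define S where "S N z = (\<Sum>n<N. c n * newton n z)" for N z
  have S: "S N \<in> H_space" for N unfolding S_def[abs_def] by (intro newton_sum_in_H_space) simp
  have diff: "(H_norm (\<lambda>z. S n z - S m z))\<^sup>2 = (\<Sum>k\<in>{m..<n}. (cmod (c k))\<^sup>2)" if "m \<le> n" for m n
  proof -
    have "(\<lambda>z. S n z - S m z) = (\<lambda>z. \<Sum>k\<in>{m..<n}. c k * newton k z)"
      unfolding S_def using that sum_diff_nat_ivl[of 0 m n] by (auto simp: fun_eq_iff atLeast0LessThan)
    then show ?thesis by (simp add: H_norm_newton_sum)
  qed
  have "\<exists>N. \<forall>m\<ge>N. \<forall>n\<ge>N. H_norm (\<lambda>x. S m x - S n x) < e" if e: "e > 0" for e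
  proof -
    obtain N where N: "\<And>m n. m \<ge> N \<Longrightarrow> norm (\<Sum>k\<in>{m..<n}. (cmod (c k))\<^sup>2) < e\<^sup>2"
      using assms e unfolding summable_Cauchy by (meson zero_less_power)
    have *: "H_norm (\<lambda>x. S n x - S m x) < e" if "N \<le> m" "m \<le> n" for m n
    proof -
      have "(H_norm (\<lambda>x. S n x - S m x))\<^sup>2 < e\<^sup>2" unfolding diff[OF that(2)] using N[OF that(1), of n] by simp
      then show ?thesis using e by (intro power_less_imp_less_base[of _ 2 e]) auto
    qed
    have "H_norm (\<lambda>x. S m x - S n x) < e" if "N \<le> m" "N \<le> n" for m n
      using *[of m n] *[of n m] that H_norm_diff_commute[OF S S, of m n] by (cases "m \<le> n") auto
    then show ?thesis by blast
  qed
  from H_space_complete[OF S this] obtain g where g: "g \<in> H_space" "(\<lambda>N. H_norm (\<lambda>z. S N z - g z)) \<longlonglongrightarrow> 0" by blast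
  have inner: "(\<lambda>N. H_inner (S N) h) \<longlonglongrightarrow> H_inner g h" if h: "h \<in> H_space" for h
  proof -
    have "(\<lambda>N. H_inner (S N) h - H_inner g h) \<longlonglongrightarrow> 0"
    proof (rule Lim_null_comparison)
      show "\<forall>\<^sub>F N in sequentially. norm (H_inner (S N) h - H_inner g h) \<le> H_norm (\<lambda>z. S N z - g z) * H_norm h"
        using H_Cauchy_Schwarz[OF H_space_diff[OF S g(1)] h] H_inner_diff_left[OF S g(1) h] by simp
      show "(\<lambda>N. H_norm (\<lambda>z. S N z - g z) * H_norm h) \<longlonglongrightarrow> 0" by (rule tendsto_mult_left_zero[OF g(2)])
    qed
    then show ?thesis by (rule LIM_zero_cancel)
  qed
  have pt: "(\<lambda>n. c n * newton n z) sums g z" for z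
  proof (cases "Re z > 0")
    case True
    from inner[OF kernel_in_H_space[OF True]] have "(\<lambda>N. S N z) \<longlonglongrightarrow> g z"
      by (simp add: H_inner_kernel[OF S True] H_inner_kernel[OF g(1) True])
    then show ?thesis by (simp add: sums_def S_def)
  next
    case False
    then show ?thesis using H_space_zero_outside[OF newton_in_H_space] H_space_zero_outside[OF g(1)] by simp
  qed
  have co: "H_inner g (newton n) = c n" for n
  proof -
    have "\<forall>\<^sub>F N in sequentially. H_inner (S N) (newton n) = c n"
      using eventually_gt_at_top[of n] by eventually_elim (simp add: S_def[abs_def] H_inner_newton_sum)
    then have "(\<lambda>N. H_inner (S N) (newton n)) \<longlonglongrightarrow> c n" by (rule tendsto_eventually)
    from LIMSEQ_unique[OF inner[OF newton_in_H_space] this] show ?thesis .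
  qed
  have "(\<lambda>N. (\<Sum>n<N. (cmod (c n))\<^sup>2)) \<longlonglongrightarrow> (H_norm g)\<^sup>2"
  proof -
    have "(\<lambda>N. H_norm (S N) - H_norm g) \<longlonglongrightarrow> 0"
    proof (rule Lim_null_comparison[OF _ g(2)])
      show "\<forall>\<^sub>F N in sequentially. norm (H_norm (S N) - H_norm g) \<le> H_norm (\<lambda>z. S N z - g z)"
      proof (intro always_eventually allI)
        fix N
        have d: "(\<lambda>z. S N z - g z) \<in> H_space" by (intro H_space_diff S g)
        have neg: "(\<lambda>z. g z - S N z) \<in> H_space" by (intro H_space_diff S g)
        have "H_norm (S N) \<le> H_norm g + H_norm (\<lambda>z. g z - S N z)"
          using H_norm_triangle[OF g(1) neg] by simp
        moreover have "H_norm g \<le> H_norm (S N) + H_norm (\<lambda>z. S N z - g z)"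
          using H_norm_triangle[OF S d, of N] by simp
        ultimately show "norm (H_norm (S N) - H_norm g) \<le> H_norm (\<lambda>z. S N z - g z)"
          using H_norm_diff_commute[OF S g(1), of N] by simp
      qed
    qed
    then have "(\<lambda>N. H_norm (S N)) \<longlonglongrightarrow> H_norm g" by (rule LIM_zero_cancel)
    from tendsto_power[OF this, of 2] show ?thesis by (simp add: S_def[abs_def] H_norm_newton_sum)
  qed
  then have ns: "(\<lambda>n. (cmod (c n))\<^sup>2) sums (H_norm g)\<^sup>2" by (simp add: sums_def)
  show ?thesis using that[OF g(1) pt _ co ns] g(2) by (simp add: S_def)
qed

text \<open>
  The usual inequality, here from Cauchy--Schwarz: with \<open>q\<close> the sum of the first squared
  coefficients, pairing \<open>g\<close> with its partial sum gives \<open>q \<le> sqrt q * H_norm g\<close>.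
\<close>

lemma H_Bessel:
  assumes g: "g \<in> H_space"
  shows "summable (\<lambda>n. (cmod (H_inner g (newton n)))\<^sup>2)" "(\<Sum>n. (cmod (H_inner g (newton n)))\<^sup>2) \<le> (H_norm g)\<^sup>2"
proof -
  let ?c = "\<lambda>n. H_inner g (newton n)"
  have le: "(\<Sum>n<N. (cmod (?c n))\<^sup>2) \<le> (H_norm g)\<^sup>2" for N
  proof -
    let ?S = "\<lambda>z. \<Sum>n<N. ?c n * newton n z"
    let ?q = "\<Sum>n<N. (cmod (?c n))\<^sup>2"
    have S: "?S \<in> H_space" by (intro newton_sum_in_H_space) simp
    have "H_inner ?S g = (\<Sum>n<N. ?c n * H_inner (newton n) g)"
      by (rule H_inner_sum_left) (auto simp: newton_in_H_space g)
    also have "\<dots> = (\<Sum>n<N. ?c n * cnj (?c n))" using H_inner_commute[OF g newton_in_H_space] by simp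
    also have "\<dots> = of_real ?q" by (simp only: of_real_sum complex_norm_square)
    finally have "cmod (H_inner ?S g) = \<bar>?q\<bar>" by (simp only: norm_of_real)
    then have "?q \<le> H_norm ?S * H_norm g" using H_Cauchy_Schwarz[OF S g] by linarith
    then have "?q\<^sup>2 \<le> (H_norm ?S * H_norm g)\<^sup>2" by (rule power_mono) (simp add: sum_nonneg)
    also have "\<dots> = ?q * (H_norm g)\<^sup>2" by (simp add: power_mult_distrib H_norm_newton_sum)
    finally have "?q * ?q \<le> ?q * (H_norm g)\<^sup>2" by (simp add: power2_eq_square)
    moreover have "?q \<ge> 0" by (simp add: sum_nonneg)
    ultimately show ?thesis by (cases "?q = 0") auto
  qed
  show s: "summable (\<lambda>n. (cmod (?c n))\<^sup>2)"
    by (rule summableI_nonneg_bounded[where x="(H_norm g)\<^sup>2"]) (use le in auto)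
  show "(\<Sum>n. (cmod (?c n))\<^sup>2) \<le> (H_norm g)\<^sup>2" by (rule suminf_le_const[OF s le])
qed

section \<open>Completeness of the polynomials\<close>

lemma nn_integral_Beta:
  assumes "a > 0" "b > (0::real)"
  shows "(\<integral>\<^sup>+t. ennreal (indicator {0..1} t * (t powr (a - 1) * (1 - t) powr (b - 1))) \<partial>lborel) = ennreal (Beta a b)"
  by (rule nn_integral_has_integral_lebesgue[OF _ has_integral_Beta_real[OF assms]]) simp

text \<open>
  The case \<open>a = b = 1 - x\<close>, \<open>c = 2\<close> of Gauss's evaluation of \<open>2F1 (a, b; c; 1)\<close>. With
  \<open>c n = \<bar>(x - 1) gchoose n\<bar>\<close>, the number \<open>c n / (n + 1)\<close> is a multiple of the Beta integral of
  \<open>t powr (n - x) * (1 - t) powr x\<close>. Summing under the integral sign, where all terms are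
  nonnegative, with \<open>\<Sum>n. c n * t ^ n = (1 - t) powr (x - 1)\<close> leaves another Beta integral.
\<close>

lemma Gauss_hypergeometric_diagonal:
  fixes x :: real
  assumes x: "0 < x" "x < 1"
  shows "(\<lambda>n. ((x - 1) gchoose n)\<^sup>2 / real (Suc n)) sums (Gamma (2 * x) / (Gamma (1 + x))\<^sup>2)"
proof -
  let ?b = "\<lambda>n t. indicator {0..1} t * (t powr (real n + 1 - x - 1) * (1 - t) powr (1 + x - 1))"
  \<comment> \<open>the absolute values of the binomial coefficients, whose signs alternate\<close>
  define c where "c n = pochhammer (1 - x) n / fact n" for n
  have c0: "c n \<ge> 0" for n unfolding c_def using x by (intro divide_nonneg_nonneg pochhammer_nonneg) auto
  have cg: "(x - 1) gchoose n = (-1) ^ n * c n" for n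
    by (simp add: gbinomial_pochhammer c_def)
  have G: "Gamma (1 - x) > 0" "Gamma (1 + x) > 0" "Gamma (2 * x) > 0" using x by (auto intro: Gamma_real_pos)
  have B: "Beta (real n + 1 - x) (1 + x) = Gamma (1 - x) * Gamma (1 + x) * (c n / real (Suc n))" for n
  proof -
    have "1 - x \<notin> \<int>\<^sub>\<le>\<^sub>0" using x nonpos_Ints_nonpos[of "1 - x"] by auto
    then have "Gamma (real n + 1 - x) = pochhammer (1 - x) n * Gamma (1 - x)"
      using G by (simp add: pochhammer_Gamma algebra_simps)
    moreover have "Gamma (real n + 1 - x + (1 + x)) = fact (Suc n)" using Gamma_fact[of "Suc n", where 'a=real] by (simp add: algebra_simps)
    ultimately show ?thesis unfolding Beta_def c_def by (simp add: mult_ac)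
  qed
  have pt: "(\<Sum>n. ennreal (c n * ?b n t))
      = ennreal (indicator {0..1} t * (t powr (1 - x - 1) * (1 - t) powr (2 * x - 1)))" for t
  proof (cases "0 < t \<and> t < 1")
    case False
    then have "t \<notin> {0..1} \<or> t = 0 \<or> t = 1" by auto
    then show ?thesis using x by (auto simp: indicator_def)
  next
    case True
    have "(\<lambda>n. ((x - 1) gchoose n) * (-t) ^ n) sums (1 + (-t)) powr (x - 1)"
      using True by (intro gen_binomial_real) auto
    moreover have "((x - 1) gchoose n) * (-t) ^ n = c n * t ^ n" for n
    proof -
      have "((x - 1) gchoose n) * (-t) ^ n = c n * ((-1) ^ n * (-t) ^ n)" by (simp only: cg mult_ac)
      also have "(-1) ^ n * (-t) ^ n = t ^ n" using power_mult_distrib[of "-1" "-t" n] by simp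
      finally show ?thesis .
    qed
    ultimately have s: "(\<lambda>n. c n * t ^ n) sums (1 - t) powr (x - 1)" by simp
    have e: "c n * ?b n t
        = t powr (- x) * (1 - t) powr x * (c n * t ^ n)" for n
    proof -
      have "t powr (real n + 1 - x - 1) = t powr (real n) * t powr (- x)" by (simp add: powr_add[symmetric])
      then show ?thesis using True by (simp add: powr_realpow)
    qed
    have "(\<lambda>n. t powr (- x) * (1 - t) powr x * (c n * t ^ n)) sums (t powr (- x) * (1 - t) powr x * (1 - t) powr (x - 1))"
      by (rule sums_mult[OF s])
    moreover have "(1 - t) powr x * (1 - t) powr (x - 1) = (1 - t) powr (2 * x - 1)" by (simp add: powr_add[symmetric])
    ultimately have "(\<lambda>n. t powr (- x) * (1 - t) powr x * (c n * t ^ n)) sums (t powr (1 - x - 1) * (1 - t) powr (2 * x - 1))"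
      by (simp add: mult.assoc)
    moreover have "0 \<le> t powr (- x) * (1 - t) powr x * (c n * t ^ n)" for n using True c0[of n] by simp
    ultimately have "(\<Sum>n. ennreal (t powr (- x) * (1 - t) powr x * (c n * t ^ n))) = ennreal (t powr (1 - x - 1) * (1 - t) powr (2 * x - 1))"
      by (intro sums_unique[symmetric] sums_ennreal[THEN iffD2]) auto
    then show ?thesis unfolding e using True by simp
  qed
  have "ennreal (Beta (1 - x) (2 * x)) = (\<integral>\<^sup>+t. ennreal (indicator {0..1} t * (t powr (1 - x - 1) * (1 - t) powr (2 * x - 1))) \<partial>lborel)"
    by (rule nn_integral_Beta[symmetric]) (use x in auto)
  also have "\<dots> = (\<integral>\<^sup>+t. (\<Sum>n. ennreal (c n * ?b n t)) \<partial>lborel)"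
    by (simp only: pt)
  also have "\<dots> = (\<Sum>n. \<integral>\<^sup>+t. ennreal (c n * ?b n t) \<partial>lborel)"
    by (rule nn_integral_suminf) measurable
  also have "\<dots> = (\<Sum>n. ennreal (c n * Beta (real n + 1 - x) (1 + x)))"
  proof (rule suminf_cong)
    fix n
    have "(\<integral>\<^sup>+t. ennreal (c n * ?b n t) \<partial>lborel)
        = (\<integral>\<^sup>+t. ennreal (c n) * ennreal (?b n t) \<partial>lborel)"
      by (intro nn_integral_cong ennreal_mult) (auto simp: c0)
    also have "\<dots> = ennreal (c n) * (\<integral>\<^sup>+t. ennreal (?b n t) \<partial>lborel)"
      by (rule nn_integral_cmult) measurable
    also have "(\<integral>\<^sup>+t. ennreal (?b n t) \<partial>lborel) = ennreal (Beta (real n + 1 - x) (1 + x))"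
      by (rule nn_integral_Beta) (use x in auto)
    also have "ennreal (c n) * ennreal (Beta (real n + 1 - x) (1 + x)) = ennreal (c n * Beta (real n + 1 - x) (1 + x))"
      by (rule ennreal_mult[symmetric, OF c0]) (use G c0[of n] in \<open>simp add: B\<close>)
    finally show "(\<integral>\<^sup>+t. ennreal (c n * ?b n t) \<partial>lborel)
        = ennreal (c n * Beta (real n + 1 - x) (1 + x))" .
  qed
  finally have eq: "(\<Sum>n. ennreal (c n * Beta (real n + 1 - x) (1 + x))) = ennreal (Beta (1 - x) (2 * x))" ..
  let ?d = "Gamma (1 - x) * Gamma (1 + x)"
  have nn: "0 \<le> c n * Beta (real n + 1 - x) (1 + x)" for n using G c0[of n] by (simp add: B)
  have B0: "Beta (1 - x) (2 * x) = Gamma (1 - x) * Gamma (2 * x) / Gamma (1 + x)"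
  proof -
    have "1 - x + 2 * x = 1 + x" by simp
    then show ?thesis unfolding Beta_def by (simp only:)
  qed
  have B0': "0 \<le> Beta (1 - x) (2 * x)" unfolding B0 using G by simp
  have "(\<lambda>n. ennreal (c n * Beta (real n + 1 - x) (1 + x))) sums ennreal (Beta (1 - x) (2 * x))"
    unfolding eq[symmetric] by (rule summable_sums) simp
  then have "(\<lambda>n. c n * Beta (real n + 1 - x) (1 + x)) sums Beta (1 - x) (2 * x)"
    by (rule sums_ennreal[THEN iffD1, OF nn B0'])
  from sums_divide[OF this, of ?d]
  have "(\<lambda>n. c n * Beta (real n + 1 - x) (1 + x) / ?d) sums (Beta (1 - x) (2 * x) / ?d)" .
  moreover have "c n * Beta (real n + 1 - x) (1 + x) / ?d = c n * (c n / real (Suc n))" for n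
  proof -
    have "b * (a * e) / a = b * e" if "a \<noteq> 0" for a b e :: real using that by simp
    moreover have "?d \<noteq> 0" using G by simp
    ultimately show ?thesis unfolding B by blast
  qed
  ultimately have "(\<lambda>n. c n * (c n / real (Suc n))) sums (Beta (1 - x) (2 * x) / ?d)" by (simp only:)
  moreover have "Beta (1 - x) (2 * x) / ?d = Gamma (2 * x) / (Gamma (1 + x))\<^sup>2"
  proof -
    have "a * b / c / (a * c) = b / (c * c)" if "a \<noteq> 0" for a b c :: real using that by simp
    moreover have "Gamma (1 - x) \<noteq> 0" using G by simp
    ultimately show ?thesis unfolding B0 power2_eq_square by blast
  qed
  moreover have "((x - 1) gchoose n)\<^sup>2 / real (Suc n) = c n * (c n / real (Suc n))" for n
  proof -
    have "((-1) ^ n * c n)\<^sup>2 = c n * c n" by (simp add: power_mult_distrib) (simp add: power2_eq_square)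
    then show ?thesis unfolding cg by simp
  qed
  ultimately show ?thesis by simp
qed

text \<open>
  The coefficients of the kernel with respect to \<open>newton\<close> are the conjugates of \<open>newton n x\<close>, and the
  squared norm of the kernel is its value on the diagonal. So the Parseval identity is Gauss's
  formula divided by \<open>2 * pi\<close>.
\<close>

lemma newton_Parseval_kernel:
  assumes x: "0 < x" "x < 1"
  shows "(\<lambda>n. (cmod (newton n (of_real x)))\<^sup>2) sums (H_norm (mellin_kernel (of_real x)))\<^sup>2"
proof -
  have n: "(cmod (newton n (of_real x)))\<^sup>2 = ((x - 1) gchoose n)\<^sup>2 / real (Suc n) / (2 * pi)" for n
  proof -
    have "newton n (of_real x) = of_real (((x - 1) gchoose n) / newton_const n)"
    proof -
      have "(complex_of_real x - 1) gchoose n = of_real ((x - 1) gchoose n)" unfolding gbinomial_prod_rev by simp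
      then show ?thesis using x newton_eq[of "of_real x" n] by simp
    qed
    then have "(cmod (newton n (of_real x)))\<^sup>2 = ((x - 1) gchoose n)\<^sup>2 / (newton_const n)\<^sup>2"
      by (simp only: norm_of_real power_divide abs_divide power2_abs)
    then show ?thesis by (simp only: newton_const_sq) (simp del: of_nat_Suc)
  qed
  have g: "Gamma (1 + complex_of_real x) = of_real (Gamma (1 + x))" using Gamma_complex_of_real[of "1 + x"] by simp
  have "(H_norm (mellin_kernel (of_real x)))\<^sup>2 = Re (mellin_kernel (of_real x) (of_real x))"
    using x by (intro kernel_norm_sq) simp
  also have "mellin_kernel (of_real x) (of_real x) = of_real (Gamma (2 * x) / (Gamma (1 + x))\<^sup>2 / (2 * pi))"
  proof -
    have G2: "Gamma (complex_of_real x + cnj (of_real x)) = of_real (Gamma (2 * x))"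
      using Gamma_complex_of_real[of "2 * x"] by simp
    have g': "Gamma (1 + cnj (complex_of_real x)) = of_real (Gamma (1 + x))" using g by simp
    have "mellin_kernel (of_real x) (of_real x) = 1 / (2 * of_real pi) * (of_real (Gamma (2 * x)) / (of_real (Gamma (1 + x)) * of_real (Gamma (1 + x))))"
      using x unfolding mellin_kernel_def G2 g g' zero_ext_def by (simp add: right_half_plane_def)
    then show ?thesis by (simp add: power2_eq_square)
  qed
  finally show ?thesis using sums_divide[OF Gauss_hypergeometric_diagonal[OF x], of "2 * pi"] by (simp only: n Re_complex_of_real)
qed

lemma H_inner_series_orthogonal:
  assumes g: "g \<in> H_space" "\<And>n. H_inner g (newton n) = 0" and h: "h \<in> H_space"
    and lim: "(\<lambda>N. H_norm (\<lambda>z. (\<Sum>n<N. c n * newton n z) - h z)) \<longlonglongrightarrow> 0"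
  shows "H_inner h g = 0"
proof -
  have "norm (H_inner h g) \<le> H_norm (\<lambda>z. (\<Sum>n<N. c n * newton n z) - h z) * H_norm g" for N
  proof -
    let ?S = "\<lambda>z. \<Sum>n<N. c n * newton n z"
    have S: "?S \<in> H_space" by (intro newton_sum_in_H_space) simp
    have "H_inner ?S g = (\<Sum>n<N. c n * H_inner (newton n) g)" by (rule H_inner_sum_left) (auto simp: newton_in_H_space g)
    also have "\<dots> = 0" using H_inner_commute[OF g(1) newton_in_H_space] g(2) by simp
    finally have "H_inner (\<lambda>z. ?S z - h z) g = - H_inner h g" using H_inner_diff_left[OF S h g(1)] by simp
    then show ?thesis using H_Cauchy_Schwarz[OF H_space_diff[OF S h] g(1)] by simp
  qed
  moreover have "(\<lambda>N. H_norm (\<lambda>z. (\<Sum>n<N. c n * newton n z) - h z) * H_norm g) \<longlonglongrightarrow> 0"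
    by (rule tendsto_mult_left_zero[OF lim])
  ultimately have "norm (H_inner h g) \<le> 0" by (intro tendsto_lowerbound[where F=sequentially]) auto
  then show ?thesis by simp
qed

text \<open>
  The Newton expansion of the kernel at \<open>0 < x < 1\<close> has an orthogonal defect \<open>d\<close>, and by
  \<open>newton_Parseval_kernel\<close> the norm of \<open>d\<close> is \<open>0\<close>. So \<open>g x\<close>, the inner product of \<open>g\<close> with this
  kernel, is a limit of combinations of the inner products with \<open>newton n\<close>, that is, \<open>0\<close>.
\<close>

lemma newton_complete:
  assumes g: "g \<in> H_space" "\<And>n. H_inner g (newton n) = 0"
  shows "g = (\<lambda>z. 0)"
proof -
  have gx: "g (of_real x) = 0" if x: "0 < x" "x < 1" for x :: real
  proof -
    let ?K = "mellin_kernel (of_real x)"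
    have K: "?K \<in> H_space" using x by (intro kernel_in_H_space) simp
    have c: "H_inner ?K (newton n) = cnj (newton n (of_real x))" for n
      using H_inner_commute[OF newton_in_H_space K, of n] H_inner_kernel[OF newton_in_H_space, of "of_real x" n] x by simp
    have s: "summable (\<lambda>n. (cmod (H_inner ?K (newton n)))\<^sup>2)" using H_Bessel(1)[OF K] .
    obtain h where h0: "h \<in> H_space" "\<And>z. (\<lambda>n. H_inner ?K (newton n) * newton n z) sums h z"
      "(\<lambda>N. H_norm (\<lambda>z. (\<Sum>n<N. H_inner ?K (newton n) * newton n z) - h z)) \<longlonglongrightarrow> 0"
      "\<And>n. H_inner h (newton n) = H_inner ?K (newton n)" "(\<lambda>n. (cmod (H_inner ?K (newton n)))\<^sup>2) sums (H_norm h)\<^sup>2"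
      by (rule newton_series_converges[OF s]) (rule that)
    note h = h0(1,3,4,5)
    have hK: "(H_norm h)\<^sup>2 = (H_norm ?K)\<^sup>2"
      using sums_unique2[OF h(4)] newton_Parseval_kernel[OF x] by (simp add: c)
    define d where "d = (\<lambda>z. ?K z - h z)"
    have d: "d \<in> H_space" unfolding d_def by (intro H_space_diff K h)
    have "H_inner d (newton n) = 0" for n
      unfolding d_def using H_inner_diff_left[OF K h(1) newton_in_H_space] h(3) by simp
    from H_inner_series_orthogonal[OF d this h(1,2)] have hd: "H_inner h d = 0" .
    have "H_inner h ?K = H_inner h d + H_inner h h"
      using H_inner_lincomb_right[OF d h(1) h(1), of 1 1] by (simp add: d_def)
    then have 1: "H_inner h ?K = of_real ((H_norm ?K)\<^sup>2)" using hd H_inner_self[OF h(1)] hK by simp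
    have "H_inner d d = H_inner ?K d - H_inner h d" unfolding d_def by (rule H_inner_diff_left[OF K h(1) d[unfolded d_def]])
    also have "H_inner ?K d = H_inner ?K ?K - H_inner ?K h"
      using H_inner_lincomb_right[OF K h(1) K, of 1 "-1"] by (simp add: d_def)
    also have "H_inner ?K h = of_real ((H_norm ?K)\<^sup>2)" using H_inner_commute[OF h(1) K] 1 by simp
    finally have "H_inner d d = 0" using hd H_inner_self[OF K] by simp
    then have "H_norm d = 0" using H_inner_self[OF d] by simp
    from H_norm_eq_0[OF d this] have "?K = h" by (simp add: d_def fun_eq_iff)
    then have "H_inner ?K g = 0" using H_inner_series_orthogonal[OF g h(1,2)] by simp
    then have "H_inner g ?K = 0" using H_inner_commute[OF K g(1)] by simp
    then show ?thesis using H_inner_kernel[OF g(1), of "of_real x"] x by simp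
  qed
  have "g z = 0" if z: "z \<in> RHP" for z
  proof (rule analytic_continuation[OF _ open_RHP, of g "of_real ` {0<..<1}" "1/2" z])
    show "g holomorphic_on RHP" using H_space_holo[OF g(1)] by (simp add: holo_space_def)
    show "connected RHP" unfolding right_half_plane_def by (intro convex_connected convex_halfspace_Re_gt)
    show "of_real ` {0<..<1} \<subseteq> RHP" "1/2 \<in> RHP" by (auto simp: right_half_plane_def)
    show "(1/2 :: complex) islimpt of_real ` {0<..<1}"
      unfolding islimpt_approachable
    proof (intro allI impI)
      fix e :: real assume e: "e > 0"
      define r where "r = min (e / 2) (1 / 4)"
      have r: "0 < r" "r < e" "r < 1/2" using e by (auto simp: r_def)
      have "dist (complex_of_real (1/2 + r)) (1/2) = r" using r by (simp add: dist_norm)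
      then show "\<exists>x'\<in>complex_of_real ` {0<..<1}. x' \<noteq> 1 / 2 \<and> dist x' (1 / 2) < e"
        using r by (intro bexI[of _ "complex_of_real (1/2 + r)"] imageI conjI) (auto simp: complex_eq_iff)
    qed
  qed (use gx z in auto)
  then show ?thesis using H_space_zero_outside[OF g(1)] by (auto simp: right_half_plane_def fun_eq_iff)
qed

lemma newton_expansion:
  assumes g: "g \<in> H_space"
  shows "\<And>z. (\<lambda>n. H_inner g (newton n) * newton n z) sums g z"
    "(\<lambda>N. H_norm (\<lambda>z. (\<Sum>n<N. H_inner g (newton n) * newton n z) - g z)) \<longlonglongrightarrow> 0"
    "(\<lambda>n. (cmod (H_inner g (newton n)))\<^sup>2) sums (H_norm g)\<^sup>2"
proof -
  obtain h where h: "h \<in> H_space" "\<And>z. (\<lambda>n. H_inner g (newton n) * newton n z) sums h z"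
    "(\<lambda>N. H_norm (\<lambda>z. (\<Sum>n<N. H_inner g (newton n) * newton n z) - h z)) \<longlonglongrightarrow> 0"
    "\<And>n. H_inner h (newton n) = H_inner g (newton n)" "(\<lambda>n. (cmod (H_inner g (newton n)))\<^sup>2) sums (H_norm h)\<^sup>2"
    by (rule newton_series_converges[OF H_Bessel(1)[OF g]]) (rule that)
  have "(\<lambda>z. g z - h z) = (\<lambda>z. 0)"
    by (rule newton_complete[OF H_space_diff[OF g h(1)]]) (simp add: H_inner_diff_left g h newton_in_H_space)
  then have hg: "h = g" by (simp add: fun_eq_iff)
  show "\<And>z. (\<lambda>n. H_inner g (newton n) * newton n z) sums g z" using h(2) unfolding hg .
  show "(\<lambda>N. H_norm (\<lambda>z. (\<Sum>n<N. H_inner g (newton n) * newton n z) - g z)) \<longlonglongrightarrow> 0" using h(3) unfolding hg .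
  show "(\<lambda>n. (cmod (H_inner g (newton n)))\<^sup>2) sums (H_norm g)\<^sup>2" using h(5) unfolding hg .
qed

section \<open>The Bergman space of the disc\<close>

lemma nn_integral_translate:
  fixes t :: complex
  assumes F: "F \<in> borel_measurable borel"
  shows "(\<integral>\<^sup>+x. F (t + x) \<partial>lborel) = (\<integral>\<^sup>+x. F x \<partial>lborel)"
  using nn_integral_distr[of "(+) t" lborel borel F] F by (simp add: lborel_distr_plus)

text \<open>
  Translation-invariant measures are unique up to a factor: multiplying by the mass of the unit ball,
  and applying Tonelli's theorem and translations in each variable, exchanges the rotated and the
  original integral. The factor is \<open>1\<close> because the unit ball is invariant.
\<close>

lemma nn_integral_rotate:
  fixes c :: complex
  assumes c: "cmod c = 1" and F[measurable]: "F \<in> borel_measurable borel"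
  shows "(\<integral>\<^sup>+x. F (c * x) \<partial>lborel) = (\<integral>\<^sup>+x. F x \<partial>lborel)"
proof -
  have c0: "c \<noteq> 0" using c by auto
  define U where "U = (indicator (ball 0 1) :: complex \<Rightarrow> ennreal)"
  have U[measurable]: "U \<in> borel_measurable borel" unfolding U_def by (rule borel_measurable_indicator) simp
  have Uc: "U (- (c * x)) = U x" for x unfolding U_def using c by (simp add: indicator_def norm_mult)
  let ?A = "\<integral>\<^sup>+x. F (c * x) \<partial>lborel" and ?L = "\<integral>\<^sup>+x. F x \<partial>lborel" and ?U = "\<integral>\<^sup>+x. U x \<partial>lborel"
  have "?A * ?U = (\<integral>\<^sup>+x. (\<integral>\<^sup>+y. F (c * x) * U y \<partial>lborel) \<partial>lborel)"
    by (simp add: nn_integral_cmult nn_integral_multc)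
  also have "\<dots> = (\<integral>\<^sup>+x. (\<integral>\<^sup>+y. F (c * x) * U (- (c * x) + y) \<partial>lborel) \<partial>lborel)"
    by (intro nn_integral_cong nn_integral_translate[symmetric]) measurable
  also have "\<dots> = (\<integral>\<^sup>+y. (\<integral>\<^sup>+x. F (c * x) * U (- (c * x) + y) \<partial>lborel) \<partial>lborel)"
    by (rule lborel_pair.Fubini'[symmetric]) measurable
  also have "\<dots> = (\<integral>\<^sup>+y. (\<integral>\<^sup>+x. F (c * x + y) * U x \<partial>lborel) \<partial>lborel)"
  proof (rule nn_integral_cong)
    fix y :: complex
    have "(\<integral>\<^sup>+x. F (c * x) * U (- (c * x) + y) \<partial>lborel) = (\<integral>\<^sup>+x. F (c * (y / c + x)) * U (- (c * (y / c + x)) + y) \<partial>lborel)"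
      using nn_integral_translate[of "\<lambda>x. F (c * x) * U (- (c * x) + y)" "y / c"] by simp
    also have "\<dots> = (\<integral>\<^sup>+x. F (c * x + y) * U x \<partial>lborel)"
      using c0 Uc by (intro nn_integral_cong) (simp add: distrib_left add.commute)
    finally show "(\<integral>\<^sup>+x. F (c * x) * U (- (c * x) + y) \<partial>lborel) = (\<integral>\<^sup>+x. F (c * x + y) * U x \<partial>lborel)" .
  qed
  also have "\<dots> = (\<integral>\<^sup>+x. (\<integral>\<^sup>+y. F (c * x + y) * U x \<partial>lborel) \<partial>lborel)"
    by (rule lborel_pair.Fubini') measurable
  also have "\<dots> = (\<integral>\<^sup>+x. ?L * U x \<partial>lborel)"
    by (intro nn_integral_cong) (simp add: nn_integral_multc nn_integral_translate)
  also have "\<dots> = ?L * ?U" by (simp add: nn_integral_cmult)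
  finally have eq: "?A * ?U = ?L * ?U" .
  have "?U = emeasure lborel (ball (0::complex) 1)" by (simp add: U_def)
  also have "\<dots> = ennreal pi" by (simp add: emeasure_ball unit_ball_vol_2)
  finally show ?thesis using eq pi_gt_zero by (simp add: mult.commute[of _ "ennreal pi"] ennreal_mult_cancel_left)
qed

lemma lborel_rotate:
  fixes c :: complex
  assumes "cmod c = 1"
  shows "distr lborel borel ((*) c) = lborel"
proof (rule measure_eqI)
  fix A :: "complex set" assume "A \<in> sets (distr lborel borel ((*) c))"
  then have A[measurable]: "A \<in> sets borel" by simp
  have m: "(*) c \<in> borel_measurable borel" by measurable
  have "emeasure (distr lborel borel ((*) c)) A = (\<integral>\<^sup>+x. indicator A x \<partial>distr lborel borel ((*) c))" by simp
  also have "\<dots> = (\<integral>\<^sup>+x. indicator A (c * x) \<partial>lborel)" by (rule nn_integral_distr) (use m in measurable)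
  also have "\<dots> = (\<integral>\<^sup>+x. indicator A x \<partial>lborel)" by (rule nn_integral_rotate[OF assms]) measurable
  finally show "emeasure (distr lborel borel ((*) c)) A = emeasure lborel A" by simp
qed simp

abbreviation disc_measure :: "real \<Rightarrow> complex measure" where
  "disc_measure r \<equiv> restrict_space lborel (ball 0 r)"

lemma disc_measure_integral:
  fixes f :: "complex \<Rightarrow> 'a::{banach, second_countable_topology}"
  shows "(LINT x|disc_measure r. f x) = (LINT x|lborel. indicator (ball 0 r) x *\<^sub>R f x)"
  by (subst integral_restrict_space) (simp_all add: set_lebesgue_integral_def)

lemma disc_measure_nn_integral:
  "(\<integral>\<^sup>+x. f x \<partial>disc_measure r) = (\<integral>\<^sup>+x. f x * indicator (ball 0 r) x \<partial>lborel)"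
  by (rule nn_integral_restrict_space) simp

lemma emeasure_disc: "r \<ge> 0 \<Longrightarrow> emeasure lborel (ball (0::complex) r) = ennreal (pi * r\<^sup>2)"
  by (simp add: emeasure_ball unit_ball_vol_2)

lemma disc_bounded_L2:
  assumes m: "u \<in> borel_measurable borel" and le: "\<And>x. x \<in> ball 0 r \<Longrightarrow> cmod (u x) \<le> C" and r: "r \<ge> 0" and C: "C \<ge> 0"
  shows "u \<in> L2 (disc_measure r)" "norm_sq (disc_measure r) u \<le> C\<^sup>2 * (pi * r\<^sup>2)"
proof -
  have m': "u \<in> borel_measurable (disc_measure r)" using m by (intro measurable_restrict_space1) simp
  have "(\<integral>\<^sup>+x. ennreal ((cmod (u x))\<^sup>2) \<partial>disc_measure r) \<le> (\<integral>\<^sup>+x. ennreal (C\<^sup>2) * indicator (ball (0::complex) r) x \<partial>lborel)"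
    unfolding disc_measure_nn_integral
    by (rule nn_integral_mono) (auto simp: indicator_def intro!: ennreal_leI power_mono le)
  also have "\<dots> = ennreal (C\<^sup>2) * emeasure lborel (ball (0::complex) r)" by (rule nn_integral_cmult_indicator) simp
  also have "\<dots> = ennreal (C\<^sup>2 * (pi * r\<^sup>2))" using r by (simp add: emeasure_disc ennreal_mult)
  finally have *: "(\<integral>\<^sup>+x. ennreal ((cmod (u x))\<^sup>2) \<partial>disc_measure r) \<le> ennreal (C\<^sup>2 * (pi * r\<^sup>2))" .
  show L: "u \<in> L2 (disc_measure r)" by (rule L2I_nn_integral[OF m']) (use * in \<open>simp add: le_less_trans\<close>)
  show "norm_sq (disc_measure r) u \<le> C\<^sup>2 * (pi * r\<^sup>2)" by (rule norm_sq_le_nn_integral[OF L *]) simp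
qed

lemma disc_monomial_L2: "0 \<le> r \<Longrightarrow> (\<lambda>x. x ^ n) \<in> L2 (disc_measure r)"
  by (rule disc_bounded_L2(1)[where C="r ^ n"]) (auto simp: norm_power power_mono)

text \<open>
  The rotation by \<open>pi / (m - n)\<close> changes the sign of the integrand.
\<close>

lemma disc_monomial_orthogonal:
  assumes "m \<noteq> n"
  shows "L2_inner (disc_measure r) (\<lambda>x. x ^ m) (\<lambda>x. x ^ n) = 0"
proof -
  define \<theta> where "\<theta> = pi / (real m - real n)"
  define c where "c = cis \<theta>"
  have c: "cmod c = 1" by (simp add: c_def)
  have cc: "c ^ m * cnj (c ^ n) = -1"
  proof -
    have "c ^ m * cnj (c ^ n) = cis ((real m - real n) * \<theta>)" 
    proof -
      have "c ^ m = cis (real m * \<theta>)" unfolding c_def by (rule Complex.DeMoivre)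
      moreover have "cnj (c ^ n) = cis (- (real n * \<theta>))"
        by (simp only: c_def Complex.DeMoivre cis_cnj)
      ultimately show ?thesis by (simp only: cis_mult) (simp add: left_diff_distrib)
    qed
    also have "(real m - real n) * \<theta> = pi" using assms by (simp add: \<theta>_def)
    finally show ?thesis by simp
  qed
  define F where "F x = indicator (ball 0 r) x *\<^sub>R (x ^ m * cnj (x ^ n))" for x :: complex
  have [measurable]: "ball (0::complex) r \<in> sets borel" by simp
  have cnjm[measurable]: "cnj \<in> borel_measurable borel" by (intro borel_measurable_continuous_onI continuous_on_cnj continuous_on_id)
  have Fm: "F \<in> borel_measurable borel" unfolding F_def[abs_def] by measurable
  have "F (c * x) = - F x" for x
  proof -
    have "F (c * x) = indicator (ball 0 r) x *\<^sub>R ((c ^ m * cnj (c ^ n)) * (x ^ m * cnj (x ^ n)))"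
      using c by (simp add: F_def indicator_def norm_mult power_mult_distrib)
    then show ?thesis unfolding cc by (simp add: F_def)
  qed
  moreover have "(LINT x|lborel. F x) = (LINT x|lborel. F (c * x))"
    using integral_distr[of "(*) c" lborel borel F] Fm lborel_rotate[OF c] by simp
  ultimately have "(LINT x|lborel. F x) = - (LINT x|lborel. F x)" by simp
  then have "(LINT x|lborel. F x) = 0" by simp
  then show ?thesis unfolding L2_inner_def disc_measure_integral F_def by simp
qed

lemma nn_integral_power_Icc:
  assumes "0 \<le> b" "n > 0"
  shows "(\<integral>\<^sup>+t. ennreal (real n * t ^ (n - 1)) * indicator {0..b} t \<partial>lborel) = ennreal (b ^ n)"
proof -
  have "(\<integral>\<^sup>+t. ennreal (real n * t ^ (n - 1)) * indicator {0..b} t \<partial>lborel) = ennreal (b ^ n - 0 ^ n)"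
    by (rule nn_integral_FTC_Icc) (use assms in \<open>auto intro!: derivative_eq_intros\<close>)
  then show ?thesis using assms by simp
qed

text \<open>
  Write \<open>|x| ^ (2 * n)\<close> as the integral of \<open>2 * n * t ^ (2 * n - 1)\<close> over \<open>0 \<le> t \<le> |x|\<close> and exchange the
  integrals; the inner one becomes the area of an annulus.
\<close>

lemma disc_monomial_norm_sq:
  assumes r: "0 \<le> r"
  shows "norm_sq (disc_measure r) (\<lambda>x. x ^ n) = pi * r ^ (2 * n + 2) / real (n + 1)"
proof -
  have [measurable]: "ball (0::complex) r \<in> sets borel" by simp
  let ?I = "\<integral>\<^sup>+x. ennreal ((cmod (x ^ n))\<^sup>2) \<partial>disc_measure r"
  have "?I = ennreal (pi * r ^ (2 * n + 2) / real (n + 1))"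
  proof (cases "n = 0")
    case True
    then show ?thesis using r by (simp add: emeasure_restrict_space emeasure_disc power2_eq_square)
  next
    case n: False
    let ?p = "\<lambda>t. ennreal (real (2 * n) * t ^ (2 * n - 1))"
    have "?I = (\<integral>\<^sup>+x. (\<integral>\<^sup>+t. ?p t * indicator {0..cmod x} t * indicator (ball 0 r) x \<partial>lborel) \<partial>lborel)"
      unfolding disc_measure_nn_integral
    proof (rule nn_integral_cong)
      fix x :: complex
      have "(cmod (x ^ n))\<^sup>2 = cmod x ^ (2 * n)" by (simp add: norm_power power_mult[symmetric] mult.commute)
      then show "ennreal ((cmod (x ^ n))\<^sup>2) * indicator (ball 0 r) x = (\<integral>\<^sup>+t. ?p t * indicator {0..cmod x} t * indicator (ball 0 r) x \<partial>lborel)"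
        using nn_integral_power_Icc[of "cmod x" "2 * n"] n by (subst nn_integral_multc) auto
    qed
    also have "\<dots> = (\<integral>\<^sup>+t. (\<integral>\<^sup>+x. ?p t * indicator {0..cmod x} t * indicator (ball 0 r) x \<partial>lborel) \<partial>lborel)"
      by (rule lborel_pair.Fubini'[symmetric]) (simp add: indicator_def, measurable)
    also have "\<dots> = (\<integral>\<^sup>+t. ennreal (real (2 * n) * t ^ (2 * n - 1) * (pi * (r\<^sup>2 - t\<^sup>2))) * indicator {0..r} t \<partial>lborel)"
    proof (rule nn_integral_cong)
      fix t :: real
      show "(\<integral>\<^sup>+x. ?p t * indicator {0..cmod x} t * indicator (ball 0 r) x \<partial>lborel)
          = ennreal (real (2 * n) * t ^ (2 * n - 1) * (pi * (r\<^sup>2 - t\<^sup>2))) * indicator {0..r} t"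
      proof (cases "0 \<le> t \<and> t \<le> r")
        case True
        have "(\<integral>\<^sup>+x. ?p t * indicator {0..cmod x} t * indicator (ball 0 r) x \<partial>lborel) = (\<integral>\<^sup>+x. ?p t * indicator (ball 0 r - ball (0::complex) t) x \<partial>lborel)"
          using True by (intro nn_integral_cong) (auto simp: indicator_def)
        also have "\<dots> = ?p t * emeasure lborel (ball 0 r - ball (0::complex) t)" by (rule nn_integral_cmult_indicator) simp
        also have "emeasure lborel (ball 0 r - ball (0::complex) t) = emeasure lborel (ball (0::complex) r) - emeasure lborel (ball (0::complex) t)"
          using True by (intro emeasure_Diff) (auto simp: emeasure_disc)
        also have "\<dots> = ennreal (pi * (r\<^sup>2 - t\<^sup>2))" using True by (simp add: emeasure_disc ennreal_minus right_diff_distrib)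
        finally show ?thesis using True by (simp add: ennreal_mult power_mono)
      next
        case False
        then have "(\<integral>\<^sup>+x. ?p t * indicator {0..cmod x} t * indicator (ball 0 r) x \<partial>lborel) = (\<integral>\<^sup>+(x::complex). 0 \<partial>lborel)"
          by (intro nn_integral_cong) (auto simp: indicator_def)
        then show ?thesis using False by auto
      qed
    qed
    also have "\<dots> = ennreal (pi * (r\<^sup>2 * r ^ (2 * n) - (real n / real (n + 1)) * r ^ (2 * n + 2)) - pi * (r\<^sup>2 * 0 ^ (2 * n) - (real n / real (n + 1)) * 0 ^ (2 * n + 2)))"
    proof (rule nn_integral_FTC_Icc[where a=0 and b=r and F="\<lambda>t. pi * (r\<^sup>2 * t ^ (2 * n) - (real n / real (n + 1)) * t ^ (2 * n + 2))"])
      fix t :: real assume "t \<in> {0..r}"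
      then have t: "0 \<le> t" "t \<le> r" by auto
      define k where "k = real n / real (n + 1)"
      define p where "p = t ^ (2 * n - 1)"
      have kM: "k * real (2 * n + 2) = real (2 * n)" by (simp add: k_def field_simps)
      have tp: "t ^ (2 * n + 1) = p * t\<^sup>2" using n by (simp add: p_def power_add[symmetric])
      have "((\<lambda>t. pi * (r\<^sup>2 * t ^ (2 * n) - k * t ^ (2 * n + 2))) has_real_derivative
          pi * (r\<^sup>2 * (real (2 * n) * p) - k * (real (2 * n + 2) * t ^ (2 * n + 1)))) (at t)"
        unfolding p_def using DERIV_pow[of "2 * n" t UNIV] DERIV_pow[of "2 * n + 2" t UNIV]
        by (intro DERIV_cmult DERIV_diff) simp_all
      also have "pi * (r\<^sup>2 * (real (2 * n) * p) - k * (real (2 * n + 2) * t ^ (2 * n + 1))) = real (2 * n) * p * (pi * (r\<^sup>2 - t\<^sup>2))"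
        unfolding tp kM[symmetric] by (simp only: right_diff_distrib mult_ac)
      finally show "((\<lambda>t. pi * (r\<^sup>2 * t ^ (2 * n) - (real n / real (n + 1)) * t ^ (2 * n + 2))) has_real_derivative
          real (2 * n) * t ^ (2 * n - 1) * (pi * (r\<^sup>2 - t\<^sup>2))) (at t)" unfolding k_def p_def .
      show "0 \<le> real (2 * n) * t ^ (2 * n - 1) * (pi * (r\<^sup>2 - t\<^sup>2))" using t by (auto intro!: mult_nonneg_nonneg power_mono)
    qed (use r in auto)
    also have "pi * (r\<^sup>2 * r ^ (2 * n) - (real n / real (n + 1)) * r ^ (2 * n + 2)) - pi * (r\<^sup>2 * 0 ^ (2 * n) - (real n / real (n + 1)) * 0 ^ (2 * n + 2))
        = pi * r ^ (2 * n + 2) / real (n + 1)"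
    proof -
      have A: "pi * (X - (real n / real (n + 1)) * X) = pi * X / real (n + 1)" for X by (simp add: field_simps)
      have R: "r\<^sup>2 * r ^ (2 * n) = r ^ (2 * n + 2)" by (simp only: power_add mult.commute)
      have Z: "(0::real) ^ (2 * n) = 0" "(0::real) ^ (2 * n + 2) = 0" using n by auto
      show ?thesis unfolding R Z A by simp
    qed
    finally show ?thesis .
  qed
  then have "ennreal (norm_sq (disc_measure r) (\<lambda>x. x ^ n)) = ennreal (pi * r ^ (2 * n + 2) / real (n + 1))"
    using nn_integral_norm_sq[OF disc_monomial_L2[OF r, of n]] by simp
  then show ?thesis using r by (subst (asm) ennreal_inj) auto
qed

text \<open>
  Pythagoras for the orthogonal monomials.
\<close>

lemma disc_polynomial_norm_sq:
  assumes r: "0 \<le> r"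
  shows "(\<lambda>x. \<Sum>n<N. a n * x ^ n) \<in> L2 (disc_measure r)"
    "norm_sq (disc_measure r) (\<lambda>x. \<Sum>n<N. a n * x ^ n) = (\<Sum>n<N. (cmod (a n))\<^sup>2 * (pi * r ^ (2 * n + 2) / real (n + 1)))"
proof -
  let ?M = "disc_measure r"
  let ?S = "\<lambda>N x. \<Sum>n<N. a n * x ^ n"
  have e: "?S (Suc N) = (\<lambda>x. 1 * ?S N x + a N * x ^ N)" for N by simp
  have L: "?S N \<in> L2 ?M" for N
  proof (induction N)
    case 0 then show ?case using L2_mult_left[OF disc_monomial_L2[OF r, of 0], of 0] by simp
  next
    case (Suc N) show ?case unfolding e by (intro L2_lincomb Suc disc_monomial_L2 r)
  qed
  show "?S N \<in> L2 ?M" by (rule L)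
  have in1: "L2_inner ?M (?S N) (\<lambda>x. x ^ m) = (if m < N then a m * of_real (pi * r ^ (2 * m + 2) / real (m + 1)) else 0)" for N m
  proof (induction N)
    case 0 then show ?case by (simp add: L2_inner_def)
  next
    case (Suc N)
    have "L2_inner ?M (?S (Suc N)) (\<lambda>x. x ^ m) = 1 * L2_inner ?M (?S N) (\<lambda>x. x ^ m) + a N * L2_inner ?M (\<lambda>x. x ^ N) (\<lambda>x. x ^ m)"
      unfolding e by (rule L2_inner_lincomb_left) (intro L disc_monomial_L2 r)+
    then show ?case using Suc disc_monomial_orthogonal[of N m r] L2_inner_self[of ?M "\<lambda>x. x ^ N"] disc_monomial_norm_sq[OF r, of N]
      by (cases "m = N") auto
  qed
  have in2: "L2_inner ?M (?S K) v = (\<Sum>n<K. a n * L2_inner ?M (\<lambda>x. x ^ n) v)" if v: "v \<in> L2 ?M" for K v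
  proof (induction K)
    case 0 then show ?case by (simp add: L2_inner_def)
  next
    case (Suc K)
    have "L2_inner ?M (?S (Suc K)) v = 1 * L2_inner ?M (?S K) v + a K * L2_inner ?M (\<lambda>x. x ^ K) v"
      unfolding e by (rule L2_inner_lincomb_left) (intro L disc_monomial_L2 r v)+
    then show ?case using Suc by simp
  qed
  have "complex_of_real (norm_sq ?M (?S N)) = (\<Sum>n<N. a n * L2_inner ?M (\<lambda>x. x ^ n) (?S N))"
    using in2[OF L, of N N] L2_inner_self[of ?M "?S N"] by simp
  also have "\<dots> = (\<Sum>n<N. of_real ((cmod (a n))\<^sup>2 * (pi * r ^ (2 * n + 2) / real (n + 1))))"
  proof (rule sum.cong[OF refl])
    fix n assume "n \<in> {..<N}"
    then have "L2_inner ?M (\<lambda>x. x ^ n) (?S N) = cnj (a n * of_real (pi * r ^ (2 * n + 2) / real (n + 1)))"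
      using L2_inner_commute[of ?M "\<lambda>x. x ^ n" "?S N"] in1[of N n] by simp
    then have "a n * L2_inner ?M (\<lambda>x. x ^ n) (?S N) = (a n * cnj (a n)) * of_real (pi * r ^ (2 * n + 2) / real (n + 1))" by simp
    then show "a n * L2_inner ?M (\<lambda>x. x ^ n) (?S N) = of_real ((cmod (a n))\<^sup>2 * (pi * r ^ (2 * n + 2) / real (n + 1)))"
      by (simp only: complex_norm_square[symmetric] of_real_mult)
  qed
  finally have "complex_of_real (norm_sq ?M (?S N)) = of_real (\<Sum>n<N. (cmod (a n))\<^sup>2 * (pi * r ^ (2 * n + 2) / real (n + 1)))"
    by (simp only: of_real_sum)
  then show "norm_sq ?M (?S N) = (\<Sum>n<N. (cmod (a n))\<^sup>2 * (pi * r ^ (2 * n + 2) / real (n + 1)))"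
    by (simp only: of_real_eq_iff)
qed

text \<open>
  On a smaller disc the Taylor polynomials converge uniformly, with the tails \<open>t N\<close> of the
  majorizing series as error.
\<close>

lemma smaller_disc_Parseval:
  assumes g: "\<And>x. x \<in> ball 0 1 \<Longrightarrow> (\<lambda>n. a n * x ^ n) sums g x" and m: "g \<in> borel_measurable borel"
    and r: "0 \<le> r" "r < 1"
  shows "g \<in> L2 (disc_measure r)"
    "(\<lambda>n. (cmod (a n))\<^sup>2 * (pi * r ^ (2 * n + 2) / real (n + 1))) sums norm_sq (disc_measure r) g"
proof -
  let ?M = "disc_measure r"
  let ?S = "\<lambda>N x. \<Sum>n<N. a n * x ^ n"
  define q where "q = (1 + r) / 2"
  have q: "r < q" "q < 1" "0 \<le> q" using r by (auto simp: q_def)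
  have "summable (\<lambda>n. a n * complex_of_real q ^ n)" using g[of "of_real q"] q by (auto simp: summable_def)
  then have s: "summable (\<lambda>n. norm (a n * of_real r ^ n))" by (rule powser_insidea) (use r q in auto)
  then have s': "summable (\<lambda>n. cmod (a n) * r ^ n)" using r by (simp add: norm_mult norm_power)
  define t where "t N = (\<Sum>n. cmod (a (n + N)) * r ^ (n + N))" for N
  have t0: "t \<longlonglongrightarrow> 0" unfolding t_def by (rule suminf_exist_split2[OF s'])
  have tn: "t N \<ge> 0" for N unfolding t_def using r by (intro suminf_nonneg summable_ignore_initial_segment[OF s']) auto
  have le: "cmod (?S N x - g x) \<le> t N" if x: "x \<in> ball 0 r" for N x
  proof -
    have x1: "x \<in> ball 0 1" using x r by auto
    have xr: "cmod x \<le> r" using x by simp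
    have "(\<lambda>n. a (n + N) * x ^ (n + N)) sums (g x - ?S N x)" using g[OF x1] by (subst sums_iff_shift) simp
    then have eq: "g x - ?S N x = (\<Sum>n. a (n + N) * x ^ (n + N))" by (rule sums_unique)
    have b: "norm (a (n + N) * x ^ (n + N)) \<le> cmod (a (n + N)) * r ^ (n + N)" for n
      unfolding norm_mult norm_power by (intro mult_left_mono power_mono xr) auto
    have "norm (\<Sum>n. a (n + N) * x ^ (n + N)) \<le> t N" unfolding t_def
      by (rule norm_suminf_le[OF b summable_ignore_initial_segment[OF s']])
    then show ?thesis unfolding eq[symmetric] by (simp add: norm_minus_commute)
  qed
  have Sm: "?S N \<in> borel_measurable borel" for N by measurable
  have d: "(\<lambda>x. ?S N x - g x) \<in> L2 ?M" "norm_sq ?M (\<lambda>x. ?S N x - g x) \<le> (t N)\<^sup>2 * (pi * r\<^sup>2)" for N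
    by (rule disc_bounded_L2[OF _ le r(1) tn]; use Sm m in measurable)+
  from L2_diff[OF disc_polynomial_norm_sq(1)[OF r(1), of a 0] d(1)[of 0]] show gL: "g \<in> L2 ?M" by simp
  have "(\<lambda>N. norm_sq ?M (\<lambda>x. ?S N x - g x)) \<longlonglongrightarrow> 0"
  proof (rule Lim_null_comparison)
    show "\<forall>\<^sub>F N in sequentially. norm (norm_sq ?M (\<lambda>x. ?S N x - g x)) \<le> (t N)\<^sup>2 * (pi * r\<^sup>2)" using d(2) by simp
    show "(\<lambda>N. (t N)\<^sup>2 * (pi * r\<^sup>2)) \<longlonglongrightarrow> 0"
    proof (rule tendsto_mult_left_zero)
      show "(\<lambda>N. (t N)\<^sup>2) \<longlonglongrightarrow> 0" using tendsto_power[OF t0, of 2] by simp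
    qed
  qed
  from norm_sq_tendsto[OF _ gL this] disc_polynomial_norm_sq(1)[OF r(1)]
  have "(\<lambda>N. norm_sq ?M (?S N)) \<longlonglongrightarrow> norm_sq ?M g" by simp
  then show "(\<lambda>n. (cmod (a n))\<^sup>2 * (pi * r ^ (2 * n + 2) / real (n + 1))) sums norm_sq ?M g"
    unfolding sums_def disc_polynomial_norm_sq(2)[OF r(1)] .
qed

text \<open>
  Monotone convergence on both sides as the radius grows to \<open>1\<close>. Extended nonnegative values let
  this decide membership in the Bergman space.
\<close>

lemma unit_disc_Parseval:
  assumes g: "\<And>x. x \<in> ball 0 1 \<Longrightarrow> (\<lambda>n. a n * x ^ n) sums g x" and m: "g \<in> borel_measurable borel"
  shows "(\<integral>\<^sup>+x. ennreal ((cmod (g x))\<^sup>2) * indicator (ball 0 1) x \<partial>lborel) = (\<Sum>n. ennreal (pi * ((cmod (a n))\<^sup>2 / real (n + 1))))"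
proof -
  note [measurable] = m
  have [measurable]: "ball (0::complex) s \<in> sets borel" for s by simp
  \<comment> \<open>radii increasing to 1\<close>
  define r where "r k = 1 - inverse (real (Suc k))" for k
  have r: "0 \<le> r k" "r k < 1" for k by (auto simp: r_def inverse_le_1_iff)
  have rm: "r k \<le> r l" if "k \<le> l" for k l using that by (simp add: r_def le_imp_inverse_le)
  have rl: "r \<longlonglongrightarrow> 1" unfolding r_def using tendsto_diff[OF tendsto_const LIMSEQ_inverse_real_of_nat, of 1] by simp
  let ?c = "\<lambda>n. (cmod (a n))\<^sup>2"
  have eq: "(\<integral>\<^sup>+x. ennreal ((cmod (g x))\<^sup>2) * indicator (ball 0 (r k)) x \<partial>lborel) = (\<integral>\<^sup>+n. ennreal (?c n * (pi * r k ^ (2 * n + 2) / real (n + 1))) \<partial>count_space UNIV)" for k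
  proof -
    note P = smaller_disc_Parseval[OF g m r[of k]]
    have "(\<integral>\<^sup>+x. ennreal ((cmod (g x))\<^sup>2) * indicator (ball 0 (r k)) x \<partial>lborel) = ennreal (norm_sq (disc_measure (r k)) g)"
      using nn_integral_norm_sq[OF P(1)] by (simp add: disc_measure_nn_integral)
    also have "\<dots> = ennreal (\<Sum>n. ?c n * (pi * r k ^ (2 * n + 2) / real (n + 1)))"
      by (simp only: sums_unique[OF P(2)])
    also have "\<dots> = (\<Sum>n. ennreal (?c n * (pi * r k ^ (2 * n + 2) / real (n + 1))))"
    proof (rule suminf_ennreal2[symmetric, OF _ sums_summable[OF P(2)]])
      show "0 \<le> ?c n * (pi * r k ^ (2 * n + 2) / real (n + 1))" for n
        using r(1)[of k] by (intro mult_nonneg_nonneg divide_nonneg_nonneg zero_le_power) auto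
    qed
    finally show ?thesis by (simp add: nn_integral_count_space_nat)
  qed
  have L1: "(\<lambda>k. \<integral>\<^sup>+x. ennreal ((cmod (g x))\<^sup>2) * indicator (ball 0 (r k)) x \<partial>lborel) \<longlonglongrightarrow> (\<integral>\<^sup>+x. ennreal ((cmod (g x))\<^sup>2) * indicator (ball 0 1) x \<partial>lborel)"
  proof (rule nn_integral_LIMSEQ)
    show "incseq (\<lambda>k x. ennreal ((cmod (g x))\<^sup>2) * indicator (ball 0 (r k)) x)"
    proof (rule incseq_SucI, rule le_funI)
      fix k x
      show "ennreal ((cmod (g x))\<^sup>2) * indicator (ball 0 (r k)) x \<le> ennreal ((cmod (g x))\<^sup>2) * indicator (ball 0 (r (Suc k))) x"
        using rm[of k "Suc k"] by (intro mult_left_mono) (auto simp: indicator_def)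
    qed
    fix x :: complex
    have "\<forall>\<^sub>F k in sequentially. indicator (ball 0 (r k)) x = (indicator (ball 0 1) x :: ennreal)"
    proof (cases "cmod x < 1")
      case True
      from order_tendstoD(1)[OF rl True] show ?thesis by eventually_elim (use True in \<open>auto simp: indicator_def\<close>)
    next
      case False
      then have "x \<notin> ball 0 (r k)" for k using r(2)[of k] by simp
      then show ?thesis using False by (simp add: indicator_def)
    qed
    then have "\<forall>\<^sub>F k in sequentially. ennreal ((cmod (g x))\<^sup>2) * indicator (ball 0 (r k)) x = ennreal ((cmod (g x))\<^sup>2) * indicator (ball 0 1) x"
      by eventually_elim simp
    then show "(\<lambda>k. ennreal ((cmod (g x))\<^sup>2) * indicator (ball 0 (r k)) x) \<longlonglongrightarrow> ennreal ((cmod (g x))\<^sup>2) * indicator (ball 0 1) x"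
      by (rule tendsto_eventually)
  qed measurable
  have L2: "(\<lambda>k. \<integral>\<^sup>+n. ennreal (?c n * (pi * r k ^ (2 * n + 2) / real (n + 1))) \<partial>count_space UNIV) \<longlonglongrightarrow> (\<integral>\<^sup>+n. ennreal (pi * (?c n / real (n + 1))) \<partial>count_space UNIV)"
  proof (rule nn_integral_LIMSEQ)
    show "incseq (\<lambda>k n. ennreal (?c n * (pi * r k ^ (2 * n + 2) / real (n + 1))))"
    proof (rule incseq_SucI, rule le_funI)
      fix k n
      show "ennreal (?c n * (pi * r k ^ (2 * n + 2) / real (n + 1))) \<le> ennreal (?c n * (pi * r (Suc k) ^ (2 * n + 2) / real (n + 1)))"
        using rm[of k "Suc k"] r by (intro ennreal_leI mult_left_mono divide_right_mono power_mono) auto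
    qed
    fix n
    have "(\<lambda>k. ?c n * (pi * r k ^ (2 * n + 2) / real (n + 1))) \<longlonglongrightarrow> ?c n * (pi * 1 ^ (2 * n + 2) / real (n + 1))"
      by (intro tendsto_intros rl) simp
    also have "?c n * (pi * 1 ^ (2 * n + 2) / real (n + 1)) = pi * (?c n / real (n + 1))" by simp
    finally have "(\<lambda>k. ?c n * (pi * r k ^ (2 * n + 2) / real (n + 1))) \<longlonglongrightarrow> pi * (?c n / real (n + 1))" .
    then show "(\<lambda>k. ennreal (?c n * (pi * r k ^ (2 * n + 2) / real (n + 1)))) \<longlonglongrightarrow> ennreal (pi * (?c n / real (n + 1)))"
      by (rule tendsto_ennrealI)
  qed simp
  from LIMSEQ_unique[OF L1 L2[folded eq]] show ?thesis by (simp add: nn_integral_count_space_nat)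
qed

abbreviation Disc where "Disc \<equiv> unit_disc_at_1"

lemma Disc_eq_ball: "Disc = ball 1 1"
  by (auto simp: unit_disc_at_1_def dist_norm norm_minus_commute)

text \<open>
  A relation rather than a formula by derivatives at the centre: the coefficients of linear
  combinations then come from adding convergent series.
\<close>

definition disc_series :: "(nat \<Rightarrow> complex) \<Rightarrow> (complex \<Rightarrow> complex) \<Rightarrow> bool" where
  "disc_series a f \<longleftrightarrow> f \<in> holo_space Disc \<and> (\<forall>z\<in>Disc. (\<lambda>n. a n * (z - 1) ^ n) sums f z)"

lemma disc_series_exists:
  assumes "f \<in> holo_space Disc"
  obtains a where "disc_series a f"
  using holomorphic_power_series[of f 1 1] assms that[of "\<lambda>n. (deriv ^^ n) f 1 / fact n"]
  by (auto simp: disc_series_def Disc_eq_ball holo_space_def)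

lemma disc_series_lincomb:
  assumes "disc_series a f" "disc_series b g"
  shows "disc_series (\<lambda>n. p * a n + q * b n) (\<lambda>z. p * f z + q * g z)"
  unfolding disc_series_def
proof (intro conjI ballI)
  show "(\<lambda>z. p * f z + q * g z) \<in> holo_space Disc"
    using assms by (auto simp: disc_series_def holo_space_def intro!: holomorphic_intros)
  fix z assume z: "z \<in> Disc"
  have "(\<lambda>n. p * (a n * (z - 1) ^ n) + q * (b n * (z - 1) ^ n)) sums (p * f z + q * g z)"
    using assms z by (intro sums_add sums_mult) (auto simp: disc_series_def)
  then show "(\<lambda>n. (p * a n + q * b n) * (z - 1) ^ n) sums (p * f z + q * g z)" by (simp add: algebra_simps)
qed

lemma disc_series_nn_integral:
  assumes f: "disc_series a f"
  shows "(\<integral>\<^sup>+z. ennreal ((cmod (f z))\<^sup>2) \<partial>lborel) = (\<Sum>n. ennreal (pi * ((cmod (a n))\<^sup>2 / real (n + 1))))"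
proof -
  have fm: "f \<in> borel_measurable borel"
    by (rule holo_space_measurable[of Disc]) (use f in \<open>auto simp: disc_series_def Disc_eq_ball\<close>)
  note [measurable] = fm
  have "(\<integral>\<^sup>+z. ennreal ((cmod (f z))\<^sup>2) \<partial>lborel) = (\<integral>\<^sup>+x. ennreal ((cmod (f (1 + x)))\<^sup>2) \<partial>lborel)"
    by (rule nn_integral_translate[symmetric]) measurable
  also have "\<dots> = (\<integral>\<^sup>+x. ennreal ((cmod (f (1 + x)))\<^sup>2) * indicator (ball 0 1) x \<partial>lborel)"
    using f by (intro nn_integral_cong) (auto simp: indicator_def disc_series_def holo_space_def unit_disc_at_1_def)
  also have "\<dots> = (\<Sum>n. ennreal (pi * ((cmod (a n))\<^sup>2 / real (n + 1))))"
  proof (rule unit_disc_Parseval)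
    fix x :: complex assume "x \<in> ball 0 1"
    then have "1 + x \<in> Disc" by (simp add: unit_disc_at_1_def)
    then have "(\<lambda>n. a n * (1 + x - 1) ^ n) sums f (1 + x)" using f unfolding disc_series_def by blast
    then show "(\<lambda>n. a n * x ^ n) sums f (1 + x)" by simp
  qed measurable
  finally show ?thesis .
qed

lemma bergman_iff_L2: "f \<in> bergman \<longleftrightarrow> f \<in> holo_space Disc \<and> f \<in> L2 lborel"
proof -
  have "f \<in> borel_measurable borel" if "f \<in> holo_space Disc"
    by (rule holo_space_measurable[OF _ that]) (simp add: Disc_eq_ball)
  moreover have "(\<lambda>z. indicator Disc z *\<^sub>R (cmod (f z))\<^sup>2) = (\<lambda>z. (cmod (f z))\<^sup>2)" if "f \<in> holo_space Disc"
    using that by (auto simp: fun_eq_iff indicator_def holo_space_def)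
  ultimately show ?thesis by (auto simp: bergman_def set_integrable_def L2_def)
qed

lemma bergman_norm_eq: "f \<in> bergman \<Longrightarrow> bergman_norm f = sqrt (norm_sq lborel f / pi)"
proof -
  assume "f \<in> bergman"
  then have "(\<lambda>z. indicator Disc z *\<^sub>R (cmod (f z))\<^sup>2) = (\<lambda>z. (cmod (f z))\<^sup>2)"
    by (auto simp: fun_eq_iff indicator_def holo_space_def bergman_def)
  then show ?thesis by (simp add: bergman_norm_def set_lebesgue_integral_def norm_sq_def)
qed

lemma bergman_iff_summable:
  assumes f: "disc_series a f"
  shows "f \<in> bergman \<longleftrightarrow> summable (\<lambda>n. (cmod (a n))\<^sup>2 / real (n + 1))"
proof
  have h: "f \<in> holo_space Disc" using f by (simp add: disc_series_def)
  have m: "f \<in> borel_measurable lborel" using holo_space_measurable[OF _ h] by (simp add: Disc_eq_ball)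
  {
    assume "f \<in> bergman"
    then have "f \<in> L2 lborel" by (simp add: bergman_iff_L2)
    then have "(\<Sum>n. ennreal (pi * ((cmod (a n))\<^sup>2 / real (n + 1)))) = ennreal (norm_sq lborel f)"
      using nn_integral_norm_sq[of f lborel] disc_series_nn_integral[OF f] by (simp only:)
    then have "(\<Sum>n. ennreal (pi * ((cmod (a n))\<^sup>2 / real (n + 1)))) \<noteq> top" by (simp only: ennreal_neq_top not_False_eq_True)
    moreover have "0 \<le> pi * ((cmod (a n))\<^sup>2 / real (n + 1))" for n by simp
    ultimately have "summable (\<lambda>n. pi * ((cmod (a n))\<^sup>2 / real (n + 1)))"
      using summable_suminf_not_top[of "\<lambda>n. pi * ((cmod (a n))\<^sup>2 / real (n + 1))"] by blast
    then show "summable (\<lambda>n. (cmod (a n))\<^sup>2 / real (n + 1))" using pi_neq_zero by (simp only: summable_cmult_iff simp_thms)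
  next
    assume s: "summable (\<lambda>n. (cmod (a n))\<^sup>2 / real (n + 1))"
    have "(\<Sum>n. ennreal (pi * ((cmod (a n))\<^sup>2 / real (n + 1)))) = ennreal (\<Sum>n. pi * ((cmod (a n))\<^sup>2 / real (n + 1)))"
      by (rule suminf_ennreal2[OF _ summable_mult[OF s]]) simp
    then have "f \<in> L2 lborel" using disc_series_nn_integral[OF f]
      by (intro L2I_nn_integral m) (simp only: infinity_ennreal_def ennreal_less_top)
    then show "f \<in> bergman" using h by (simp add: bergman_iff_L2)
  }
qed

lemma bergman_Parseval:
  assumes f: "disc_series a f" "f \<in> bergman"
  shows "(\<lambda>n. (cmod (a n))\<^sup>2 / real (n + 1)) sums (norm_sq lborel f / pi)"
proof -
  have s: "summable (\<lambda>n. (cmod (a n))\<^sup>2 / real (n + 1))" using bergman_iff_summable[OF f(1)] f(2) by blast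
  have "(\<Sum>n. ennreal (pi * ((cmod (a n))\<^sup>2 / real (n + 1)))) = ennreal (\<Sum>n. pi * ((cmod (a n))\<^sup>2 / real (n + 1)))"
    by (rule suminf_ennreal2[OF _ summable_mult[OF s]]) simp
  moreover have "f \<in> L2 lborel" using f(2) by (simp add: bergman_iff_L2)
  ultimately have "ennreal (norm_sq lborel f) = ennreal (\<Sum>n. pi * ((cmod (a n))\<^sup>2 / real (n + 1)))"
    using nn_integral_norm_sq[of f lborel] disc_series_nn_integral[OF f(1)] by (simp only:)
  also have "(\<Sum>n. pi * ((cmod (a n))\<^sup>2 / real (n + 1))) = pi * (\<Sum>n. (cmod (a n))\<^sup>2 / real (n + 1))"
    by (rule suminf_mult[OF s])
  finally have "norm_sq lborel f = pi * (\<Sum>n. (cmod (a n))\<^sup>2 / real (n + 1))"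
  proof (subst (asm) ennreal_inj)
    have "0 \<le> (\<Sum>n. (cmod (a n))\<^sup>2 / real (n + 1))" by (rule suminf_nonneg[OF s]) simp
    then show "0 \<le> pi * (\<Sum>n. (cmod (a n))\<^sup>2 / real (n + 1))" by simp
  qed simp_all
  then have "(\<Sum>n. (cmod (a n))\<^sup>2 / real (n + 1)) = norm_sq lborel f / pi" by simp
  then show ?thesis using summable_sums[OF s] by (simp only:)
qed

text \<open>
  Polarization of \<open>bergman_Parseval\<close>: the squared norm of \<open>f - h\<close> gives the real part, and replacing
  \<open>h\<close> by \<open>\<i> * h\<close> gives the imaginary part.
\<close>

lemma bergman_inner_series:
  assumes f: "disc_series a f" "f \<in> bergman" and h: "disc_series b h" "h \<in> bergman"
  shows "(\<lambda>n. a n * cnj (b n) / of_nat (n + 1)) sums (L2_inner lborel f h / pi)"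
proof -
  have L: "f \<in> L2 lborel" "h \<in> L2 lborel" using f h by (auto simp: bergman_iff_L2)
  have Re: "(\<lambda>n. Re (a n * cnj (c n)) / real (n + 1)) sums (Re (L2_inner lborel f k) / pi)"
    if k: "disc_series c k" "k \<in> bergman" for c k
  proof -
    have kL: "k \<in> L2 lborel" using k by (simp add: bergman_iff_L2)
    have d: "disc_series (\<lambda>n. a n - c n) (\<lambda>z. f z - k z)" using disc_series_lincomb[OF f(1) k(1), of 1 "-1"] by simp
    then have "(\<lambda>z. f z - k z) \<in> bergman" using L2_diff[OF L(1) kL] by (simp add: bergman_iff_L2 disc_series_def)
    note P = bergman_Parseval[OF f] bergman_Parseval[OF k] bergman_Parseval[OF d this]
    have pt: "(cmod (x - y))\<^sup>2 = (cmod x)\<^sup>2 + (cmod y)\<^sup>2 - 2 * Re (x * cnj y)" for x y :: complex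
      by (simp only: cmod_power2) (simp add: power2_eq_square algebra_simps)
    have "(\<lambda>n. ((cmod (a n))\<^sup>2 / real (n + 1) + (cmod (c n))\<^sup>2 / real (n + 1) - (cmod (a n - c n))\<^sup>2 / real (n + 1)) / 2) sums
       ((norm_sq lborel f / pi + norm_sq lborel k / pi - norm_sq lborel (\<lambda>z. f z - k z) / pi) / 2)"
      by (intro sums_divide sums_diff sums_add P)
    moreover have "(u / r + v / r - (u + v - 2 * w) / r) / 2 = w / r" for u v w r :: real
      by (simp add: diff_divide_distrib add_divide_distrib)
    ultimately show ?thesis unfolding pt norm_sq_diff[OF L(1) kL] by (simp only:)
  qed
  \<comment> \<open>the real part for this function is the imaginary part for h\<close>
  define k where "k = (\<lambda>z. \<i> * h z)"
  have k: "disc_series (\<lambda>n. \<i> * b n) k" "k \<in> bergman"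
    using disc_series_lincomb[OF h(1) h(1), of \<i> 0] L2_mult_left[OF L(2), of \<i>] by (auto simp: k_def bergman_iff_L2 disc_series_def)
  have "L2_inner lborel f k = - \<i> * L2_inner lborel f h"
    unfolding L2_inner_def k_def by (subst integral_mult_right_zero[symmetric]) (simp add: mult_ac)
  then have "Re (L2_inner lborel f k) = Im (L2_inner lborel f h)" by simp
  moreover have "Re (a n * cnj (\<i> * b n)) = Im (a n * cnj (b n))" for n by simp
  ultimately have Im: "(\<lambda>n. Im (a n * cnj (b n)) / real (n + 1)) sums (Im (L2_inner lborel f h) / pi)"
    using Re[OF k] by simp
  have pe: "Re (a n * cnj (b n) / of_nat (n + 1)) = Re (a n * cnj (b n)) / real (n + 1)"
    "Im (a n * cnj (b n) / of_nat (n + 1)) = Im (a n * cnj (b n)) / real (n + 1)" for n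
    using Re_divide_of_real[of "a n * cnj (b n)" "real (n + 1)"] Im_divide_of_real[of "a n * cnj (b n)" "real (n + 1)"]
    by (simp_all only: of_real_of_nat_eq)
  show ?thesis unfolding sums_complex_iff pe Re_divide_of_real Im_divide_of_real using Re[OF h] Im by (rule conjI)
qed

section \<open>The Mellin--Bergman transform\<close>

text \<open>
  The functions with which the transform pairs \<open>f\<close> in the Bergman space; see
  \<open>mellin_bergman_inner\<close>.
\<close>

definition power_fun :: "complex \<Rightarrow> complex \<Rightarrow> complex" where
  "power_fun z = zero_ext Disc (\<lambda>\<zeta>. \<zeta> powr (cnj z - 1))"

lemma Disc_Re_pos: "\<zeta> \<in> Disc \<Longrightarrow> Re \<zeta> > 0"
  using abs_Re_le_cmod[of "\<zeta> - 1"] by (auto simp: unit_disc_at_1_def)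

lemma disc_seriesI:
  assumes "\<And>z. z \<in> Disc \<Longrightarrow> (\<lambda>n. a n * (z - 1) ^ n) sums f z"
  shows "disc_series a (zero_ext Disc f)"
proof -
  have "f holomorphic_on ball 1 1" by (rule power_series_holomorphic[of 1 1 a]) (use assms in \<open>simp add: Disc_eq_ball\<close>)
  then have "zero_ext Disc f holomorphic_on Disc"
    unfolding Disc_eq_ball[symmetric] by (rule holomorphic_transform) (simp add: zero_ext_def)
  then show ?thesis using assms by (auto simp: disc_series_def holo_space_def zero_ext_def)
qed

lemma power_fun_series: "disc_series (\<lambda>n. (cnj z - 1) gchoose n) (power_fun z)"
  unfolding power_fun_def
proof (rule disc_seriesI)
  fix \<zeta> assume "\<zeta> \<in> Disc"
  then have "norm (\<zeta> - 1) < 1" by (simp add: unit_disc_at_1_def)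
  from gen_binomial_complex[OF this, of "cnj z - 1"]
  show "(\<lambda>n. (cnj z - 1 gchoose n) * (\<zeta> - 1) ^ n) sums \<zeta> powr (cnj z - 1)" by simp
qed

lemma cnj_gbinomial: "cnj (a gchoose n) = cnj a gchoose n"
  by (simp add: gbinomial_prod_rev)

text \<open>
  Up to the factor \<open>2 * pi\<close>, the series of squared coefficients is the one that Bessel's inequality bounds for
  the kernel at \<open>z\<close>. So square integrability near the boundary point \<open>0\<close> comes for free.
\<close>

lemma power_fun_bergman:
  assumes z: "Re z > 0"
  shows "power_fun z \<in> bergman"
proof -
  let ?K = "mellin_kernel z"
  have K: "?K \<in> H_space" by (rule kernel_in_H_space[OF z])
  have c: "(cmod (H_inner ?K (newton n)))\<^sup>2 = (cmod ((cnj z - 1) gchoose n))\<^sup>2 / real (n + 1) / (2 * pi)" for n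
  proof -
    have "H_inner ?K (newton n) = cnj (newton n z)"
      using H_inner_commute[OF newton_in_H_space K, of n] H_inner_kernel[OF newton_in_H_space z, of n] by simp
    then have "cmod (H_inner ?K (newton n)) = cmod (newton n z)" by simp
    also have "\<dots> = cmod ((z - 1) gchoose n) / newton_const n"
      using newton_const_pos[of n] by (simp add: newton_eq[OF z] norm_divide)
    also have "cmod ((z - 1) gchoose n) = cmod ((cnj z - 1) gchoose n)"
      using cnj_gbinomial[of "z - 1" n] complex_mod_cnj[of "(z - 1) gchoose n"] by simp
    finally have "(cmod (H_inner ?K (newton n)))\<^sup>2 = (cmod ((cnj z - 1) gchoose n))\<^sup>2 / (newton_const n)\<^sup>2"
      by (simp only: power_divide)
    then show ?thesis unfolding newton_const_sq by (simp add: mult.commute)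
  qed
  from summable_mult[OF H_Bessel(1)[OF K], of "2 * pi"]
  have "summable (\<lambda>n. (cmod ((cnj z - 1) gchoose n))\<^sup>2 / real (n + 1))" unfolding c by simp
  then show ?thesis using bergman_iff_summable[OF power_fun_series] by blast
qed

lemma mellin_bergman_inner:
  assumes z: "Re z > 0" and f: "f \<in> bergman"
  shows "mellin_bergman f z = L2_inner lborel f (power_fun z) / pi"
proof -
  have "indicator Disc \<zeta> *\<^sub>R (f \<zeta> * cnj \<zeta> powr (z - 1)) = f \<zeta> * cnj (power_fun z \<zeta>)" for \<zeta>
  proof (cases "\<zeta> \<in> Disc")
    case True
    then have "cnj (\<zeta> powr (cnj z - 1)) = cnj \<zeta> powr (z - 1)"
      using Disc_Re_pos[OF True] by (subst cnj_powr) auto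
    then show ?thesis using True by (simp add: power_fun_def zero_ext_def)
  qed (simp add: power_fun_def zero_ext_def)
  then show ?thesis using z
    by (simp add: mellin_bergman_def zero_ext_def right_half_plane_def set_lebesgue_integral_def L2_inner_def)
qed

lemma mellin_bergman_series:
  assumes f: "disc_series a f" "f \<in> bergman"
  shows "(\<lambda>n. (a n / of_real (sqrt (real (Suc n)))) * newton n z) sums (mellin_bergman f z / of_real (sqrt (2 * pi)))"
proof (cases "Re z > 0")
  case False
  then show ?thesis using H_space_zero_outside[OF newton_in_H_space]
    by (simp add: mellin_bergman_def zero_ext_def right_half_plane_def)
next
  case True
  have "(\<lambda>n. a n * cnj ((cnj z - 1) gchoose n) / of_nat (n + 1) / of_real (sqrt (2 * pi))) sums
      (L2_inner lborel f (power_fun z) / pi / of_real (sqrt (2 * pi)))"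
    by (intro sums_divide bergman_inner_series f power_fun_series power_fun_bergman True)
  moreover have "a n * cnj ((cnj z - 1) gchoose n) / of_nat (n + 1) / of_real (sqrt (2 * pi))
      = (a n / of_real (sqrt (real (Suc n)))) * newton n z" for n
  proof -
    have "newton_const n = sqrt (2 * pi) * sqrt (real (Suc n))" unfolding newton_const_def by (rule real_sqrt_mult)
    moreover have "complex_of_real (sqrt (real (Suc n))) * of_real (sqrt (real (Suc n))) = of_nat (n + 1)"
      by (simp only: of_real_mult[symmetric] real_sqrt_mult_self) simp
    moreover have "cnj ((cnj z - 1) gchoose n) = (z - 1) gchoose n" by (simp add: cnj_gbinomial)
    moreover have "x * y / (s * s) / t = (x / s) * (y / (t * s))" for x y s t :: complex by simp
    ultimately show ?thesis unfolding newton_eq[OF True] by (metis of_real_mult)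
  qed
  ultimately show ?thesis by (simp only: mellin_bergman_inner[OF True f(2)])
qed

lemma bergman_coeff_norm:
  "(cmod (a n / of_real (sqrt (real (Suc n)))))\<^sup>2 = (cmod (a n))\<^sup>2 / real (n + 1)"
  by (simp add: norm_divide power_divide)

abbreviation (input) mellin_iso :: "(complex \<Rightarrow> complex) \<Rightarrow> complex \<Rightarrow> complex" where
  "mellin_iso \<equiv> \<lambda>f z. mellin_bergman f z / of_real (sqrt (2 * pi))"

lemma mellin_iso_in_H_space:
  assumes f: "f \<in> bergman"
  shows "mellin_iso f \<in> H_space" "H_norm (mellin_iso f) = bergman_norm f"
proof -
  obtain a where a: "disc_series a f" using disc_series_exists[of f] f by (auto simp: bergman_iff_L2)
  let ?c = "\<lambda>n. a n / of_real (sqrt (real (Suc n)))"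
  note P = bergman_Parseval[OF a f]
  have s: "summable (\<lambda>n. (cmod (?c n))\<^sup>2)" unfolding bergman_coeff_norm using P by (rule sums_summable)
  obtain g where g: "g \<in> H_space" "\<And>z. (\<lambda>n. ?c n * newton n z) sums g z"
    "(\<lambda>N. H_norm (\<lambda>z. (\<Sum>n<N. ?c n * newton n z) - g z)) \<longlonglongrightarrow> 0"
    "\<And>n. H_inner g (newton n) = ?c n" "(\<lambda>n. (cmod (?c n))\<^sup>2) sums (H_norm g)\<^sup>2"
    by (rule newton_series_converges[OF s]) (rule that)
  have eq: "mellin_iso f = g"
    by (rule ext) (rule sums_unique2[OF mellin_bergman_series[OF a f] g(2)])
  show "mellin_iso f \<in> H_space" unfolding eq by (rule g(1))
  have "(H_norm g)\<^sup>2 = norm_sq lborel f / pi" by (rule sums_unique2[OF g(5)[unfolded bergman_coeff_norm] P])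
  then show "H_norm (mellin_iso f) = bergman_norm f"
    unfolding eq bergman_norm_eq[OF f] using H_norm_nonneg[OF g(1)] by (metis real_sqrt_unique)
qed

text \<open>
  The Newton coefficients of \<open>g\<close> are square summable, so they are those of a function in the Bergman
  space; the power series converges in the disc because
  \<open>|c n| * (sqrt (n + 1) * r ^ n) \<le> |c n|^2 + (n + 1) * r ^ (2 * n)\<close>.
\<close>

lemma mellin_iso_surj:
  assumes g: "g \<in> H_space"
  shows "\<exists>f\<in>bergman. mellin_iso f = g"
proof -
  define c where "c n = H_inner g (newton n)" for n
  define a where "a n = c n * of_real (sqrt (real (Suc n)))" for n
  have ac: "a n / of_real (sqrt (real (Suc n))) = c n" for n by (simp add: a_def del: of_nat_Suc)
  have sc: "summable (\<lambda>n. (cmod (c n))\<^sup>2)" unfolding c_def by (rule H_Bessel(1)[OF g])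
  have conv: "summable (\<lambda>n. a n * (z - 1) ^ n)" if z: "z \<in> Disc" for z
  proof (rule summable_comparison_test')
    define r where "r = cmod (z - 1)"
    have r: "0 \<le> r" "r < 1" using z by (auto simp: r_def unit_disc_at_1_def)
    have "r * r < 1 * 1" using r by (intro mult_strict_mono') auto
    then have "norm (r * r) < 1" using r by simp
    from sums_summable[OF geometric_deriv_sums[OF this]]
    show "summable (\<lambda>n. (cmod (c n))\<^sup>2 + of_nat (Suc n) * (r * r) ^ n)" by (rule summable_add[OF sc])
    fix n :: nat assume "0 \<le> n"
    have "norm (a n * (z - 1) ^ n) = cmod (c n) * (sqrt (real (Suc n)) * r ^ n)"
      by (simp add: a_def norm_mult norm_power r_def)
    also have "\<dots> \<le> (cmod (c n))\<^sup>2 + (sqrt (real (Suc n)) * r ^ n)\<^sup>2"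
      using sum_squares_bound[of "cmod (c n)" "sqrt (real (Suc n)) * r ^ n"]
        sum_power2_ge_zero[of "cmod (c n)" "sqrt (real (Suc n)) * r ^ n"] by linarith
    also have "(sqrt (real (Suc n)) * r ^ n)\<^sup>2 = of_nat (Suc n) * (r * r) ^ n"
      by (simp add: power_mult_distrib power2_eq_square[symmetric] power_mult[symmetric] mult.commute)
    finally show "norm (a n * (z - 1) ^ n) \<le> (cmod (c n))\<^sup>2 + of_nat (Suc n) * (r * r) ^ n" .
  qed
  define f where "f = zero_ext Disc (\<lambda>z. \<Sum>n. a n * (z - 1) ^ n)"
  have a: "disc_series a f" unfolding f_def by (rule disc_seriesI) (rule summable_sums[OF conv])
  have "summable (\<lambda>n. (cmod (a n))\<^sup>2 / real (n + 1))"
    using sc unfolding bergman_coeff_norm[symmetric] ac .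
  then have fb: "f \<in> bergman" using bergman_iff_summable[OF a] by blast
  have "mellin_iso f = g"
  proof
    fix z
    from mellin_bergman_series[OF a fb, of z] have "(\<lambda>n. c n * newton n z) sums mellin_iso f z" unfolding ac .
    from sums_unique2[OF this newton_expansion(1)[OF g, of z, folded c_def]] show "mellin_iso f z = g z" .
  qed
  with fb show ?thesis by blast
qed

lemma bergman_lincomb: "f \<in> bergman \<Longrightarrow> g \<in> bergman \<Longrightarrow> (\<lambda>z. p * f z + q * g z) \<in> bergman"
  using L2_lincomb[of f lborel g p q] by (auto simp: bergman_iff_L2 holo_space_def intro!: holomorphic_intros)

lemma mellin_iso_lincomb:
  assumes f: "f \<in> bergman" and g: "g \<in> bergman"
  shows "mellin_iso (\<lambda>z. p * f z + q * g z) = (\<lambda>z. p * mellin_iso f z + q * mellin_iso g z)"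
proof
  fix z
  show "mellin_iso (\<lambda>z. p * f z + q * g z) z = p * mellin_iso f z + q * mellin_iso g z"
  proof (cases "Re z > 0")
    case True
    have L: "f \<in> L2 lborel" "g \<in> L2 lborel" "power_fun z \<in> L2 lborel"
      using f g power_fun_bergman[OF True] by (auto simp: bergman_iff_L2)
    show ?thesis
      unfolding mellin_bergman_inner[OF True f] mellin_bergman_inner[OF True g] mellin_bergman_inner[OF True bergman_lincomb[OF f g]]
        L2_inner_lincomb_left[OF L] by (simp add: add_divide_distrib)
  qed (simp add: mellin_bergman_def zero_ext_def right_half_plane_def)
qed

text \<open>
  Here \<open>|\<zeta> powr s| = exp (Re s * u - Im s * t)\<close>, where \<open>u = ln |\<zeta>|\<close> and \<open>t\<close> is the argument,
  which lies between \<open>- pi / 2\<close> and \<open>pi / 2\<close>. If \<open>|\<zeta>| \<le> 1\<close> the term with \<open>u\<close> only helps. Otherwise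
  \<open>|\<zeta>| < 2 * cos t\<close> forces \<open>|t| < pi / 3\<close> and \<open>u < 1\<close>, so \<open>|Ln \<zeta>| \<le> pi / 2\<close>.
\<close>

lemma norm_powr_Disc_le:
  assumes \<zeta>: "\<zeta> \<in> Disc" and s: "Re s \<ge> 0"
  shows "cmod (\<zeta> powr s) \<le> exp (pi / 2 * cmod s)"
proof -
  have pos: "Re \<zeta> > 0" by (rule Disc_Re_pos[OF \<zeta>])
  have z0: "\<zeta> \<noteq> 0" using pos by auto
  define u where "u = Re (Ln \<zeta>)"
  define t where "t = Im (Ln \<zeta>)"
  have t: "\<bar>t\<bar> < pi / 2" using Re_Ln_pos_lt[OF z0] pos by (simp add: t_def)
  have u: "u = ln (cmod \<zeta>)" using z0 by (simp add: u_def)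
  have "Re (s * Ln \<zeta>) \<le> pi / 2 * cmod s"
  proof (cases "cmod \<zeta> \<le> 1")
    case True
    then have "u \<le> 0" using z0 by (simp add: u)
    then have "Re s * u \<le> 0" using s by (simp add: mult_nonneg_nonpos)
    moreover have "- (Im s * t) \<le> \<bar>Im s\<bar> * \<bar>t\<bar>" using abs_ge_minus_self[of "Im s * t"] by (simp add: abs_mult)
    moreover have "\<bar>Im s\<bar> * \<bar>t\<bar> \<le> cmod s * (pi / 2)" using t by (intro mult_mono abs_Im_le_cmod) auto
    ultimately show ?thesis by (simp add: u_def t_def mult.commute)
  next
    case False
    have "(cmod (\<zeta> - 1))\<^sup>2 < 1" using \<zeta> by (simp add: unit_disc_at_1_def power_less_one_iff)
    then have sq: "(cmod \<zeta>)\<^sup>2 < 2 * Re \<zeta>" by (simp add: cmod_power2 power2_diff)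
    have "\<zeta> = exp (Ln \<zeta>)" using z0 by simp
    then have "Re \<zeta> = exp u * cos t" by (metis Re_exp u_def t_def)
    also have "exp u = cmod \<zeta>" using z0 by (simp add: u)
    finally have Re\<zeta>: "Re \<zeta> = cmod \<zeta> * cos t" .
    have "cmod \<zeta> * cmod \<zeta> < cmod \<zeta> * (2 * cos t)" using sq Re\<zeta> by (simp add: power2_eq_square)
    then have ct: "cmod \<zeta> < 2 * cos t" using False by (simp add: mult_less_cancel_left)
    have t3: "\<bar>t\<bar> < pi / 3"
    proof (rule ccontr)
      assume "\<not> ?thesis"
      then have "cos \<bar>t\<bar> \<le> cos (pi / 3)" using t by (intro cos_monotone_0_pi_le) auto
      then show False using ct False by (simp add: cos_60)
    qed
    have "cmod \<zeta> < 2" using ct cos_le_one[of t] by linarith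
    then have "ln (cmod \<zeta>) \<le> cmod \<zeta> - 1" "cmod \<zeta> - 1 < 1" "0 < ln (cmod \<zeta>)"
      using False ln_le_minus_one[of "cmod \<zeta>"] ln_gt_zero[of "cmod \<zeta>"] z0 by simp_all
    then have u1: "0 < u" "u < 1" unfolding u by auto
    have "(cmod (Ln \<zeta>))\<^sup>2 = u\<^sup>2 + t\<^sup>2" by (simp add: cmod_power2 u_def t_def)
    moreover have "u\<^sup>2 \<le> 1" using u1 by (simp add: power_le_one)
    moreover have "t\<^sup>2 \<le> (pi / 3)\<^sup>2" by (rule abs_le_square_iff[THEN iffD1]) (use t3 in simp)
    moreover have "1 + (pi / 3)\<^sup>2 \<le> (pi / 2)\<^sup>2"
    proof -
      have "3 * 3 \<le> pi * pi" using pi_gt3 by (intro mult_mono) auto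
      then show ?thesis by (simp add: power_divide power2_eq_square)
    qed
    ultimately have "(cmod (Ln \<zeta>))\<^sup>2 \<le> (pi / 2)\<^sup>2" by linarith
    then have "cmod (Ln \<zeta>) \<le> pi / 2" by (rule power2_le_imp_le) simp
    then have le: "cmod s * cmod (Ln \<zeta>) \<le> cmod s * (pi / 2)" by (intro mult_left_mono) auto
    have "Re (s * Ln \<zeta>) \<le> cmod s * cmod (Ln \<zeta>)"
      using complex_Re_le_cmod[of "s * Ln \<zeta>"] by (simp only: norm_mult)
    also note le
    also have "cmod s * (pi / 2) = pi / 2 * cmod s" by (rule mult.commute)
    finally show ?thesis .
  qed
  then show ?thesis using z0 by (simp add: powr_def norm_exp_eq_Re)
qed

text \<open>
  Splitting \<open>\<zeta> powr (cnj z - 1)\<close> as \<open>\<zeta> powr (cnj z - \<delta>) * \<zeta> powr (\<delta> - 1)\<close> separates the growth in \<open>z\<close>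
  from the singularity at \<open>\<zeta> = 0\<close>, which does not depend on \<open>z\<close>.
\<close>

lemma mellin_iso_exponential_type:
  assumes f: "f \<in> bergman"
  shows "exponential_type_at_most (pi / 2) (mellin_iso f)"
  unfolding exponential_type_at_most_def
proof (intro allI impI)
  fix \<delta> \<epsilon> :: real assume \<delta>: "\<delta> > 0" and \<epsilon>: "\<epsilon> > 0"
  define A where "A = sqrt (norm_sq lborel f) * sqrt (norm_sq lborel (power_fun (of_real \<delta>))) / pi / sqrt (2 * pi) * exp (pi / 2 * \<delta>)"
  have A0: "A \<ge> 0" by (simp add: A_def)
  have "cmod (mellin_iso f z) \<le> A * exp ((pi / 2 + \<epsilon>) * cmod z)" if z: "Re z \<ge> \<delta>" for z
  proof -
    have z0: "Re z > 0" using z \<delta> by simp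
    let ?h = "power_fun z" and ?k = "power_fun (of_real \<delta>)"
    let ?E = "exp (pi / 2 * cmod (cnj z - of_real \<delta>))"
    have L: "f \<in> L2 lborel" "?h \<in> L2 lborel" "?k \<in> L2 lborel"
      using f power_fun_bergman[OF z0] power_fun_bergman[of "of_real \<delta>"] \<delta> by (auto simp: bergman_iff_L2)
    have hk: "cmod (?h \<zeta>) \<le> ?E * cmod (?k \<zeta>)" for \<zeta>
    proof (cases "\<zeta> \<in> Disc")
      case True
      have "\<zeta> powr (cnj z - 1) = \<zeta> powr (cnj z - of_real \<delta>) * \<zeta> powr (of_real \<delta> - 1)" by (simp add: powr_add[symmetric])
      moreover have "cmod (\<zeta> powr (cnj z - of_real \<delta>)) \<le> ?E" by (rule norm_powr_Disc_le[OF True]) (use z in simp)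
      ultimately show ?thesis using True by (simp add: power_fun_def zero_ext_def norm_mult mult_right_mono)
    qed (simp add: power_fun_def zero_ext_def)
    have "norm_sq lborel ?h \<le> (LINT \<zeta>|lborel. ?E\<^sup>2 * (cmod (?k \<zeta>))\<^sup>2)"
      unfolding norm_sq_def
    proof (intro integral_mono L2_integrable L integrable_mult_right)
      fix \<zeta> show "(cmod (?h \<zeta>))\<^sup>2 \<le> ?E\<^sup>2 * (cmod (?k \<zeta>))\<^sup>2"
        using power_mono[OF hk[of \<zeta>], of 2] by (simp only: power_mult_distrib) simp
    qed
    also have "\<dots> = ?E\<^sup>2 * norm_sq lborel ?k" by (simp add: norm_sq_def)
    finally have "sqrt (norm_sq lborel ?h) \<le> sqrt (?E\<^sup>2 * norm_sq lborel ?k)" by (rule real_sqrt_le_mono)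
    then have hE: "sqrt (norm_sq lborel ?h) \<le> ?E * sqrt (norm_sq lborel ?k)" by (simp add: real_sqrt_mult)
    have "cmod (cnj z - of_real \<delta>) \<le> cmod z + \<delta>" using norm_triangle_ineq4[of "cnj z" "of_real \<delta>"] \<delta> by simp
    then have "pi / 2 * cmod (cnj z - of_real \<delta>) \<le> pi / 2 * (cmod z + \<delta>)" by (intro mult_left_mono) auto
    also have "\<dots> \<le> pi / 2 * \<delta> + (pi / 2 + \<epsilon>) * cmod z" using \<epsilon> by (simp add: algebra_simps)
    finally have E: "?E \<le> exp (pi / 2 * \<delta>) * exp ((pi / 2 + \<epsilon>) * cmod z)" by (simp add: exp_add[symmetric])
    have "cmod (mellin_iso f z) = cmod (L2_inner lborel f ?h) / pi / sqrt (2 * pi)"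
      unfolding mellin_bergman_inner[OF z0 f] by (simp add: norm_divide norm_mult)
    also have "\<dots> \<le> sqrt (norm_sq lborel f) * sqrt (norm_sq lborel ?h) / pi / sqrt (2 * pi)"
      by (intro divide_right_mono L2_Cauchy_Schwarz L) auto
    also have "\<dots> \<le> sqrt (norm_sq lborel f) * ((exp (pi / 2 * \<delta>) * exp ((pi / 2 + \<epsilon>) * cmod z)) * sqrt (norm_sq lborel ?k)) / pi / sqrt (2 * pi)"
      by (intro divide_right_mono mult_left_mono order_trans[OF hE] mult_right_mono E) auto
    also have "\<dots> = A * exp ((pi / 2 + \<epsilon>) * cmod z)" by (simp add: A_def)
    finally show ?thesis .
  qed
  then show "\<exists>C. \<forall>z. \<delta> \<le> Re z \<longrightarrow> cmod (mellin_iso f z) \<le> C * exp ((pi / 2 + \<epsilon>) * cmod z)" by blast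
qed

lemma polynomials_dense:
  assumes g: "g \<in> H_space" and e: "\<epsilon> > 0"
  shows "\<exists>p. H_norm (\<lambda>z. g z - poly_RHP p z) < \<epsilon>"
proof -
  let ?c = "\<lambda>n. H_inner g (newton n)"
  obtain N where N: "norm (H_norm (\<lambda>z. (\<Sum>n<N. ?c n * newton n z) - g z) - 0) < \<epsilon>"
    using LIMSEQ_D[OF newton_expansion(2)[OF g] e] by blast
  define p where "p = (\<Sum>n<N. smult (?c n) (newton_poly n))"
  have p: "poly_RHP p = (\<lambda>z. \<Sum>n<N. ?c n * newton n z)"
    by (auto simp: p_def newton_def zero_ext_def poly_sum fun_eq_iff)
  have "H_norm (\<lambda>z. g z - poly_RHP p z) = H_norm (\<lambda>z. poly_RHP p z - g z)"
    by (rule H_norm_diff_commute[OF g poly_in_H_space])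
  also have "\<dots> < \<epsilon>" unfolding p using N by simp
  finally show ?thesis by blast
qed

lemma H_space_Hilbert: "complex_hilbert_space H_space H_inner H_norm"
  unfolding complex_hilbert_space_def
proof (intro conjI ballI allI impI)
  show "(\<lambda>x. 0) \<in> H_space" by (rule H_space_zero)
next
  fix f g a b assume "f \<in> H_space" "g \<in> H_space"
  then show "(\<lambda>x. a * f x + b * g x) \<in> H_space" by (rule H_space_lincomb)
next
  fix f g h a b assume "f \<in> H_space" "g \<in> H_space" "h \<in> H_space"
  then show "H_inner (\<lambda>x. a * f x + b * g x) h = a * H_inner f h + b * H_inner g h" by (rule H_inner_lincomb_left)
next
  fix f g assume "f \<in> H_space" "g \<in> H_space"
  then show "H_inner g f = cnj (H_inner f g)" by (rule H_inner_commute)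
next
  fix f assume f: "f \<in> H_space"
  show "0 \<le> H_norm f" by (rule H_norm_nonneg[OF f])
  show "H_inner f f = complex_of_real ((H_norm f)\<^sup>2)" by (rule H_inner_self[OF f])
  show "f = (\<lambda>x. 0)" if "H_norm f = 0" by (rule H_norm_eq_0[OF f that])
next
  fix s assume s: "(\<forall>n. s n \<in> H_space) \<and> (\<forall>\<epsilon>>0. \<exists>N::nat. \<forall>m\<ge>N. \<forall>n\<ge>N. H_norm (\<lambda>x. s m x - s n x) < \<epsilon>)"
  show "\<exists>l\<in>H_space. (\<lambda>n. H_norm (\<lambda>x. s n x - l x)) \<longlonglongrightarrow> 0"
    by (rule H_space_complete) (use s in blast)+
qed

theorem theorem4:
  shows "surjective_isometry bergman bergman_norm H_space H_norm
           (\<lambda>f z. mellin_bergman f z / of_real (sqrt (2 * pi)))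
       \<and> (\<forall>g\<in>H_space. g holomorphic_on right_half_plane \<and> exponential_type_at_most (pi / 2) g)
       \<and> (\<forall>p :: complex poly. zero_ext right_half_plane (poly p) \<in> H_space)
       \<and> (\<forall>g\<in>H_space. \<forall>\<epsilon>>0. \<exists>p :: complex poly.
            H_norm (\<lambda>z. g z - zero_ext right_half_plane (poly p) z) < \<epsilon>)
       \<and> complex_hilbert_space H_space H_inner H_norm
       \<and> reproducing_kernel right_half_plane H_space H_inner
           (\<lambda>z w. 1 / (2 * of_real pi) * (Gamma (z + cnj w) / (Gamma (1 + z) * Gamma (1 + cnj w))))"
proof (intro conjI ballI allI impI)
  show "surjective_isometry bergman bergman_norm H_space H_norm
           (\<lambda>f z. mellin_bergman f z / of_real (sqrt (2 * pi)))"
    unfolding surjective_isometry_def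
  proof (intro conjI ballI allI)
    show "mellin_iso (\<lambda>z. a * f z + b * g z) = (\<lambda>z. a * mellin_iso f z + b * mellin_iso g z)"
      if "f \<in> bergman" "g \<in> bergman" for f g a b
      by (rule mellin_iso_lincomb[OF that])
    show "mellin_iso ` bergman = H_space"
      using mellin_iso_in_H_space(1) mellin_iso_surj by blast
    show "H_norm (mellin_iso f) = bergman_norm f" if "f \<in> bergman" for f
      by (rule mellin_iso_in_H_space(2)[OF that])
  qed
next
  fix g assume g: "g \<in> H_space"
  show "g holomorphic_on RHP" using H_space_holo[OF g] by (simp add: holo_space_def)
  show "exponential_type_at_most (pi / 2) g"
    using mellin_iso_surj[OF g] mellin_iso_exponential_type by blast
next
  show "poly_RHP p \<in> H_space" for p by (rule poly_in_H_space)
next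
  show "\<exists>p. H_norm (\<lambda>z. g z - poly_RHP p z) < \<epsilon>" if "g \<in> H_space" "\<epsilon> > 0" for g \<epsilon>
    by (rule polynomials_dense[OF that])
next
  show "complex_hilbert_space H_space H_inner H_norm" by (rule H_space_Hilbert)
next
  show "reproducing_kernel RHP H_space H_inner
           (\<lambda>z w. 1 / (2 * of_real pi) * (Gamma (z + cnj w) / (Gamma (1 + z) * Gamma (1 + cnj w))))"
    unfolding reproducing_kernel_def mellin_kernel_def[symmetric]
    using kernel_in_H_space H_inner_kernel by (simp add: right_half_plane_def)
qed

end
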